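(* Let $T>1$, let $e=(1,0,0)\in\mathbb{R}^3$, and let $p\in\{1,2,3\}$. For $k=1,2$, let $\mathfrak{P}^{(k)}=\big(\beta^{(k)}_{ij}\big)_{1\le i,j\le 2}\in\mathcal{A}_p$ (with $\mathcal{A}_1,\mathcal{A}_2,\mathcal{A}_3$ the admissible classes of $2\times2$ matrix-valued functions on $\mathbb{R}^3$ defined in the context) have real-valued entries $\beta^{(k)}_{ij}\in C^\infty(\mathbb{R}^3)$, and let $\overrightarrow{U}^{(k)}=\begin{bmatrix} U^{(k)}_1 \\ U^{(k)}_2 \end{bmatrix}$ solve the initial value problem $$\begin{cases}\left(\Box I_{2\times 2}-\mathfrak{P}^{(k)}(x)\right)\overrightarrow{U}^{(k)}(t,x)=\delta(t,x)\begin{bmatrix}1\\1\end{bmatrix}, & (t,x)\in\mathbb{R}\times\mathbb{R}^3,\\ \overrightarrow{U}^{(k)}(t,x)=\overrightarrow{0}, & (t,x)\in(-\infty,0)\times\mathbb{R}^3.\end{cases}$$ Assume further that for $k=1,2$ and $1\le i,j\le2$ there is a function $b^{(k)}_{ij}$ on $[1,\infty)$ with $\beta^{(k)}_{ij}(x)=b^{(k)}_{ij}(|x|+|x-e|)$ for every $x\in\mathbb{R}^3$. If $$\overrightarrow{U}^{(1)}(t,e)=\overrightarrow{U}^{(2)}(t,e)\quad\text{for each } t\in(0,T],$$ then $\mathfrak{P}^{(1)}(x)=\mathfrak{P}^{(2)}(x)$ for every $x\in\mathbb{R}^3$ with $|x|+|x-e|\le T$.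
   Context: Admissible classes. $\mathcal{A}_1$ is the set of matrix functions $\mathfrak{P}=(\beta_{ij})$ with $\beta_{11}=\beta_{12}=\beta_{21}=\beta_{22}$. $\mathcal{A}_2$ is the set of matrix functions $\begin{bmatrix}\beta&\beta_{12}\\ \beta_{21}&\beta\end{bmatrix}$ in which the off-diagonal entries $\beta_{12},\beta_{21}$ are prescribed (fixed, known functions, the same for all members of the class, hence the same for $k=1$ and $k=2$) while $\beta$ is an arbitrary unknown function. $\mathcal{A}_3$ is the set of matrix functions $\begin{bmatrix}\beta_{11}&\beta\\ \beta&\beta_{22}\end{bmatrix}$ in which the diagonal entries $\beta_{11},\beta_{22}$ are prescribed (the same for $k=1$ and $k=2$) while $\beta$ is an arbitrary unknown function. Here $\Box=\partial_t^2-\Delta_x$ is the wave operator on $\mathbb{R}\times\mathbb{R}^3$, $I_{2\times2}$ is the identity matrix, and $\delta(t,x)$ is the Dirac delta distribution on $\mathbb{R}\times\mathbb{R}^3$ concentrated at $(t,x)=(0,0)$. The initial value problem is understood in the sense of distributions. Its unique solution has the form $$\overrightarrow{U}^{(k)}(t,x)=\frac{\delta(t-|x|)}{4\pi|x|}\begin{bmatrix}1\\1\end{bmatrix}+\mathscr{H}(t-|x|)\,\overrightarrow{R}^{(k)}(t,x),$$ where $\mathscr{H}$ is the Heaviside function and $\overrightarrow{R}^{(k)}$ is a $C^1$ solution in the region $t>|x|$ (up to the cone $t=|x|$) of $(\Box I_{2\times2}-\mathfrak{P}^{(k)})\overrightarrow{R}^{(k)}=\overrightarrow{0}$ with $\overrightarrow{R}^{(k)}(|x|,x)=\frac{1}{8\pi}\int_0^1\mathfrak{P}^{(k)}(sx)\begin{bmatrix}1\\1\end{bmatrix}ds$.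 Both solutions have the same singular term and vanish at $x=e$ for $t<|e|=1$; the equality $\overrightarrow{U}^{(1)}(t,e)=\overrightarrow{U}^{(2)}(t,e)$ for $t\in(0,T]$ is understood as $\overrightarrow{R}^{(1)}(t,e)=\overrightarrow{R}^{(2)}(t,e)$ for all $t\in(1,T]$. *)

theory Defs
  imports "HOL-Analysis.Analysis"
begin

section \<open>Smooth functions and distributions\<close>

definition dir_deriv :: "'a::euclidean_space \<Rightarrow> ('a \<Rightarrow> real) \<Rightarrow> 'a \<Rightarrow> real" where
  "dir_deriv v f = (\<lambda>x. frechet_derivative f (at x) v)"

primrec Ck :: "nat \<Rightarrow> ('a::euclidean_space \<Rightarrow> real) \<Rightarrow> bool" where
  "Ck 0 f \<longleftrightarrow> continuous_on UNIV f"
| "Ck (Suc k) f \<longleftrightarrow> f differentiable_on UNIV \<and> (\<forall>b\<in>Basis. Ck k (dir_deriv b f))"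

definition smooth :: "('a::euclidean_space \<Rightarrow> real) \<Rightarrow> bool" where
  "smooth f \<longleftrightarrow> (\<forall>k. Ck k f)"

definition supp :: "('a::euclidean_space \<Rightarrow> real) \<Rightarrow> 'a set" where
  "supp f = closure {x. f x \<noteq> 0}"

definition test_fun :: "('a::euclidean_space \<Rightarrow> real) \<Rightarrow> bool" where
  "test_fun \<phi> \<longleftrightarrow> smooth \<phi> \<and> compact (supp \<phi>)"

text \<open>
  Functionals are total on \<open>'a \<Rightarrow> real\<close>, but only their values on test functions are
  meaningful; no condition below refers to other values.
\<close>

type_synonym 'a functional = "('a \<Rightarrow> real) \<Rightarrow> real"

text \<open>
  The last conjunct is continuity on \<open>C\<^sub>c\<^sup>\<infinity>\<close>, as the usual seminorm estimate. A list \<open>bs\<close> of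
  basis vectors encodes an iterated partial derivative of order \<open>length bs\<close>.
\<close>

definition distribution :: "'a::euclidean_space functional \<Rightarrow> bool" where
  "distribution u \<longleftrightarrow>
     (\<forall>\<phi> \<psi>. test_fun \<phi> \<longrightarrow> test_fun \<psi> \<longrightarrow> u (\<lambda>z. \<phi> z + \<psi> z) = u \<phi> + u \<psi>) \<and>
     (\<forall>c \<phi>. test_fun \<phi> \<longrightarrow> u (\<lambda>z. c * \<phi> z) = c * u \<phi>) \<and>
     (\<forall>K. compact K \<longrightarrow> (\<exists>C N. \<forall>\<phi>. test_fun \<phi> \<longrightarrow> supp \<phi> \<subseteq> K \<longrightarrow>
        \<bar>u \<phi>\<bar> \<le> C * (\<Sum>bs | set bs \<subseteq> Basis \<and> length bs \<le> N.
                     SUP z. \<bar>foldr dir_deriv bs \<phi> z\<bar>)))"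

definition dist_deriv :: "'a::euclidean_space \<Rightarrow> 'a functional \<Rightarrow> 'a functional" where
  "dist_deriv v u = (\<lambda>\<phi>. - u (dir_deriv v \<phi>))"

definition dist_mult :: "('a::euclidean_space \<Rightarrow> real) \<Rightarrow> 'a functional \<Rightarrow> 'a functional" where
  "dist_mult f u = (\<lambda>\<phi>. u (\<lambda>z. f z * \<phi> z))"

definition dist_of_fun :: "('a::euclidean_space \<Rightarrow> real) \<Rightarrow> 'a functional" where
  "dist_of_fun f = (\<lambda>\<phi>. LINT z|lborel. f z * \<phi> z)"

definition dirac :: "'a::euclidean_space functional" where
  "dirac = (\<lambda>\<phi>. \<phi> 0)"

definition dist_vanishes_on :: "'a::euclidean_space set \<Rightarrow> 'a functional \<Rightarrow> bool" where
  "dist_vanishes_on S u \<longleftrightarrow> (\<forall>\<phi>. test_fun \<phi> \<longrightarrow> supp \<phi> \<subseteq> S \<longrightarrow> u \<phi> = 0)"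

section \<open>The point source problem\<close>

text \<open>Points of space-time are pairs \<open>(t, x)\<close>.\<close>

type_synonym spacetime = "real \<times> (real^3)"

definition dist_box :: "spacetime functional \<Rightarrow> spacetime functional" where
  "dist_box u = (\<lambda>\<phi>. dist_deriv (1, 0) (dist_deriv (1, 0) u) \<phi>
                   - (\<Sum>b\<in>Basis. dist_deriv (0, b) (dist_deriv (0, b) u) \<phi>))"

definition solves_ivp :: "(real^3 \<Rightarrow> real^2^2) \<Rightarrow> (spacetime functional)^2 \<Rightarrow> bool" where
  "solves_ivp P U \<longleftrightarrow>
     (\<forall>i. distribution (U $ i)) \<and>
     (\<forall>i \<phi>. test_fun \<phi> \<longrightarrow>
        dist_box (U $ i) \<phi> - (\<Sum>j\<in>UNIV. dist_mult (\<lambda>(t, x). P x $ i $ j) (U $ j) \<phi>) = dirac \<phi>) \<and>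
     (\<forall>i. dist_vanishes_on {(t, x). t < 0} (U $ i))"

definition heaviside :: "real \<Rightarrow> real" where
  "heaviside s = (if 0 \<le> s then 1 else 0)"

text \<open>
  The distribution \<open>\<delta>(t - |x|) / (4 \<pi> |x|)\<close>. The value 0 of the integrand at \<open>x = 0\<close>, due to
  division by zero, is irrelevant.
\<close>

definition cone_delta :: "spacetime functional" where
  "cone_delta = (\<lambda>\<phi>. LINT x|lborel. \<phi> (norm x, x) / (4 * pi * norm x))"

definition C1_up_to_cone :: "(spacetime \<Rightarrow> real^2) \<Rightarrow> bool" where
  "C1_up_to_cone R \<longleftrightarrow>
     continuous_on {(t, x). norm x \<le> t} R \<and>
     (\<exists>D :: spacetime \<Rightarrow> spacetime \<Rightarrow>\<^sub>L (real^2). continuous_on {(t, x). norm x \<le> t} D \<and>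
        (\<forall>z\<in>{(t, x). norm x < t}. (R has_derivative blinfun_apply (D z)) (at z)))"

text \<open>
  \<open>R\<close> is the regular part of \<open>U\<close> in
  \<open>U = \<delta>(t - |x|) / (4 \<pi> |x|) (1, 1) + H(t - |x|) R\<close>.
  This determines \<open>R\<close> on \<open>|x| \<le> t\<close>. If \<open>U\<close> solves the initial value problem for \<open>P\<close>, it follows
  that \<open>\<box>R = P R\<close> inside the cone and that \<open>R\<close> has boundary values
  \<open>R(|x|, x) = 1 / (8 \<pi>) \<integral>\<^sub>0\<^sup>1 P(s x) (1, 1) ds\<close>, so these are not made part of the definition.
\<close>

definition regular_part :: "(spacetime functional)^2 \<Rightarrow> (spacetime \<Rightarrow> real^2) \<Rightarrow> bool" where
  "regular_part U R \<longleftrightarrow>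
     C1_up_to_cone R \<and>
     (\<forall>i \<phi>. test_fun \<phi> \<longrightarrow>
        (U $ i) \<phi> = cone_delta \<phi>
                   + dist_of_fun (\<lambda>(t, x). heaviside (t - norm x) * R (t, x) $ i) \<phi>)"

section \<open>Admissible classes\<close>

text \<open>
  For \<open>p = 2\<close> the functions \<open>f\<close>, \<open>g\<close> are the prescribed off-diagonal entries, for \<open>p = 3\<close> the
  prescribed diagonal entries; for \<open>p = 1\<close> they are not used.
\<close>

definition admissible ::
  "(real^3 \<Rightarrow> real) \<Rightarrow> (real^3 \<Rightarrow> real) \<Rightarrow> nat \<Rightarrow> (real^3 \<Rightarrow> real^2^2) set" where
  "admissible f g p =
     (if p = 1 then {P. \<exists>\<beta>. \<forall>x. P x = vector [vector [\<beta> x, \<beta> x], vector [\<beta> x, \<beta> x]]}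
      else if p = 2 then {P. \<exists>\<beta>. \<forall>x. P x = vector [vector [\<beta> x, f x], vector [g x, \<beta> x]]}
      else if p = 3 then {P. \<exists>\<beta>. \<forall>x. P x = vector [vector [f x, \<beta> x], vector [\<beta> x, g x]]}
      else {})"

definition e1 :: "real^3" where
  "e1 = vector [1, 0, 0]"

end

theory Submission
  imports Defs
begin

text \<open>The regular parts \<open>R\<^sub>1\<close>, \<open>R\<^sub>2\<close> of the two solutions differ by a function \<open>r\<close> which, extended by zero
  outside the light cone, satisfies a wave equation whose sources are \<open>q\<close> on the cone and
  \<open>q R\<^sub>1 + P\<^sub>2 r\<close> inside it, where \<open>q = P\<^sub>1 - P\<^sub>2\<close>. Testing this with the regularised spherical waves
  \<open>G(t + n) / n\<close>, \<open>n = sqrt (|x - z|\<^sup>2 + \<epsilon>\<^sup>2)\<close>, and letting \<open>\<epsilon> \<rightarrow> 0\<close> yields Kirchhoff's formula for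
  \<open>r\<close> on the line through an arbitrary point \<open>z\<close>, tested against functions of time. No solution of
  an adjoint problem is needed.

  In Kirchhoff's formula the cone source is integrated over the ellipsoids with foci \<open>0\<close> and \<open>z\<close>, and
  the measure \<open>dx / (|x| |x - z|)\<close> is mapped by \<open>|x| + |x - z|\<close> to \<open>2 \<pi> ds\<close> on \<open>s \<ge> |z|\<close>. For \<open>z = e\<close>, where
  \<open>r\<close> vanishes, the leading term is therefore a multiple of the integral of the unknown profile \<open>b\<close>.
  Inserting Kirchhoff's formula at all points \<open>z\<close> into the remaining term and using the same measure
  identity with the foci \<open>x\<close> and \<open>e\<close> bounds that term by the integral of \<open>|b|\<close> over \<open>[1, \<tau>]\<close>. The result
  is a Volterra inequality for \<open>b\<close>, so that \<open>b = 0\<close> on \<open>[1, T]\<close>.\<close>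

section \<open>Smooth functions and cutoffs\<close>

text \<open>The hypothesis on the coefficients makes the leading term one-dimensional: their
  difference is constant on every ellipsoid with foci \<open>0\<close> and \<open>e1\<close>, so the
  data on a time interval see exactly the integral of the profile over it. The obstacle is that the
  data live at one point, while the remainder contains the unknown \<open>r\<close> on the whole
  region where t + |x - e1| is at most \<open>T\<close>; there \<open>r\<close> has to be bounded by
  the profile alone. The formula tested in time gives signed integrals of \<open>r\<close> over time
  intervals, hence all estimates are in \<open>L^1\<close>, and absolute values are recovered by
  subdividing the intervals. Measuring the region by the arrival time at \<open>e1\<close> makes
  \<open>e1\<close> a focus in every integration over observation points. The remainder over
  \<open>(u, v)\<close> then gains a factor \<open>v - u\<close>, and this small factor closes the
  argument. In each admissible class the matrix difference is a scalar times a fixed matrix; its row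
  sums matter because the incident wave is the vector \<open>(1, 1)\<close>.\<close>

lemma dir_deriv_eqI: "(f has_derivative D) (at x) \<Longrightarrow> dir_deriv v f x = D v"
  unfolding dir_deriv_def using frechet_derivative_at by metis

lemma Ck_SucD: "Ck (Suc k) f \<Longrightarrow> Ck k f"
proof (induction k arbitrary: f)
  case 0
  then show ?case by (simp add: differentiable_imp_continuous_on)
next
  case (Suc k)
  then show ?case by (simp only: Ck.simps) blast
qed

lemma Ck_Suc_has_derivative:
  "Ck (Suc k) f \<Longrightarrow> (f has_derivative (\<lambda>v. dir_deriv v f x)) (at x)"
  by (simp add: dir_deriv_def differentiable_on_def frechet_derivative_works[symmetric])

lemma Ck_SucI:
  assumes "\<And>x. (f has_derivative D x) (at x)" "\<And>b. b \<in> Basis \<Longrightarrow> Ck k (\<lambda>x. D x b)"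
  shows "Ck (Suc k) f"
proof -
  have "dir_deriv b f = (\<lambda>x. D x b)" for b
    using assms(1) dir_deriv_eqI by fast
  then show ?thesis
    using assms by (auto simp: differentiable_on_def differentiable_def intro: has_derivative_at_withinI)
qed

lemma Ck_const: "Ck k (\<lambda>x. c)"
proof (induction k arbitrary: c)
  case (Suc k)
  show ?case by (rule Ck_SucI[where D="\<lambda>_ _. 0"]) (auto intro: Suc)
qed auto

lemma Ck_bounded_linear: "bounded_linear f \<Longrightarrow> Ck k f"
proof (cases k)
  case 0
  then show "bounded_linear f \<Longrightarrow> Ck k f" by (simp add: linear_continuous_on)
next
  case (Suc n)
  then show "bounded_linear f \<Longrightarrow> Ck k f"
    by (simp only:) (rule Ck_SucI[where D="\<lambda>_. f"], auto intro: Ck_const bounded_linear_imp_has_derivative)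
qed

lemma Ck_add: "Ck k f \<Longrightarrow> Ck k g \<Longrightarrow> Ck k (\<lambda>x. f x + g x)"
proof (induction k arbitrary: f g)
  case (Suc k)
  show ?case
    by (rule Ck_SucI[where D="\<lambda>x v. dir_deriv v f x + dir_deriv v g x"])
       (use Suc in \<open>auto intro!: has_derivative_add Ck_Suc_has_derivative\<close>)
qed (auto intro: continuous_on_add)

lemma Ck_mult: "Ck k f \<Longrightarrow> Ck k g \<Longrightarrow> Ck k (\<lambda>x. f x * g x)"
proof (induction k arbitrary: f g)
  case (Suc k)
  note [simp del] = Ck.simps
  have "Ck k f" "Ck k g" using Suc.prems Ck_SucD by auto
  moreover have "Ck k (dir_deriv b f)" "Ck k (dir_deriv b g)" if "b \<in> Basis" for b
    using that Suc.prems by (auto simp: Ck.simps)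
  ultimately show ?case
    by (intro Ck_SucI[where D="\<lambda>x v. f x * dir_deriv v g x + dir_deriv v f x * g x"])
       (use Suc in \<open>auto intro!: has_derivative_mult Ck_Suc_has_derivative Ck_add\<close>)
qed (auto intro: continuous_on_mult)

text \<open>The induction on \<open>k\<close> moves to the next derivative of the outer function, so
  the whole tower \<open>D\<close> is given and the claim is proved for all \<open>n\<close> at
  once. The set \<open>S\<close> admits outer functions that are smooth on part of the line only,
  such as powers.\<close>

lemma Ck_compose_real:
  assumes D: "\<And>n y. y \<in> S \<Longrightarrow> (D n has_real_derivative D (Suc n) y) (at y)"
    and gS: "\<And>x. g x \<in> S" and g: "smooth g"
  shows "Ck k (\<lambda>x. D n (g x))"
proof (induction k arbitrary: n)
  have der: "((\<lambda>x. D n (g x)) has_derivative (\<lambda>v. D (Suc n) (g x) * dir_deriv v g x)) (at x)" for n x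
  proof -
    have "(g has_derivative (\<lambda>v. dir_deriv v g x)) (at x)"
      using g Ck_Suc_has_derivative unfolding smooth_def by blast
    from has_derivative_compose[OF this D[OF gS, unfolded has_field_derivative_def]]
    show ?thesis .
  qed
  {
    case 0
    have "continuous_on UNIV (\<lambda>x. D n (g x))"
      by (intro differentiable_imp_continuous_on)
         (use der in \<open>auto simp: differentiable_on_def differentiable_def\<close>)
    then show ?case by simp
  next
    case (Suc k)
    have "Ck k (dir_deriv b g)" if "b \<in> Basis" for b
      using g that unfolding smooth_def by (metis Ck.simps(2))
    then show ?case
      by (intro Ck_SucI[OF der] Ck_mult Suc)
  }
qed

lemma smooth_const: "smooth (\<lambda>x. c)"
  and smooth_bounded_linear: "bounded_linear f \<Longrightarrow> smooth f"
  and smooth_add: "smooth f \<Longrightarrow> smooth g \<Longrightarrow> smooth (\<lambda>x. f x + g x)"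
  and smooth_mult: "smooth f \<Longrightarrow> smooth g \<Longrightarrow> smooth (\<lambda>x. f x * g x)"
  by (auto simp: smooth_def intro: Ck_const Ck_bounded_linear Ck_add Ck_mult)

lemma smooth_compose_real:
  assumes "\<And>n y. y \<in> S \<Longrightarrow> (D n has_real_derivative D (Suc n) y) (at y)"
    and "\<And>x. g x \<in> S" and "smooth g"
  shows "smooth (\<lambda>x. D n (g x))"
  using Ck_compose_real[where D=D and S=S and g=g and n=n] assms by (auto simp: smooth_def)

lemma smooth_diff: "smooth f \<Longrightarrow> smooth g \<Longrightarrow> smooth (\<lambda>x. f x - g x)"
  using smooth_add[of f "\<lambda>x. (-1) * g x"] smooth_mult[OF smooth_const, of g "-1"] by simp

lemma smooth_sum: "(\<And>i. i \<in> I \<Longrightarrow> smooth (f i)) \<Longrightarrow> smooth (\<lambda>x. \<Sum>i\<in>I. f i x)"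
  by (induction I rule: infinite_finite_induct) (auto intro: smooth_const smooth_add)

lemma smooth_dir_deriv: "smooth f \<Longrightarrow> b \<in> Basis \<Longrightarrow> smooth (dir_deriv b f)"
  unfolding smooth_def by (metis Ck.simps(2))

lemma smooth_has_derivative: "smooth f \<Longrightarrow> (f has_derivative (\<lambda>v. dir_deriv v f x)) (at x)"
  using Ck_Suc_has_derivative unfolding smooth_def by blast

lemma smooth_continuous: "smooth f \<Longrightarrow> continuous_on S f"
  unfolding smooth_def using Ck.simps(1) continuous_on_subset by blast

lemma smooth_powr:
  assumes "smooth g" "\<And>x. 0 < g x"
  shows "smooth (\<lambda>x. g x powr a)"
proof -
  define D where "D n y = (\<Prod>i<n. a - real i) * y powr (a - real n)" for n and y :: real
  have "(D n has_real_derivative D (Suc n) y) (at y)" if "y \<in> {0<..}" for n y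
  proof -
    have "((\<lambda>y. y powr (a - real n)) has_real_derivative (a - real n) * y powr (a - real n - 1)) (at y)"
      using has_real_derivative_powr that by simp
    from DERIV_cmult[OF this, of "\<Prod>i<n. a - real i"] show ?thesis
      by (simp add: D_def[abs_def] diff_diff_eq add.commute mult.assoc)
  qed
  then have "smooth (\<lambda>x. D 0 (g x))"
    using assms by (intro smooth_compose_real[where S="{0<..}" and D=D and n=0]) auto
  then show ?thesis by (simp add: D_def)
qed

lemma smooth_real_derivatives:
  fixes G :: "real \<Rightarrow> real"
  assumes "smooth G"
  shows "smooth ((dir_deriv 1 ^^ n) G)"
    and "((dir_deriv 1 ^^ n) G has_real_derivative (dir_deriv 1 ^^ Suc n) G y) (at y)"
proof -
  show *: "smooth ((dir_deriv 1 ^^ n) G)" for n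
    by (induction n) (use assms in \<open>auto intro: smooth_dir_deriv\<close>)
  show "((dir_deriv 1 ^^ n) G has_real_derivative (dir_deriv 1 ^^ Suc n) G y) (at y)"
  proof -
    let ?F = "(dir_deriv 1 ^^ n) G"
    have d: "(?F has_derivative (\<lambda>v. dir_deriv v ?F y)) (at y)"
      by (rule smooth_has_derivative[OF *])
    interpret bounded_linear "\<lambda>v. dir_deriv v ?F y" using d by (rule has_derivative_bounded_linear)
    have "(\<lambda>v. dir_deriv v ?F y) = (*) (dir_deriv 1 ?F y)"
    proof
      fix v
      show "dir_deriv v ?F y = dir_deriv 1 ?F y * v"
        using scaleR[of v 1] unfolding real_scaleR_def mult_1_right by (simp only: mult.commute)
    qed
    with d have "(?F has_derivative (*) (dir_deriv 1 ?F y)) (at y)" by simp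
    then show ?thesis by (simp add: has_field_derivative_def)
  qed
qed

lemma smooth_compose:
  fixes G :: "real \<Rightarrow> real"
  assumes "smooth G" "smooth g"
  shows "smooth (\<lambda>x. G (g x))"
  using smooth_compose_real[where S=UNIV and D="\<lambda>n. (dir_deriv 1 ^^ n) G" and n=0 and g=g]
    smooth_real_derivatives(2)[OF assms(1)] assms(2) by simp

text \<open>The coefficients depend on \<open>x\<close> only; this makes them multipliers for test
  functions on space-time.\<close>

lemma smooth_snd:
  fixes f :: "'b::euclidean_space \<Rightarrow> real"
  assumes "smooth f"
  shows "smooth (\<lambda>z :: 'a::euclidean_space \<times> 'b. f (snd z))"
proof -
  have "Ck k (\<lambda>z :: 'a \<times> 'b. f (snd z))" if "smooth f" for k f
    using that
  proof (induction k arbitrary: f)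
    case 0
    then show ?case
      by (auto intro!: continuous_on_compose2[OF smooth_continuous[of f UNIV]] continuous_intros)
  next
    case (Suc k)
    show ?case
    proof (rule Ck_SucI[where D="\<lambda>z v. dir_deriv (snd v) f (snd z)"])
      fix z :: "'a \<times> 'b"
      show "((\<lambda>z. f (snd z)) has_derivative (\<lambda>v. dir_deriv (snd v) f (snd z))) (at z)"
        by (rule has_derivative_compose[OF has_derivative_snd[OF has_derivative_ident]
              smooth_has_derivative[OF Suc.prems]])
    next
      fix b :: "'a \<times> 'b" assume "b \<in> Basis"
      then consider "snd b = 0" | "snd b \<in> Basis" by (auto simp: Basis_prod_def)
      then show "Ck k (\<lambda>z :: 'a \<times> 'b. dir_deriv (snd b) f (snd z))"
      proof cases
        case 1
        have "dir_deriv 0 f x = 0" for x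
          using smooth_has_derivative[OF Suc.prems, of x]
          by (metis has_derivative_bounded_linear linear_simps(3))
        then show ?thesis using 1 by (simp add: Ck_const)
      next
        case 2
        from Suc.IH[OF smooth_dir_deriv[OF Suc.prems this]] show ?thesis .
      qed
    qed
  qed
  then show ?thesis using assms by (simp add: smooth_def)
qed

section \<open>The flat function exp(-1/x), cutoffs, and approximation of intervals\<close>

fun flat_poly :: "nat \<Rightarrow> real poly" where
  "flat_poly 0 = 1"
| "flat_poly (Suc n) = [:0, 0, 1:] * (flat_poly n - pderiv (flat_poly n))"

text \<open>This is the \<open>n\<close>-th derivative of exp(-1/x), extended by zero.
  Differentiating p(1/x) exp(-1/x) replaces p(y) by y^2 (p(y) - p'(y)), which is the recursion of
  \<open>flat_poly\<close>.\<close>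

definition flat_deriv :: "nat \<Rightarrow> real \<Rightarrow> real" where
  "flat_deriv n x = (if 0 < x then poly (flat_poly n) (inverse x) * exp (- inverse x) else 0)"

lemma poly_times_exp_tendsto_0: "((\<lambda>y. poly p y * exp (- y)) \<longlongrightarrow> (0::real)) at_top"
proof -
  have *: "((\<lambda>y. \<Sum>i\<le>degree p. coeff p i * (y ^ i / exp y)) \<longlongrightarrow> (\<Sum>i\<le>degree p. coeff p i * 0)) at_top"
    by (intro tendsto_intros tendsto_power_div_exp_0)
  moreover have "poly p y * exp (- y) = (\<Sum>i\<le>degree p. coeff p i * (y ^ i / exp y))" for y
    by (simp add: poly_altdef exp_minus divide_inverse sum_distrib_right mult.assoc)
  ultimately show ?thesis by simp
qed

lemma flat_deriv_has_derivative:
  "(flat_deriv n has_real_derivative flat_deriv (Suc n) x) (at x)"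
proof -
  consider "x < 0" | "x = 0" | "x > 0" by linarith
  then show ?thesis
  proof cases
    case 1
    have "((\<lambda>x. 0) has_real_derivative 0) (at x)" by simp
    then have "(flat_deriv n has_real_derivative 0) (at x)"
      by (rule has_field_derivative_transform_within_open[where S="{..<0}"])
         (use 1 in \<open>auto simp: flat_deriv_def\<close>)
    then show ?thesis using 1 by (simp add: flat_deriv_def)
  next
    case 3
    let ?i = "inverse x" and ?p = "flat_poly n"
    have i: "(inverse has_real_derivative - (?i * ?i)) (at x)"
      using DERIV_inverse[of x] 3 by (simp add: numeral_2_eq_2)
    have "((\<lambda>x. poly ?p (inverse x)) has_real_derivative poly (pderiv ?p) ?i * - (?i * ?i)) (at x)"
      by (rule DERIV_chain2[OF poly_DERIV i])
    moreover have "((\<lambda>x. exp (- inverse x)) has_real_derivative exp (- ?i) * - (- (?i * ?i))) (at x)"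
      by (rule DERIV_chain2[OF DERIV_exp DERIV_minus[OF i]])
    ultimately have "((\<lambda>x. poly ?p (inverse x) * exp (- inverse x)) has_real_derivative
        poly (pderiv ?p) ?i * - (?i * ?i) * exp (- ?i) + exp (- ?i) * - (- (?i * ?i)) * poly ?p ?i) (at x)"
      by (rule DERIV_mult)
    moreover have "poly (pderiv ?p) ?i * - (?i * ?i) * exp (- ?i) + exp (- ?i) * - (- (?i * ?i)) * poly ?p ?i
        = flat_deriv (Suc n) x"
      using 3 by (simp add: flat_deriv_def right_diff_distrib left_diff_distrib)
    ultimately have "((\<lambda>x. poly ?p (inverse x) * exp (- inverse x)) has_real_derivative
        flat_deriv (Suc n) x) (at x)" by simp
    then show ?thesis
      by (rule has_field_derivative_transform_within_open[where S="{0<..}"])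
         (use 3 in \<open>auto simp: flat_deriv_def\<close>)
  next
    case 2
    have right: "((\<lambda>y. flat_deriv n y / y) \<longlongrightarrow> 0) (at_right 0)"
    proof -
      \<comment> \<open>Dividing by \<open>y\<close> shifts the coefficients of the polynomial in
        1/y by one, so the difference quotient at 0 is again a polynomial times the
        exponential.\<close>
      have "((\<lambda>y. poly (pCons 0 (flat_poly n)) (inverse y) * exp (- inverse y)) \<longlongrightarrow> 0) (at_right (0::real))"
        by (rule filterlim_compose[OF poly_times_exp_tendsto_0 filterlim_inverse_at_top_right])
      moreover have "\<forall>\<^sub>F y in at_right 0. poly (pCons 0 (flat_poly n)) (inverse y) * exp (- inverse y)
          = flat_deriv n y / y"
        by (rule eventually_mono[OF eventually_at_right_less])
           (simp add: flat_deriv_def divide_inverse)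
      ultimately show ?thesis by (rule Lim_transform_eventually)
    qed
    have left: "((\<lambda>y. flat_deriv n y / y) \<longlongrightarrow> 0) (at_left 0)"
      by (rule Lim_transform_eventually[OF tendsto_const])
         (auto simp: eventually_at_filter flat_deriv_def)
    have "((\<lambda>y. flat_deriv n y / y) \<longlongrightarrow> 0) (at 0)"
      using left right by (rule filterlim_split_at)
    then show ?thesis using 2
      by (simp add: has_field_derivative_iff flat_deriv_def)
  qed
qed

lemma smooth_flat: "smooth g \<Longrightarrow> smooth (\<lambda>x. flat_deriv 0 (g x))"
  using smooth_compose_real[where S=UNIV and D=flat_deriv and n=0] flat_deriv_has_derivative by simp

lemma flat_eq: "flat_deriv 0 x = (if 0 < x then exp (- inverse x) else 0)"
  by (simp add: flat_deriv_def)

lemma flat_nonneg: "0 \<le> flat_deriv 0 x" and flat_le_one: "flat_deriv 0 x \<le> 1"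
  by (auto simp: flat_eq)

lemma smooth_step_exists:
  obtains h :: "real \<Rightarrow> real" where "smooth h" "\<And>t. t \<le> -1 \<Longrightarrow> h t = 0" "\<And>t. t \<ge> -1/2 \<Longrightarrow> h t = 1"
proof
  define a where "a = (\<lambda>t::real. flat_deriv 0 (1 + t))"
  define d where "d = (\<lambda>t::real. flat_deriv 0 (1 + t) + flat_deriv 0 (-1/2 - t))"
  have lin: "smooth (\<lambda>t::real. t)" by (intro smooth_bounded_linear bounded_linear_ident)
  have a: "smooth a" unfolding a_def
    by (intro smooth_flat smooth_add smooth_const lin)
  have d: "smooth d" unfolding d_def
    by (intro smooth_flat smooth_add smooth_diff smooth_const lin)
  \<comment> \<open>The arguments \<open>1 + t\<close> and \<open>-1/2 - t\<close> add up to 1/2, so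
    at least one of them is positive.\<close>
  have pos: "0 < d t" for t unfolding d_def flat_eq
    by (auto intro: add_pos_pos)
  show "smooth (\<lambda>t. a t * d t powr (-1))"
    by (intro smooth_mult a smooth_powr d pos)
  show "a t * d t powr (-1) = 0" if "t \<le> -1" for t using that by (simp add: a_def flat_eq)
  show "a t * d t powr (-1) = 1" if "t \<ge> -1/2" for t
    using that pos[of t] by (simp add: a_def d_def flat_eq powr_minus)
qed

text \<open>All approximants vanish outside the interval itself and stay between 0 and 1, which is
  what dominated convergence asks for when the profile of the wave is replaced by an
  indicator.\<close>

lemma interval_indicator_approx:
  fixes a b :: real
  obtains G :: "nat \<Rightarrow> real \<Rightarrow> real" where "\<And>n. smooth (G n)"
    "\<And>n s. 0 \<le> G n s" "\<And>n s. G n s \<le> 1" "\<And>n s. s \<notin> {a<..<b} \<Longrightarrow> G n s = 0"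
    "\<And>s. (\<lambda>n. G n s) \<longlonglongrightarrow> indicat_real {a<..<b} s"
proof
  define G where "G n s = flat_deriv 0 (real n * (s - a)) * flat_deriv 0 (real n * (b - s))" for n s
  have lin: "smooth (\<lambda>t::real. t)" by (intro smooth_bounded_linear bounded_linear_ident)
  show "smooth (G n)" for n unfolding G_def
    by (intro smooth_flat smooth_mult smooth_diff smooth_const lin)
  show "0 \<le> G n s" for n s by (simp add: G_def flat_eq)
  show "G n s \<le> 1" for n s unfolding G_def by (intro mult_le_one flat_nonneg flat_le_one)
  show "G n s = 0" if "s \<notin> {a<..<b}" for n s
    using that by (auto simp: G_def flat_eq zero_less_mult_iff)
  have lim: "(\<lambda>n. flat_deriv 0 (real n * c)) \<longlonglongrightarrow> 1" if "0 < c" for c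
  proof -
    have "(\<lambda>n. exp (- (inverse c * inverse (real n)))) \<longlonglongrightarrow> exp (- (inverse c * 0))"
      by (intro tendsto_intros lim_inverse_n)
    moreover have "\<forall>\<^sub>F n in sequentially. exp (- (inverse c * inverse (real n))) = flat_deriv 0 (real n * c)"
      by (rule eventually_mono[OF eventually_gt_at_top[of 0]])
         (use that in \<open>simp add: flat_eq mult.commute\<close>)
    ultimately show ?thesis using Lim_transform_eventually by fastforce
  qed
  show "(\<lambda>n. G n s) \<longlonglongrightarrow> indicat_real {a<..<b} s" for s
  proof (cases "s \<in> {a<..<b}")
    case True
    have "(\<lambda>n. G n s) \<longlonglongrightarrow> 1 * 1" unfolding G_def
      by (intro tendsto_mult lim) (use True in auto)
    then show ?thesis using True by simp
  next
    case False
    then show ?thesis using \<open>\<And>n s. s \<notin> {a<..<b} \<Longrightarrow> G n s = 0\<close> by simp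
  qed
qed

section \<open>Integrals over confocal ellipsoids\<close>

lemma lborel_distr_orthogonal:
  fixes f :: "real^'n::{finite,wellorder} \<Rightarrow> real^'n::_"
  assumes f: "orthogonal_transformation f"
  shows "distr lborel borel f = lborel"
proof (rule lborel_eqI[symmetric])
  have cont: "continuous_on UNIV f"
    using orthogonal_transformation_linear[OF f] by (simp add: linear_continuous_on linear_conv_bounded_linear)
  then have meas [measurable]: "f \<in> borel_measurable borel" by (rule borel_measurable_continuous_onI)
  fix l u :: "real^'n::{finite,wellorder}" assume le: "\<And>b. b \<in> Basis \<Longrightarrow> l \<bullet> b \<le> u \<bullet> b"
  obtain g where g: "orthogonal_transformation g" "\<And>x. g (f x) = x" "\<And>x. f (g x) = x"
    using f by (metis bij_inv_eq_iff orthogonal_transformation_bij orthogonal_transformation_inv)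
  have eq: "f -` box l u = g ` box l u"
  proof
    show "f -` box l u \<subseteq> g ` box l u" using g(2) by (metis image_eqI subsetI vimage_eq)
  qed (use g(3) in auto)
  have open_: "open (f -` box l u)" using cont open_vimage[OF open_box] by blast
  then have sets: "f -` box l u \<in> sets borel" by simp
  have m: "g ` box l u \<in> lmeasurable" "measure lebesgue (g ` box l u) = measure lebesgue (box l u)"
    using measurable_orthogonal_image[OF g(1)] measure_orthogonal_image[OF g(1)] by auto
  have "emeasure (distr lborel borel f) (box l u) = emeasure lebesgue (f -` box l u)"
    using sets by (simp add: emeasure_distr)
  also have "\<dots> = ennreal (measure lebesgue (box l u))"
    using m eq emeasure_eq_measure2 by (metis fmeasurable_def emeasure_eq_ennreal_measure mem_Collect_eq top.not_eq_extremum infinity_ennreal_def)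
  also have "\<dots> = (\<Prod>b\<in>Basis. (u - l) \<bullet> b)"
    using le by (simp add: measure_lborel_box_eq)
  finally show "emeasure (distr lborel borel f) (box l u) = (\<Prod>b\<in>Basis. (u - l) \<bullet> b)" .
qed simp

lemma borel_measurable_vector3:
  "(\<lambda>(a, b, c). vector [a, b, c] :: real^3) \<in> borel_measurable borel"
proof -
  have "(\<lambda>(a :: real, b, c). vector [a, b, c] :: real^3)
      = (\<lambda>z. \<chi> i. if i = 1 then fst z else if i = 2 then fst (snd z) else snd (snd z))"
    by (auto simp: fun_eq_iff vec_eq_iff forall_3)
  moreover have "continuous_on UNIV (\<lambda>z :: real \<times> real \<times> real.
      if i = 1 then fst z else if i = 2 then fst (snd z) else snd (snd z))" for i :: 3
    by (cases "i = 1"; cases "i = 2") (auto intro!: continuous_intros)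
  ultimately show ?thesis
    by (auto intro!: borel_measurable_continuous_onI continuous_on_vec_lambda)
qed

lemma lborel_distr_vector3:
  "distr lborel borel (\<lambda>(a, b, c). vector [a, b, c] :: real^3) = lborel"
proof (rule lborel_eqI[symmetric])
  let ?h = "\<lambda>(a :: real, b :: real, c :: real). vector [a, b, c] :: real^3"
  note borel_measurable_vector3[measurable]
  fix l u :: "real^3" assume le: "\<And>b. b \<in> Basis \<Longrightarrow> l \<bullet> b \<le> u \<bullet> b"
  have le': "l $ i \<le> u $ i" for i
    using le[of "axis i 1"] by (simp add: inner_axis)
  have box_Pair: "box (a, b) (a', b') = box a a' \<times> box b b'"
    for a a' :: "'c::euclidean_space" and b b' :: "'d::euclidean_space"
    by (auto simp: box_def Basis_prod_def ball_Un)
  have Times: "emeasure lborel (A \<times> B) = emeasure lborel A * emeasure lborel B"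
    if "open A" "open B" for A :: "'c::euclidean_space set" and B :: "'d::euclidean_space set"
    using lborel.emeasure_pair_measure_Times[of A lborel B] that by (simp add: lborel_prod)
  have eq: "?h -` box l u = box (l$1, l$2, l$3) (u$1, u$2, u$3)"
    by (auto simp: mem_box_cart forall_3 box_Pair)
  have P: "(\<Prod>b\<in>Basis. f b) = f (axis 1 1) * f (axis 2 1) * f (axis 3 1)" for f :: "real^3 \<Rightarrow> real"
  proof -
    have B: "Basis = range (\<lambda>i :: 3. axis i (1::real))" by (auto simp: Basis_vec_def)
    have "inj (\<lambda>i :: 3. axis i (1::real))" by (auto simp: inj_def axis_eq_axis)
    have "(\<Prod>b\<in>Basis. f b) = (\<Prod>i\<in>UNIV. f (axis i (1::real)))"
      unfolding B using prod.reindex[OF \<open>inj _\<close>] by (simp only: o_def)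
    also have "\<dots> = f (axis 1 1) * f (axis 2 1) * f (axis 3 1)"
      unfolding UNIV_3 by (simp add: mult.assoc)
    finally show ?thesis .
  qed
  have "emeasure (distr lborel borel ?h) (box l u) = emeasure lborel (box (l$1, l$2, l$3) (u$1, u$2, u$3))"
    using eq by (simp add: emeasure_distr)
  also have "\<dots> = ennreal ((u$1 - l$1) * (u$2 - l$2) * (u$3 - l$3))"
    using le' by (simp add: box_Pair Times open_Times ennreal_mult mult.assoc)
  also have "\<dots> = (\<Prod>b\<in>Basis. (u - l) \<bullet> b)"
    by (simp add: P inner_axis)
  finally show "emeasure (distr lborel borel ?h) (box l u) = (\<Prod>b\<in>Basis. (u - l) \<bullet> b)" .
qed simp

lemma borel_measurable_fst_snd [measurable]:
  "(fst :: 'a::euclidean_space \<times> 'b::euclidean_space \<Rightarrow> 'a) \<in> borel_measurable borel"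
  "(snd :: 'a \<times> 'b \<Rightarrow> 'b) \<in> borel_measurable borel"
  by (auto intro!: borel_measurable_continuous_onI continuous_intros)

lemma nn_integral_lborel_Pair:
  fixes f :: "'a::euclidean_space \<times> 'b::euclidean_space \<Rightarrow> ennreal"
  assumes "f \<in> borel_measurable borel"
  shows "(\<integral>\<^sup>+ z. f z \<partial>lborel) = (\<integral>\<^sup>+ x. \<integral>\<^sup>+ y. f (x, y) \<partial>lborel \<partial>lborel)"
    and "(\<integral>\<^sup>+ z. f z \<partial>lborel) = (\<integral>\<^sup>+ y. \<integral>\<^sup>+ x. f (x, y) \<partial>lborel \<partial>lborel)"
proof -
  have f: "f \<in> borel_measurable (lborel \<Otimes>\<^sub>M lborel)" using assms by (simp add: lborel_prod)
  show "(\<integral>\<^sup>+ z. f z \<partial>lborel) = (\<integral>\<^sup>+ x. \<integral>\<^sup>+ y. f (x, y) \<partial>lborel \<partial>lborel)"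
    using lborel.nn_integral_fst[OF f] by (simp add: lborel_prod)
  show "(\<integral>\<^sup>+ z. f z \<partial>lborel) = (\<integral>\<^sup>+ y. \<integral>\<^sup>+ x. f (x, y) \<partial>lborel \<partial>lborel)"
    using lborel_pair.nn_integral_snd[OF f] by (simp add: lborel_prod)
qed

text \<open>A disc of squared radius \<open>p\<close> has area pi p, so the squared distance from
  the origin has constant density.\<close>

lemma nn_integral_plane_radial:
  fixes f :: "real \<Rightarrow> ennreal"
  assumes [measurable]: "f \<in> borel_measurable borel"
  shows "(\<integral>\<^sup>+ v. f ((norm (v :: real \<times> real))\<^sup>2) \<partial>lborel) = (\<integral>\<^sup>+ p. ennreal pi * f p * indicator {0..} p \<partial>lborel)"
proof -
  \<comment> \<open>The sign is reversed so that upper rays pull back to discs. These have finite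
    measure, as the comparison of measures on upper rays requires.\<close>
  let ?M = "distr lborel borel (\<lambda>v :: real \<times> real. - ((norm v)\<^sup>2))"
  let ?N = "density lborel (\<lambda>s :: real. ennreal pi * indicator {..0} s)"
  have M: "emeasure ?M {x<..} = ennreal (pi * max 0 (- x))" for x
  proof -
    have "emeasure ?M {x<..} = emeasure lborel ((\<lambda>v :: real \<times> real. - ((norm v)\<^sup>2)) -` {x<..})"
      by (subst emeasure_distr) auto
    also have "(\<lambda>v :: real \<times> real. - ((norm v)\<^sup>2)) -` {x<..} = ball 0 (sqrt (max 0 (- x)))"
    proof -
      have "norm v < sqrt (max 0 (- x)) \<longleftrightarrow> (norm v)\<^sup>2 < max 0 (- x)" for v :: "real \<times> real"
        using real_sqrt_less_iff[of "(norm v)\<^sup>2" "max 0 (- x)"] by simp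
      moreover have "(norm v)\<^sup>2 < max 0 (- x) \<longleftrightarrow> x < - ((norm v)\<^sup>2)" for v :: "real \<times> real"
        using zero_le_power2[of "norm v"] by linarith
      ultimately show ?thesis by auto
    qed
    also have "emeasure lborel \<dots> = ennreal (pi * max 0 (- x))"
      by (subst emeasure_ball) (auto simp: eval_unit_ball_vol)
    finally show ?thesis .
  qed
  have N: "emeasure ?N {x<..} = ennreal (pi * max 0 (- x))" for x
  proof -
    have "emeasure ?N {x<..} = (\<integral>\<^sup>+ s. ennreal pi * indicator {x<..0} s \<partial>lborel)"
      by (subst emeasure_density) (auto intro!: nn_integral_cong split: split_indicator)
    also have "\<dots> = ennreal (pi * max 0 (- x))"
      by (auto simp: nn_integral_cmult ennreal_mult max_def)
    finally show ?thesis .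
  qed
  have eq: "?M = ?N"
    by (rule measure_eqI_lessThan) (simp_all add: M N)
  have "(\<integral>\<^sup>+ v. f ((norm (v :: real \<times> real))\<^sup>2) \<partial>lborel) = (\<integral>\<^sup>+ s. f (- s) \<partial>?M)"
    by (subst nn_integral_distr) auto
  also have "\<dots> = (\<integral>\<^sup>+ s. ennreal pi * indicator {..0} s * f (- s) \<partial>lborel)"
    unfolding eq by (subst nn_integral_density) auto
  also have "\<dots> = (\<integral>\<^sup>+ s. ennreal pi * indicator {..0} (-s) * f s \<partial>lborel)"
    by (subst nn_integral_real_affine[where c="-1" and t=0]) auto
  also have "\<dots> = (\<integral>\<^sup>+ p. ennreal pi * f p * indicator {0..} p \<partial>lborel)"
    by (intro nn_integral_cong) (auto split: split_indicator)
  finally show ?thesis .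
qed

lemma nn_integral_incseq_cover:
  fixes f :: "real \<Rightarrow> ennreal"
  assumes [measurable]: "f \<in> borel_measurable borel"
    and S: "\<And>n::nat. S n \<in> sets borel" "incseq S"
  shows "(\<lambda>n. \<integral>\<^sup>+ x. f x * indicator (S n) x \<partial>lborel) \<longlonglongrightarrow> (\<integral>\<^sup>+ x. f x * indicator (\<Union>n. S n) x \<partial>lborel)"
proof (rule nn_integral_LIMSEQ)
  note S(1)[measurable]
  show "incseq (\<lambda>n x. f x * indicator (S n) x)"
    using S(2) by (auto simp: incseq_def le_fun_def split: split_indicator)
  show "(\<lambda>x. f x * indicator (S n) x) \<in> borel_measurable lborel" for n by measurable
  show "(\<lambda>n. f x * indicator (S n) x) \<longlonglongrightarrow> f x * indicator (\<Union>n. S n) x" for x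
  proof (cases "x \<in> (\<Union>n. S n)")
    case True
    then obtain m where "x \<in> S m" by blast
    then have "\<forall>n\<ge>m. x \<in> S n" using S(2) by (auto simp: incseq_def)
    then have "\<forall>\<^sub>F n in sequentially. f x * indicator (S n) x = f x * indicator (\<Union>n. S n) x"
      using True by (intro eventually_sequentiallyI[of m]) auto
    then show ?thesis by (rule tendsto_eventually)
  qed auto
qed

text \<open>On a slice at axial coordinate \<open>y\<close>, with \<open>p\<close> the squared
  distance from the axis, the sum of the focal distances has derivative (1/a + 1/c)/2 = (a + c)/(2 a
  c). Hence dp/(a c) becomes 2 ds/s. The slices through the foci are excluded because
  \<open>a\<close> or \<open>c\<close> vanishes there at \<open>p = 0\<close>.\<close>

lemma nn_integral_profile_substitution:
  fixes G :: "real \<Rightarrow> ennreal" and y d :: real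
  assumes [measurable]: "G \<in> borel_measurable borel" and y: "y \<noteq> 0" "y \<noteq> d"
  defines "a \<equiv> \<lambda>p. sqrt (y\<^sup>2 + p)" and "c \<equiv> \<lambda>p. sqrt ((y - d)\<^sup>2 + p)"
  shows "(\<integral>\<^sup>+ p. G (a p + c p) * ennreal (1 / (a p * c p)) * indicator {0..} p \<partial>lborel)
       = (\<integral>\<^sup>+ s. G s * ennreal (2 / s) * indicator {\<bar>y\<bar> + \<bar>y - d\<bar>..} s \<partial>lborel)"
proof -
  define g where "g p = a p + c p" for p
  define g' where "g' p = (1 / a p + 1 / c p) / 2" for p
  have pos: "0 < y\<^sup>2" "0 < (y - d)\<^sup>2" using y by auto
  have apos: "0 < a p" "0 < c p" if "0 \<le> p" for p
    using add_pos_nonneg[OF pos(1) that] add_pos_nonneg[OF pos(2) that] by (simp_all add: a_def c_def)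
  have root: "((\<lambda>p. sqrt (k + p)) has_real_derivative 1 / (2 * sqrt (k + p))) (at p)" if "0 < k + p" for k p
  proof -
    have "((\<lambda>p. k + p) has_real_derivative 1) (at p)" by (auto intro!: derivative_eq_intros)
    from DERIV_chain2[where f=sqrt and g="\<lambda>p. k + p", OF DERIV_real_sqrt[OF that] this]
    show ?thesis by (simp add: field_simps)
  qed
  have g0: "g 0 = \<bar>y\<bar> + \<bar>y - d\<bar>" by (simp add: g_def a_def c_def)
  have mono: "mono g" unfolding g_def a_def c_def by (auto intro!: monoI add_mono)
  have ga: "sqrt p \<le> g p" if "0 \<le> p" for p
  proof -
    have "sqrt p \<le> a p" unfolding a_def by (rule real_sqrt_le_mono) simp
    then show ?thesis using apos(2)[OF that] by (simp add: g_def)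
  qed
  let ?f = "\<lambda>s. G s * ennreal (2 / s)"
  have step: "(\<integral>\<^sup>+ s. ?f s * indicator {g 0..g (real (Suc n))} s \<partial>lborel)
      = (\<integral>\<^sup>+ p. G (g p) * ennreal (1 / (a p * c p)) * indicator {0..real (Suc n)} p \<partial>lborel)" for n
  proof -
    have "(\<integral>\<^sup>+ s. ?f s * indicator {g 0..g (real (Suc n))} s \<partial>lborel)
      = (\<integral>\<^sup>+ p. ?f (g p) * g' p * indicator {0..real (Suc n)} p \<partial>lborel)"
    proof (rule nn_integral_substitution_aux)
      fix p assume p: "p \<in> {0..real (Suc n)}"
      have "(a has_real_derivative 1 / (2 * a p)) (at p)" "(c has_real_derivative 1 / (2 * c p)) (at p)"
        using root[of "y\<^sup>2" p] root[of "(y - d)\<^sup>2" p] add_pos_nonneg[OF pos(1)] add_pos_nonneg[OF pos(2)] p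
        unfolding a_def c_def by auto
      then have "((\<lambda>p. a p + c p) has_real_derivative 1 / (2 * a p) + 1 / (2 * c p)) (at p)"
        by (rule DERIV_add)
      moreover have "1 / (2 * a p) + 1 / (2 * c p) = g' p" by (simp add: g'_def add_divide_distrib)
      ultimately show "(g has_real_derivative g' p) (at p)" by (simp add: g_def[abs_def])
      show "g' p \<ge> 0" using p apos[of p] by (auto simp: g'_def)
    next
      have "continuous_on {0..real (Suc n)} (\<lambda>p. (1 / a p + 1 / c p) / 2)"
      proof -
        have "continuous_on {0..real (Suc n)} a" "continuous_on {0..real (Suc n)} c"
          unfolding a_def c_def by (auto intro!: continuous_intros)
        moreover have "a p \<noteq> 0" "c p \<noteq> 0" if "p \<in> {0..real (Suc n)}" for p
          using apos[of p] that by auto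
        ultimately show ?thesis by (intro continuous_intros) auto
      qed
      then show "continuous_on {0..real (Suc n)} g'" by (simp add: g'_def[abs_def])
    qed auto
    also have "\<dots> = (\<integral>\<^sup>+ p. G (g p) * ennreal (1 / (a p * c p)) * indicator {0..real (Suc n)} p \<partial>lborel)"
    proof (intro nn_integral_cong)
      fix p
      have "ennreal (2 / g p) * ennreal (g' p) = ennreal (1 / (a p * c p))" if "0 \<le> p"
      proof -
        have "0 < g p" "g' p = g p / (2 * (a p * c p))"
          using apos[OF that] by (auto simp: g'_def g_def field_simps)
        then have "2 / g p * g' p = 1 / (a p * c p)" by simp
        moreover have "ennreal (2 / g p) * ennreal (g' p) = ennreal (2 / g p * g' p)"
          using \<open>0 < g p\<close> apos[OF that] by (intro ennreal_mult[symmetric]) (auto simp: g'_def)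
        ultimately show ?thesis by simp
      qed
      then show "?f (g p) * g' p * indicator {0..real (Suc n)} p
          = G (g p) * ennreal (1 / (a p * c p)) * indicator {0..real (Suc n)} p"
        by (auto split: split_indicator simp: mult.assoc)
    qed
    finally show ?thesis .
  qed
  have U1: "(\<Union>n. {g 0..g (real (Suc n))}) = {g 0..}"
  proof safe
    fix s assume s: "g 0 \<le> s"
    have "0 \<le> s" using s g0 by linarith
    obtain n where "s\<^sup>2 \<le> real n" using real_arch_simple by blast
    then have "s\<^sup>2 \<le> real (Suc n)" by simp
    then have "s \<le> sqrt (real (Suc n))" using \<open>0 \<le> s\<close> by (simp add: real_le_rsqrt)
    then have "s \<in> {g 0..g (real (Suc n))}" using s ga[of "real (Suc n)"] by simp
    then show "s \<in> (\<Union>n. {g 0..g (real (Suc n))})" by blast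
  qed auto
  have U2: "(\<Union>n. {0..real (Suc n)}) = {0..}"
  proof safe
    fix p :: real assume "0 \<le> p"
    obtain n where "p \<le> real n" using real_arch_simple by blast
    then have "p \<in> {0..real (Suc n)}" using \<open>0 \<le> p\<close> by simp
    then show "p \<in> (\<Union>n. {0..real (Suc n)})" by blast
  qed auto
  have inc1: "incseq (\<lambda>n. {g 0..g (real (Suc n))})"
  proof (rule incseq_SucI)
    fix n
    have "g (real (Suc n)) \<le> g (real (Suc (Suc n)))" by (rule monoD[OF mono]) simp
    then show "{g 0..g (real (Suc n))} \<subseteq> {g 0..g (real (Suc (Suc n)))}" by auto
  qed
  have inc2: "incseq (\<lambda>n. {0..real (Suc n)})" by (auto simp: incseq_def)
  have [measurable]: "a \<in> borel_measurable borel" "c \<in> borel_measurable borel" "g \<in> borel_measurable borel"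
    by (auto simp: a_def[abs_def] c_def[abs_def] g_def[abs_def])
  have "(\<lambda>n. \<integral>\<^sup>+ s. ?f s * indicator {g 0..g (real (Suc n))} s \<partial>lborel)
      \<longlonglongrightarrow> (\<integral>\<^sup>+ s. ?f s * indicator {g 0..} s \<partial>lborel)"
    using nn_integral_incseq_cover[OF _ _ inc1, of ?f] unfolding U1 by simp
  moreover have "(\<lambda>n. \<integral>\<^sup>+ s. ?f s * indicator {g 0..g (real (Suc n))} s \<partial>lborel)
      \<longlonglongrightarrow> (\<integral>\<^sup>+ p. G (g p) * ennreal (1 / (a p * c p)) * indicator {0..} p \<partial>lborel)"
    unfolding step
    using nn_integral_incseq_cover[OF _ _ inc2, of "\<lambda>p. G (g p) * ennreal (1 / (a p * c p))"] unfolding U2 by simp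
  ultimately show ?thesis
    unfolding g0[symmetric] by (simp add: LIMSEQ_unique g_def)
qed

text \<open>The length \<open>s\<close> of this set of axial coordinates cancels the factor 1/s from
  the substitution above and leaves a constant density.\<close>

lemma emeasure_two_point_sublevel:
  fixes d s :: real
  assumes "0 \<le> d"
  shows "emeasure lborel {y. \<bar>y\<bar> + \<bar>y - d\<bar> \<le> s} = ennreal s * indicator {d..} s"
proof (cases "d \<le> s")
  case True
  then have "{y. \<bar>y\<bar> + \<bar>y - d\<bar> \<le> s} = {(d - s) / 2..(d + s) / 2}" using assms by auto
  then show ?thesis using True assms by (simp add: field_simps)
next
  case False
  then have "{y. \<bar>y\<bar> + \<bar>y - d\<bar> \<le> s} = {}" using assms by auto
  then show ?thesis using False by simp
qed

lemma nn_integral_foci_axis: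
  fixes G :: "real \<Rightarrow> ennreal"
  assumes G[measurable]: "G \<in> borel_measurable borel" and d: "0 \<le> d"
  shows "(\<integral>\<^sup>+ x. G (norm x + norm (x - d *\<^sub>R axis 1 1)) * ennreal (1 / (norm x * norm (x - d *\<^sub>R axis 1 (1::real) :: real^3))) \<partial>lborel)
    = ennreal (2 * pi) * (\<integral>\<^sup>+ s. G s * indicator {d..} s \<partial>lborel)"
proof -
  let ?h = "\<lambda>(a :: real, b :: real, c :: real). vector [a, b, c] :: real^3"
  let ?F = "\<lambda>y p. G (sqrt (y\<^sup>2 + p) + sqrt ((y - d)\<^sup>2 + p)) * ennreal (1 / (sqrt (y\<^sup>2 + p) * sqrt ((y - d)\<^sup>2 + p)))"
  note borel_measurable_vector3[measurable]
  have [measurable]: "(\<lambda>x. G (norm x + norm (x - d *\<^sub>R axis 1 1)) * ennreal (1 / (norm x * norm (x - d *\<^sub>R axis 1 (1::real) :: real^3)))) \<in> borel_measurable borel"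
    by measurable
  have n1: "norm (?h z) = sqrt ((fst z)\<^sup>2 + (norm (snd z))\<^sup>2)" for z
    by (cases z) (simp add: norm_vec_def L2_set_def sum_3 norm_Pair add.assoc)
  have n2: "norm (?h z - d *\<^sub>R axis 1 1) = sqrt ((fst z - d)\<^sup>2 + (norm (snd z))\<^sup>2)" for z
    by (cases z) (simp add: norm_vec_def L2_set_def sum_3 norm_Pair axis_def add.assoc)
  have "(\<integral>\<^sup>+ x. G (norm x + norm (x - d *\<^sub>R axis 1 1)) * ennreal (1 / (norm x * norm (x - d *\<^sub>R axis 1 (1::real) :: real^3))) \<partial>lborel)
    = (\<integral>\<^sup>+ z. ?F (fst z) ((norm (snd z :: real \<times> real))\<^sup>2) \<partial>lborel)"
    unfolding lborel_distr_vector3[symmetric]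
    by (subst nn_integral_distr) (measurable, simp only: n1 n2)
  also have "\<dots> = (\<integral>\<^sup>+ y. \<integral>\<^sup>+ v. ?F y ((norm (v :: real \<times> real))\<^sup>2) \<partial>lborel \<partial>lborel)"
    by (subst nn_integral_lborel_Pair(1)) auto
  also have "\<dots> = (\<integral>\<^sup>+ y. \<integral>\<^sup>+ p. ennreal pi * ?F y p * indicator {0..} p \<partial>lborel \<partial>lborel)"
    by (intro nn_integral_cong nn_integral_plane_radial) measurable
  also have "\<dots> = (\<integral>\<^sup>+ y. \<integral>\<^sup>+ s. ennreal pi * (G s * ennreal (2 / s) * indicator {\<bar>y\<bar> + \<bar>y - d\<bar>..} s) \<partial>lborel \<partial>lborel)"
  proof (rule nn_integral_cong_AE)
    have "AE y in lborel. y \<noteq> (0::real)" "AE y in lborel. y \<noteq> d" by (rule AE_lborel_singleton)+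
    then show "AE y in lborel. (\<integral>\<^sup>+ p. ennreal pi * ?F y p * indicator {0..} p \<partial>lborel)
        = (\<integral>\<^sup>+ s. ennreal pi * (G s * ennreal (2 / s) * indicator {\<bar>y\<bar> + \<bar>y - d\<bar>..} s) \<partial>lborel)"
    proof eventually_elim
      case (elim y)
      then show ?case
        using nn_integral_profile_substitution[OF G elim]
        by (simp add: nn_integral_cmult mult.assoc)
    qed
  qed
  also have "\<dots> = (\<integral>\<^sup>+ s. \<integral>\<^sup>+ y. ennreal pi * (G s * ennreal (2 / s) * indicator {y. \<bar>y\<bar> + \<bar>y - d\<bar> \<le> s} y) \<partial>lborel \<partial>lborel)"
    by (subst lborel_pair.Fubini') (auto intro!: nn_integral_cong split: split_indicator)
  also have "\<dots> = (\<integral>\<^sup>+ s. ennreal (2 * pi) * (G s * indicator {d..} s) \<partial>lborel)"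
  proof (rule nn_integral_cong_AE)
    \<comment> \<open>For coinciding foci the range contains \<open>s = 0\<close>, where
      \<open>2 / s\<close> is 0 by division by zero and the cancellation fails.\<close>
    have "AE s in lborel. s \<noteq> (0::real)" by (rule AE_lborel_singleton)
    then show "AE s in lborel. (\<integral>\<^sup>+ y. ennreal pi * (G s * ennreal (2 / s) * indicator {y. \<bar>y\<bar> + \<bar>y - d\<bar> \<le> s} y) \<partial>lborel)
        = ennreal (2 * pi) * (G s * indicator {d..} s)"
    proof eventually_elim
      case (elim s)
      have "(\<integral>\<^sup>+ y. ennreal pi * (G s * ennreal (2 / s) * indicator {y. \<bar>y\<bar> + \<bar>y - d\<bar> \<le> s} y) \<partial>lborel)
        = ennreal pi * (G s * ennreal (2 / s)) * emeasure lborel {y. \<bar>y\<bar> + \<bar>y - d\<bar> \<le> s}"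
        by (subst nn_integral_cmult_indicator[symmetric]) (auto simp: mult.assoc)
      also have "\<dots> = ennreal (2 * pi) * (G s * indicator {d..} s)"
      proof (cases "d \<le> s")
        case True
        then have "0 < s" using d elim by simp
        then have "ennreal pi * (ennreal (2 / s) * ennreal s) = ennreal (2 * pi)"
          by (simp add: ennreal_mult[symmetric] field_simps) (simp add: ennreal_mult mult.commute)
        then have "G s * (ennreal pi * (ennreal (2 / s) * ennreal s)) = G s * ennreal (2 * pi)"
          by (rule arg_cong)
        then show ?thesis unfolding emeasure_two_point_sublevel[OF d] using True
          by (simp only: indicator_simps atLeast_iff mult_1_right) (simp only: ac_simps)
      qed (simp add: emeasure_two_point_sublevel[OF d])
      finally show ?case .
    qed
  qed
  also have "\<dots> = ennreal (2 * pi) * (\<integral>\<^sup>+ s. G s * indicator {d..} s \<partial>lborel)"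
    by (rule nn_integral_cmult) auto
  finally show ?thesis .
qed

text \<open>In prolate spheroidal coordinates with foci \<open>p\<close> and \<open>z\<close> the Jacobian is a multiple of the
  product of the focal distances, which explains why the density in \<open>s\<close> is constant.\<close>

lemma nn_integral_foci:
  fixes G :: "real \<Rightarrow> ennreal" and p z :: "real^3"
  assumes G[measurable]: "G \<in> borel_measurable borel"
  shows "(\<integral>\<^sup>+ x. G (norm (x - p) + norm (x - z)) * ennreal (1 / (norm (x - p) * norm (x - z))) \<partial>lborel)
    = ennreal (2 * pi) * (\<integral>\<^sup>+ s. G s * indicator {norm (p - z)..} s \<partial>lborel)"
proof -
  define d where "d = norm (z - p)"
  have "norm (d *\<^sub>R axis 1 1 :: real^3) = norm (z - p)" by (simp add: d_def)
  then obtain f where f: "orthogonal_transformation f" and fz: "f (d *\<^sub>R axis 1 1 :: real^3) = z - p"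
    using orthogonal_transformation_exists by blast
  have lin: "linear f" using f by (rule orthogonal_transformation_linear)
  have [measurable]: "f \<in> borel_measurable borel"
    using lin by (intro borel_measurable_continuous_onI) (simp add: linear_continuous_on linear_conv_bounded_linear)
  have n1: "norm (f x) = norm x" for x using f by (rule orthogonal_transformation_norm)
  have n2: "norm (f x - (z - p)) = norm (x - d *\<^sub>R axis 1 1)" for x
    unfolding fz[symmetric] linear_diff[OF lin, symmetric] by (rule n1)
  have "(\<integral>\<^sup>+ x. G (norm (x - p) + norm (x - z)) * ennreal (1 / (norm (x - p) * norm (x - z))) \<partial>lborel)
    = (\<integral>\<^sup>+ x. G (norm (x - p) + norm (x - z)) * ennreal (1 / (norm (x - p) * norm (x - z))) \<partial>distr lborel borel ((+) p))"
    by (simp add: lborel_distr_plus)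
  also have "\<dots> = (\<integral>\<^sup>+ x. G (norm x + norm (x - (z - p))) * ennreal (1 / (norm x * norm (x - (z - p)))) \<partial>lborel)"
    by (subst nn_integral_distr) (auto simp: algebra_simps intro!: nn_integral_cong)
  also have "\<dots> = (\<integral>\<^sup>+ x. G (norm x + norm (x - (z - p))) * ennreal (1 / (norm x * norm (x - (z - p)))) \<partial>distr lborel borel f)"
    by (simp add: lborel_distr_orthogonal[OF f])
  also have "\<dots> = (\<integral>\<^sup>+ x. G (norm x + norm (x - d *\<^sub>R axis 1 1)) * ennreal (1 / (norm x * norm (x - d *\<^sub>R axis 1 (1::real) :: real^3))) \<partial>lborel)"
    by (subst nn_integral_distr) (auto simp: n1 n2 intro!: nn_integral_cong)
  also have "\<dots> = ennreal (2 * pi) * (\<integral>\<^sup>+ s. G s * indicator {d..} s \<partial>lborel)"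
    by (rule nn_integral_foci_axis) (auto simp: d_def)
  finally show ?thesis by (simp add: d_def norm_minus_commute)
qed

section \<open>The difference of two solutions\<close>

lemma supp_dir_deriv_subset: "supp (dir_deriv v f) \<subseteq> supp f"
proof -
  have "dir_deriv v f x = 0" if "x \<notin> supp f" for x
  proof -
    have "((\<lambda>_. 0) has_derivative (\<lambda>_. 0)) (at x)" by simp
    then have "(f has_derivative (\<lambda>_. 0)) (at x)"
    proof (rule has_derivative_transform_within_open)
      show "open (- supp f)" "x \<in> - supp f" using that by (auto simp: supp_def)
      show "0 = f y" if "y \<in> - supp f" for y
        using that closure_subset[of "{x. f x \<noteq> 0}"] by (auto simp: supp_def)
    qed
    then show ?thesis using dir_deriv_eqI by blast
  qed
  then have "{x. dir_deriv v f x \<noteq> 0} \<subseteq> supp f" by blast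
  then show ?thesis unfolding supp_def[of "dir_deriv v f"]
    by (rule closure_minimal) (simp add: supp_def)
qed

lemma supp_notin: "x \<notin> supp f \<Longrightarrow> f x = 0"
  using closure_subset[of "{x. f x \<noteq> 0}"] by (auto simp: supp_def)

lemma test_funI:
  assumes "smooth f" "compact K" "\<And>x. x \<notin> K \<Longrightarrow> f x = 0"
  shows "test_fun f"
proof -
  have "supp f \<subseteq> K" unfolding supp_def
    using assms(2,3) by (intro closure_minimal) (auto dest: compact_imp_closed)
  then show ?thesis
    using assms(1,2) compact_Int_closed[of K "supp f"] by (simp add: test_fun_def supp_def Int_absorb1)
qed

lemma test_fun_dir_deriv: "test_fun f \<Longrightarrow> b \<in> Basis \<Longrightarrow> test_fun (dir_deriv b f)"
  using supp_dir_deriv_subset[of b f] supp_notin[of _ "dir_deriv b f"]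
  by (intro test_funI[where K="supp f"]) (auto simp: test_fun_def intro: smooth_dir_deriv)

lemma test_fun_mult: "smooth f \<Longrightarrow> test_fun g \<Longrightarrow> test_fun (\<lambda>x. f x * g x)"
  by (intro test_funI[where K="supp g"]) (auto simp: test_fun_def intro: smooth_mult supp_notin)

section \<open>Local integrability of the weights with two foci and with one\<close>

lemma nn_integral_foci_finite:
  fixes p z :: "real^3"
  shows "(\<integral>\<^sup>+ x. indicator {x. norm (x - p) + norm (x - z) \<le> M} x * ennreal (1 / (norm (x - p) * norm (x - z))) \<partial>lborel) < \<infinity>"
proof -
  have "(\<integral>\<^sup>+ x. indicator {x. norm (x - p) + norm (x - z) \<le> M} x * ennreal (1 / (norm (x - p) * norm (x - z))) \<partial>lborel)
    = ennreal (2 * pi) * (\<integral>\<^sup>+ s. indicator {..M} s * indicator {norm (p - z)..} s \<partial>lborel)"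
    by (subst nn_integral_foci[symmetric]) (auto intro!: nn_integral_cong split: split_indicator)
  also have "(\<integral>\<^sup>+ s. indicator {..M} s * indicator {norm (p - z)..} s \<partial>lborel)
      = (\<integral>\<^sup>+ s. indicator {norm (p - z)..M} s \<partial>lborel)"
    by (intro nn_integral_cong) (auto split: split_indicator)
  also have "ennreal (2 * pi) * \<dots> < \<infinity>"
    by (simp add: ennreal_mult_less_top emeasure_lborel_Icc_eq)
  finally show ?thesis .
qed

lemma integrable_foci:
  fixes p z :: "real^3" and f :: "real^3 \<Rightarrow> real"
  assumes [measurable]: "f \<in> borel_measurable borel"
    and bound: "\<And>x. \<bar>f x\<bar> \<le> C" and zero: "\<And>x. norm (x - p) + norm (x - z) > M \<Longrightarrow> f x = 0"
  shows "integrable lborel (\<lambda>x. f x / (norm (x - p) * norm (x - z)))"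
proof (rule integrableI_bounded)
  have C: "0 \<le> C" using bound[of 0] by linarith
  have "(\<integral>\<^sup>+ x. ennreal (norm (f x / (norm (x - p) * norm (x - z)))) \<partial>lborel)
     \<le> (\<integral>\<^sup>+ x. ennreal C * (indicator {x. norm (x - p) + norm (x - z) \<le> M} x * ennreal (1 / (norm (x - p) * norm (x - z)))) \<partial>lborel)"
  proof (intro nn_integral_mono)
    fix x
    show "ennreal (norm (f x / (norm (x - p) * norm (x - z))))
      \<le> ennreal C * (indicator {x. norm (x - p) + norm (x - z) \<le> M} x * ennreal (1 / (norm (x - p) * norm (x - z))))"
    proof (cases "norm (x - p) + norm (x - z) \<le> M")
      case True
      have "norm (f x / (norm (x - p) * norm (x - z))) \<le> C * (1 / (norm (x - p) * norm (x - z)))"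
        using bound[of x] by (auto simp: abs_mult divide_right_mono)
      then show ?thesis using True C by (simp add: ennreal_mult[symmetric] ennreal_leI)
    qed (use zero in auto)
  qed
  also have "\<dots> < \<infinity>"
    using nn_integral_foci_finite[of p z M] by (subst nn_integral_cmult) (auto simp: ennreal_mult_less_top)
  finally show "(\<integral>\<^sup>+ x. ennreal (norm (f x / (norm (x - p) * norm (x - z)))) \<partial>lborel) < \<infinity>" .
qed auto

text \<open>The weight 1/|x - z| is the two-focus weight with both foci at \<open>z\<close>, times
  the factor |x - z|, which is bounded on the support.\<close>

lemma integrable_inverse_norm:
  fixes z :: "real^3" and f :: "real^3 \<Rightarrow> real"
  assumes [measurable]: "f \<in> borel_measurable borel"
    and bound: "\<And>x. \<bar>f x\<bar> \<le> C" and zero: "\<And>x. norm (x - z) > M \<Longrightarrow> f x = 0"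
  shows "integrable lborel (\<lambda>x. f x / norm (x - z))"
proof -
  have "integrable lborel (\<lambda>x. (f x * norm (x - z)) / (norm (x - z) * norm (x - z)))"
  proof (rule integrable_foci[where C="C * max 0 M" and M="2 * M"])
    fix x
    have "\<bar>f x\<bar> * norm (x - z) \<le> C * max 0 M" if "norm (x - z) \<le> M"
      using bound[of x] that by (intro mult_mono) auto
    then show "\<bar>f x * norm (x - z)\<bar> \<le> C * max 0 M"
      using zero[of x] bound[of x] by (cases "norm (x - z) \<le> M") (auto simp: abs_mult)
    show "f x * norm (x - z) = 0" if "norm (x - z) + norm (x - z) > 2 * M"
      using zero[of x] that by auto
  qed measurable
  moreover have "(f x * norm (x - z)) / (norm (x - z) * norm (x - z)) = f x / norm (x - z)" for x
    by (cases "x = z") auto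
  ultimately show ?thesis by simp
qed

section \<open>The solid light cone and the subtraction of the two problems\<close>

definition cone_set :: "spacetime set" where
  "cone_set = {(t, x). norm x \<le> t}"

lemma closed_cone_set: "closed cone_set"
proof -
  have eq: "cone_set = {z :: spacetime. norm (snd z) \<le> fst z}" by (auto simp: cone_set_def)
  show ?thesis unfolding eq by (intro closed_Collect_le continuous_intros)
qed

lemma integrable_cone_test:
  assumes R: "continuous_on cone_set R" and \<phi>: "test_fun \<phi>"
  shows "integrable lborel (\<lambda>z. indicator cone_set z * R z * \<phi> z)"
proof -
  have c: "compact (cone_set \<inter> supp \<phi>)"
    using closed_cone_set \<phi> by (auto simp: test_fun_def closed_Int_compact)
  have "integrable lborel (\<lambda>z. indicator (cone_set \<inter> supp \<phi>) z *\<^sub>R (R z * \<phi> z))"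
    using \<phi> by (intro borel_integrable_compact[OF c] continuous_intros continuous_on_subset[OF R])
       (auto simp: test_fun_def intro: smooth_continuous)
  moreover have "indicator (cone_set \<inter> supp \<phi>) z *\<^sub>R (R z * \<phi> z) = indicator cone_set z * R z * \<phi> z" for z
    using supp_notin[of z \<phi>] by (auto split: split_indicator)
  ultimately show ?thesis by (simp only:)
qed

lemma test_fun_bounded: 
  assumes "test_fun \<phi>"
  obtains C M where "\<And>z. \<bar>\<phi> z\<bar> \<le> C" "\<And>z. norm z > M \<Longrightarrow> \<phi> z = 0"
proof -
  have K: "compact (supp \<phi>)" and s: "smooth \<phi>" using assms by (auto simp: test_fun_def)
  then have "bounded (\<phi> ` supp \<phi>)" "bounded (supp \<phi>)"
    by (auto intro: compact_imp_bounded compact_continuous_image smooth_continuous)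
  then obtain C M where C: "\<And>z. z \<in> supp \<phi> \<Longrightarrow> \<bar>\<phi> z\<bar> \<le> C" and M: "\<And>z. z \<in> supp \<phi> \<Longrightarrow> norm z \<le> M"
    unfolding bounded_iff by fastforce
  have "\<bar>\<phi> z\<bar> \<le> max C 0" for z using C[of z] supp_notin[of z \<phi>] by (cases "z \<in> supp \<phi>") auto
  moreover have "\<phi> z = 0" if "norm z > M" for z using M[of z] that supp_notin[of z \<phi>] by fastforce
  ultimately show ?thesis using that by blast
qed

lemma integrable_cone_delta:
  assumes "test_fun (\<phi> :: spacetime \<Rightarrow> real)"
  shows "integrable lborel (\<lambda>x. \<phi> (norm x, x) / (4 * pi * norm x))"
proof -
  obtain C M where C: "\<And>z. \<bar>\<phi> z\<bar> \<le> C" and M: "\<And>z. norm z > M \<Longrightarrow> \<phi> z = 0"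
    using test_fun_bounded[OF assms] by blast
  have "continuous_on UNIV \<phi>" using assms by (auto simp: test_fun_def smooth_continuous)
  then have "continuous_on UNIV (\<lambda>x :: real^3. \<phi> (norm x, x))"
    by (rule continuous_on_compose2) (auto intro!: continuous_intros)
  then have m: "(\<lambda>x :: real^3. \<phi> (norm x, x)) \<in> borel_measurable borel" by (rule borel_measurable_continuous_onI)
  have "\<phi> (norm x, x) = 0" if "norm x > M" for x
    using that norm_snd_le[of x "norm x"] by (intro M) (metis less_le_trans)
  then have "integrable lborel (\<lambda>x. \<phi> (norm x, x) / norm (x - 0))"
    using C by (intro integrable_inverse_norm[OF m, where C=C and M=M]) auto
  from integrable_divide[OF this, of "4 * pi"] show ?thesis by (simp add: mult.commute)
qed

definition dalembert :: "(spacetime \<Rightarrow> real) \<Rightarrow> spacetime \<Rightarrow> real" where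
  "dalembert \<phi> z = dir_deriv (1, 0) (dir_deriv (1, 0) \<phi>) z
     - (\<Sum>b\<in>Basis. dir_deriv (0, b) (dir_deriv (0, b) \<phi>) z)"

text \<open>Subtracting the two problems removes both the source and the singular part.\<close>

lemma difference_identity:
  fixes P1 P2 :: "real^3 \<Rightarrow> real^2^2" and i :: 2
  assumes P: "\<And>i j. smooth (\<lambda>x. P1 x $ i $ j)" "\<And>i j. smooth (\<lambda>x. P2 x $ i $ j)"
    and S: "solves_ivp P1 U1" "solves_ivp P2 U2"
    and R: "regular_part U1 R1" "regular_part U2 R2"
    and \<phi>: "test_fun \<phi>"
  shows "(LINT z|lborel. indicator cone_set z * (R1 z $ i - R2 z $ i) * dalembert \<phi> z)
     = (LINT x|lborel. (\<Sum>j\<in>UNIV. P1 x $ i $ j - P2 x $ i $ j) * \<phi> (norm x, x) / (4 * pi * norm x))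
     + (LINT z|lborel. indicator cone_set z
          * (\<Sum>j\<in>UNIV. P1 (snd z) $ i $ j * R1 z $ j - P2 (snd z) $ i $ j * R2 z $ j) * \<phi> z)"
proof -
  have heav: "(case z of (t, x) \<Rightarrow> heaviside (t - norm x) * R (t, x) $ i) = indicator cone_set z * R z $ i"
    for z R and i :: 2
    by (auto simp: heaviside_def cone_set_def split: prod.split split_indicator)
  have cR: "continuous_on cone_set (\<lambda>z. R1 z $ j)" "continuous_on cone_set (\<lambda>z. R2 z $ j)" for j
    using R by (auto simp: regular_part_def C1_up_to_cone_def cone_set_def intro!: continuous_intros)
  have val: "(U1 $ j) \<psi> = cone_delta \<psi> + (LINT z|lborel. indicator cone_set z * R1 z $ j * \<psi> z)"
            "(U2 $ j) \<psi> = cone_delta \<psi> + (LINT z|lborel. indicator cone_set z * R2 z $ j * \<psi> z)"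
    if "test_fun \<psi>" for j \<psi>
    using R that by (simp_all add: regular_part_def dist_of_fun_def heav)
  have int: "integrable lborel (\<lambda>z. indicator cone_set z * R1 z $ j * \<psi> z)"
            "integrable lborel (\<lambda>z. indicator cone_set z * R2 z $ j * \<psi> z)" if "test_fun \<psi>" for j \<psi>
    using integrable_cone_test cR that by blast+
  let ?I = "\<lambda>j \<psi>. LINT z|lborel. indicator cone_set z * (R1 z $ j - R2 z $ j) * \<psi> z"
  have intd: "integrable lborel (\<lambda>z. indicator cone_set z * (R1 z $ j - R2 z $ j) * \<psi> z)"
    if "test_fun \<psi>" for j \<psi>
    using Bochner_Integration.integrable_diff[OF int[OF that]] by (simp add: algebra_simps)
  have diff: "(U1 $ j) \<psi> - (U2 $ j) \<psi> = ?I j \<psi>" if "test_fun \<psi>" for j \<psi>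
    using Bochner_Integration.integral_diff[OF int[OF that]] that by (simp add: val algebra_simps)
  have B1: "(1, 0) \<in> (Basis :: spacetime set)" and B2: "\<And>b. b \<in> Basis \<Longrightarrow> (0, b) \<in> (Basis :: spacetime set)"
    by (auto simp: Basis_prod_def)
  have tt: "test_fun (dir_deriv (1, 0) (dir_deriv (1, 0) \<phi>))"
    by (intro test_fun_dir_deriv \<phi> B1)
  have tx: "test_fun (dir_deriv (0, b) (dir_deriv (0, b) \<phi>))" if "b \<in> Basis" for b
    by (intro test_fun_dir_deriv \<phi> B2 that)
  have "dist_box (U1 $ i) \<phi> - dist_box (U2 $ i) \<phi>
      = ?I i (dir_deriv (1, 0) (dir_deriv (1, 0) \<phi>)) - (\<Sum>b\<in>Basis. ?I i (dir_deriv (0, b) (dir_deriv (0, b) \<phi>)))"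
    unfolding diff[OF tt, symmetric]
    by (simp add: dist_box_def dist_deriv_def diff[OF tx, symmetric] sum_subtractf)
  also have "\<dots> = ?I i (dalembert \<phi>)"
    using intd[OF tt, of i] intd[OF tx, of _ i]
    by (subst Bochner_Integration.integral_sum[symmetric], simp, subst Bochner_Integration.integral_diff[symmetric])
       (auto simp: dalembert_def right_diff_distrib sum_distrib_left intro!: Bochner_Integration.integral_cong)
  finally have L: "dist_box (U1 $ i) \<phi> - dist_box (U2 $ i) \<phi> = ?I i (dalembert \<phi>)" .
  \<comment> \<open>Smoothness of the coefficients lets them be moved onto the test
    function.\<close>
  have tP: "test_fun (\<lambda>z. P1 (snd z) $ i $ j * \<phi> z)" "test_fun (\<lambda>z. P2 (snd z) $ i $ j * \<phi> z)" for j
    using P by (auto intro!: test_fun_mult \<phi> smooth_snd)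
  have "dist_box (U1 $ i) \<phi> - dist_box (U2 $ i) \<phi>
     = (\<Sum>j\<in>UNIV. dist_mult (\<lambda>(t, x). P1 x $ i $ j) (U1 $ j) \<phi>) - (\<Sum>j\<in>UNIV. dist_mult (\<lambda>(t, x). P2 x $ i $ j) (U2 $ j) \<phi>)"
  proof -
    have "dist_box (U1 $ i) \<phi> - (\<Sum>j\<in>UNIV. dist_mult (\<lambda>(t, x). P1 x $ i $ j) (U1 $ j) \<phi>) = dirac \<phi>"
      "dist_box (U2 $ i) \<phi> - (\<Sum>j\<in>UNIV. dist_mult (\<lambda>(t, x). P2 x $ i $ j) (U2 $ j) \<phi>) = dirac \<phi>"
      using S \<phi> unfolding solves_ivp_def by blast+
    then show ?thesis by linarith
  qed
  also have "\<dots> = (\<Sum>j\<in>UNIV. (U1 $ j) (\<lambda>z. P1 (snd z) $ i $ j * \<phi> z) - (U2 $ j) (\<lambda>z. P2 (snd z) $ i $ j * \<phi> z))"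
    by (simp add: dist_mult_def case_prod_unfold sum_subtractf)
  also have "\<dots> = (\<Sum>j\<in>UNIV. (cone_delta (\<lambda>z. P1 (snd z) $ i $ j * \<phi> z) - cone_delta (\<lambda>z. P2 (snd z) $ i $ j * \<phi> z)))
     + (\<Sum>j\<in>UNIV. (LINT z|lborel. indicator cone_set z * R1 z $ j * (P1 (snd z) $ i $ j * \<phi> z))
          - (LINT z|lborel. indicator cone_set z * R2 z $ j * (P2 (snd z) $ i $ j * \<phi> z)))"
    by (subst sum.distrib[symmetric], intro sum.cong refl, subst val(1)[OF tP(1)], subst val(2)[OF tP(2)])
       (rule add_diff_add)
  \<comment> \<open>The singular parts agree, but they are multiplied by different coefficients;
    this leaves a source on the cone. Both components of the singular part are
    \<open>cone_delta\<close>, so the source is a row sum.\<close>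
  also have "(\<Sum>j\<in>UNIV. (cone_delta (\<lambda>z. P1 (snd z) $ i $ j * \<phi> z) - cone_delta (\<lambda>z. P2 (snd z) $ i $ j * \<phi> z)))
      = (LINT x|lborel. (\<Sum>j\<in>UNIV. P1 x $ i $ j - P2 x $ i $ j) * \<phi> (norm x, x) / (4 * pi * norm x))"
  proof -
    let ?c = "\<lambda>j x. (P1 x $ i $ j - P2 x $ i $ j) * \<phi> (norm x, x) / (4 * pi * norm x)"
    have eq: "P1 (snd (norm x, x)) $ i $ j * \<phi> (norm x, x) / (4 * pi * norm x)
        - P2 (snd (norm x, x)) $ i $ j * \<phi> (norm x, x) / (4 * pi * norm x) = ?c j x" for j x
      by (simp add: left_diff_distrib diff_divide_distrib)
    have c: "integrable lborel (?c j)"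
      "cone_delta (\<lambda>z. P1 (snd z) $ i $ j * \<phi> z) - cone_delta (\<lambda>z. P2 (snd z) $ i $ j * \<phi> z)
        = integral\<^sup>L lborel (?c j)" for j
      using Bochner_Integration.integrable_diff[OF integrable_cone_delta[OF tP(1)[of j]] integrable_cone_delta[OF tP(2)[of j]]]
        Bochner_Integration.integral_diff[OF integrable_cone_delta[OF tP(1)[of j]] integrable_cone_delta[OF tP(2)[of j]]]
      unfolding cone_delta_def eq by simp_all
    have "(\<Sum>j\<in>UNIV. (cone_delta (\<lambda>z. P1 (snd z) $ i $ j * \<phi> z) - cone_delta (\<lambda>z. P2 (snd z) $ i $ j * \<phi> z)))
       = (LINT x|lborel. (\<Sum>j\<in>UNIV. ?c j x))"
      unfolding c(2) by (rule Bochner_Integration.integral_sum[symmetric]) (rule c(1))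
    then show ?thesis by (simp only: sum_distrib_right sum_divide_distrib)
  qed
  also have "(\<Sum>j\<in>UNIV. (LINT z|lborel. indicator cone_set z * R1 z $ j * (P1 (snd z) $ i $ j * \<phi> z))
          - (LINT z|lborel. indicator cone_set z * R2 z $ j * (P2 (snd z) $ i $ j * \<phi> z)))
      = (LINT z|lborel. (\<Sum>j\<in>UNIV. indicator cone_set z * R1 z $ j * (P1 (snd z) $ i $ j * \<phi> z)
          - indicator cone_set z * R2 z $ j * (P2 (snd z) $ i $ j * \<phi> z)))"
    unfolding Bochner_Integration.integral_diff[OF int(1)[OF tP(1)] int(2)[OF tP(2)], symmetric]
    by (rule Bochner_Integration.integral_sum[symmetric])
       (rule Bochner_Integration.integrable_diff[OF int(1)[OF tP(1)] int(2)[OF tP(2)]])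
  also have "\<dots> = (LINT z|lborel. indicator cone_set z
          * (\<Sum>j\<in>UNIV. P1 (snd z) $ i $ j * R1 z $ j - P2 (snd z) $ i $ j * R2 z $ j) * \<phi> z)"
    by (intro Bochner_Integration.integral_cong refl)
       (simp add: sum_distrib_left sum_distrib_right algebra_simps)
  finally show ?thesis using L by simp
qed

section \<open>Regularised spherical waves\<close>

definition soft_norm :: "real \<Rightarrow> real^3 \<Rightarrow> real" where
  "soft_norm \<epsilon> y = sqrt ((norm y)\<^sup>2 + \<epsilon>\<^sup>2)"

lemma soft_norm_pos: "0 < \<epsilon> \<Longrightarrow> 0 < soft_norm \<epsilon> y"
  by (simp add: soft_norm_def add_nonneg_pos)

lemma soft_norm_ge: "norm y \<le> soft_norm \<epsilon> y"
  by (simp add: soft_norm_def real_le_rsqrt)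

lemma soft_norm_square: "(soft_norm \<epsilon> y)\<^sup>2 = (norm y)\<^sup>2 + \<epsilon>\<^sup>2"
  by (simp add: soft_norm_def)

lemma soft_norm_has_derivative:
  assumes "0 < \<epsilon>"
  shows "((\<lambda>x. soft_norm \<epsilon> (x - z)) has_derivative (\<lambda>v. ((x - z) \<bullet> v) / soft_norm \<epsilon> (x - z))) (at x)"
proof -
  have pos: "0 < (norm (x - z))\<^sup>2 + \<epsilon>\<^sup>2" using assms by (simp add: add_nonneg_pos)
  have "((\<lambda>x. (x - z) \<bullet> (x - z) + \<epsilon>\<^sup>2) has_derivative (\<lambda>v. 2 * ((x - z) \<bullet> v))) (at x)"
    by (auto intro!: derivative_eq_intros simp: inner_commute)
  then have d: "((\<lambda>x. (norm (x - z))\<^sup>2 + \<epsilon>\<^sup>2) has_derivative (\<lambda>v. 2 * ((x - z) \<bullet> v))) (at x)"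
    by (simp add: power2_norm_eq_inner)
  from has_derivative_compose[OF d DERIV_real_sqrt[OF pos, unfolded has_field_derivative_def]]
  show ?thesis by (simp add: soft_norm_def field_simps)
qed

text \<open>Powers of the soft norm are powers of a polynomial in the coordinates that is at least
  \<open>\<epsilon>\<^sup>2\<close>, hence smooth also at the centre \<open>z\<close>.\<close>

lemma smooth_soft_norm_powr:
  assumes "0 < \<epsilon>"
  shows "smooth (\<lambda>w :: spacetime. soft_norm \<epsilon> (snd w - z) powr a)"
proof -
  have eq: "(norm (y - z))\<^sup>2 + \<epsilon>\<^sup>2 = (\<Sum>b\<in>Basis. (y \<bullet> b - z \<bullet> b) * (y \<bullet> b - z \<bullet> b)) + \<epsilon>\<^sup>2" for y
    unfolding power2_norm_eq_inner euclidean_inner[of "y - z" "y - z"] by (simp add: inner_diff_left)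
  have "smooth (\<lambda>w :: spacetime. (norm (snd w - z))\<^sup>2 + \<epsilon>\<^sup>2)"
    unfolding eq by (intro smooth_add smooth_sum smooth_mult smooth_diff smooth_const
        smooth_bounded_linear bounded_linear_intros)
  then have "smooth (\<lambda>w :: spacetime. ((norm (snd w - z))\<^sup>2 + \<epsilon>\<^sup>2) powr (a / 2))"
    using assms by (intro smooth_powr) (auto simp: add_nonneg_pos)
  moreover have "((norm y)\<^sup>2 + \<epsilon>\<^sup>2) powr (a / 2) = soft_norm \<epsilon> y powr a" for y :: "real^3"
    using assms by (simp add: soft_norm_def powr_half_sqrt[symmetric] powr_powr add_nonneg_pos)
  ultimately show ?thesis by simp
qed

text \<open>The profile and the power are arbitrary because second derivatives of the wave need this
  formula for the powers 1, 2 and 3, with \<open>G\<close> and with its derivative.\<close>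

lemma retarded_profile_has_derivative:
  fixes A A' :: "real \<Rightarrow> real" and z :: "real^3"
  assumes A: "\<And>s. (A has_real_derivative A' s) (at s)" and \<epsilon>: "0 < \<epsilon>"
  defines "n \<equiv> \<lambda>x. soft_norm \<epsilon> (x - z)"
  shows "((\<lambda>w. A (fst w + n (snd w)) / n (snd w) ^ k) has_derivative
    (\<lambda>v. A' (fst w + n (snd w)) / n (snd w) ^ k * fst v
       + (A' (fst w + n (snd w)) / n (snd w) ^ (k + 1) - real k * A (fst w + n (snd w)) / n (snd w) ^ (k + 2))
         * ((snd w - z) \<bullet> snd v))) (at w)"
proof -
  have npos: "n (snd w) > 0" unfolding n_def by (rule soft_norm_pos[OF \<epsilon>])
  have n: "((\<lambda>w. n (snd w)) has_derivative (\<lambda>v. ((snd w - z) \<bullet> snd v) / n (snd w))) (at w)"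
    unfolding n_def
    by (rule has_derivative_compose[OF has_derivative_snd[OF has_derivative_ident] soft_norm_has_derivative[OF \<epsilon>]])
  have s: "((\<lambda>w. fst w + n (snd w)) has_derivative (\<lambda>v. fst v + ((snd w - z) \<bullet> snd v) / n (snd w))) (at w)"
    by (intro has_derivative_add n has_derivative_fst has_derivative_ident)
  have a: "((\<lambda>w. A (fst w + n (snd w))) has_derivative
      (\<lambda>v. A' (fst w + n (snd w)) * (fst v + ((snd w - z) \<bullet> snd v) / n (snd w)))) (at w)"
    by (rule has_derivative_compose[OF s A[unfolded has_field_derivative_def]])
  have "((\<lambda>y. inverse (y ^ k)) has_real_derivative - (real k * inverse (n (snd w) ^ (k + 1)))) (at (n (snd w)))"
  proof (cases k)
    case (Suc m)
    have "((\<lambda>y. y ^ k) has_real_derivative real k * n (snd w) ^ m) (at (n (snd w)))"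
      using DERIV_pow[of k "n (snd w)"] Suc by simp
    from DERIV_inverse_fun[OF this]
    have "((\<lambda>y. inverse (y ^ k)) has_real_derivative - (inverse (n (snd w) ^ k) * (real k * n (snd w) ^ m)
        * inverse (n (snd w) ^ k))) (at (n (snd w)))" using npos by (simp add: ac_simps)
    moreover have "inverse (n (snd w) ^ k) * (real k * n (snd w) ^ m) * inverse (n (snd w) ^ k)
        = real k * inverse (n (snd w) ^ (k + 1))"
      using npos Suc by (simp add: field_simps)
    ultimately show ?thesis by (simp only:)
  qed simp
  from has_derivative_compose[OF n this[unfolded has_field_derivative_def]]
  have i: "((\<lambda>w. inverse (n (snd w) ^ k)) has_derivative
      (\<lambda>v. - (real k * inverse (n (snd w) ^ (k + 1))) * (((snd w - z) \<bullet> snd v) / n (snd w)))) (at w)" .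
  have "(\<lambda>v. A' (fst w + n (snd w)) / n (snd w) ^ k * fst v
       + (A' (fst w + n (snd w)) / n (snd w) ^ (k + 1) - real k * A (fst w + n (snd w)) / n (snd w) ^ (k + 2))
         * ((snd w - z) \<bullet> snd v))
     = (\<lambda>v. A (fst w + n (snd w)) * (- (real k * inverse (n (snd w) ^ (k + 1))) * (((snd w - z) \<bullet> snd v) / n (snd w)))
       + A' (fst w + n (snd w)) * (fst v + ((snd w - z) \<bullet> snd v) / n (snd w)) * inverse (n (snd w) ^ k))"
    by (rule ext) (use npos in \<open>simp add: field_simps\<close>)
  with has_derivative_mult[OF a i] show ?thesis by (simp add: divide_inverse)
qed

lemma dir_deriv_cong_open:
  assumes "(g has_derivative D) (at x)" "open S" "x \<in> S" "\<And>y. y \<in> S \<Longrightarrow> g y = f y"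
  shows "dir_deriv v f x = D v"
  using has_derivative_transform_within_open[OF assms] by (rule dir_deriv_eqI)

text \<open>The d'Alembertian of the regularised wave \<open>G(t + n) / n\<close>, \<open>n = sqrt (|y|\<^sup>2 + \<epsilon>\<^sup>2)\<close>. As \<open>\<epsilon> \<rightarrow> 0\<close> it
  concentrates on the line \<open>y = 0\<close>, because \<open>3 \<epsilon>\<^sup>2 / n\<^sup>5\<close> is an approximate identity.\<close>

definition wave_defect :: "(real \<Rightarrow> real) \<Rightarrow> real \<Rightarrow> real^3 \<Rightarrow> real \<Rightarrow> real" where
  "wave_defect G \<epsilon> y t = \<epsilon>\<^sup>2 * (dir_deriv 1 (dir_deriv 1 G) (t + soft_norm \<epsilon> y) / soft_norm \<epsilon> y ^ 3
     - 3 * dir_deriv 1 G (t + soft_norm \<epsilon> y) / soft_norm \<epsilon> y ^ 4 + 3 * G (t + soft_norm \<epsilon> y) / soft_norm \<epsilon> y ^ 5)"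

text \<open>With the true distance in place of \<open>n\<close> the wave would solve the wave
  equation away from its centre. Here the squared components of \<open>snd w - z\<close> sum to n^2
  - \<epsilon>^2 instead of n^2, and exactly the terms carrying \<epsilon>^2 survive.\<close>

lemma dalembert_regularised_wave:
  fixes G :: "real \<Rightarrow> real" and z :: "real^3"
  assumes G: "smooth G" and \<epsilon>: "0 < \<epsilon>"
  defines "n \<equiv> \<lambda>x. soft_norm \<epsilon> (x - z)"
  assumes \<phi>: "\<And>w. w \<in> S \<Longrightarrow> \<phi> w = G (fst w + n (snd w)) / n (snd w)" and S: "open S" "w \<in> S"
  shows "dalembert \<phi> w = wave_defect G \<epsilon> (snd w - z) (fst w)"
proof -
  define G1 where "G1 = dir_deriv 1 G"
  define G2 where "G2 = dir_deriv 1 G1"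
  have D1: "(G has_real_derivative G1 s) (at s)" for s
    using smooth_real_derivatives(2)[OF G, of 0] by (simp add: G1_def)
  have D2: "(G1 has_real_derivative G2 s) (at s)" for s
    using smooth_real_derivatives(2)[OF G, of 1] by (simp add: G1_def G2_def)
  have der: "((\<lambda>w. A (fst w + n (snd w)) / n (snd w) ^ k) has_derivative
    (\<lambda>v. A' (fst w + n (snd w)) / n (snd w) ^ k * fst v
       + (A' (fst w + n (snd w)) / n (snd w) ^ (k + 1) - real k * A (fst w + n (snd w)) / n (snd w) ^ (k + 2))
         * ((snd w - z) \<bullet> snd v))) (at w)"
    if "\<And>s. (A has_real_derivative A' s) (at s)" for A A' k w
    unfolding n_def by (rule retarded_profile_has_derivative[OF that \<epsilon>])
  have npos: "n x > 0" for x unfolding n_def by (rule soft_norm_pos[OF \<epsilon>])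
  have first: "dir_deriv v \<phi> w = G1 (fst w + n (snd w)) / n (snd w) * fst v
      + (G1 (fst w + n (snd w)) / n (snd w) ^ 2 - G (fst w + n (snd w)) / n (snd w) ^ 3) * ((snd w - z) \<bullet> snd v)"
    if "w \<in> S" for w v
    using dir_deriv_cong_open[OF der[OF D1, of 1 w] S(1) that, of \<phi> v] \<phi>
    by (simp add: power2_eq_square power3_eq_cube mult.assoc)
  let ?s = "fst w + n (snd w)" and ?n = "n (snd w)" and ?y = "snd w - z"
  have tt: "dir_deriv (1, 0) (dir_deriv (1, 0) \<phi>) w = G2 ?s / ?n"
    using dir_deriv_cong_open[OF der[OF D2, of 1 w] S, of "dir_deriv (1, 0) \<phi>" "(1, 0)"] first by simp
  have xx: "dir_deriv (0, b) (dir_deriv (0, b) \<phi>) w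
      = (G2 ?s / ?n ^ 3 - 3 * G1 ?s / ?n ^ 4 + 3 * G ?s / ?n ^ 5) * (?y \<bullet> b)\<^sup>2 + (G1 ?s / ?n\<^sup>2 - G ?s / ?n ^ 3)"
    if "b \<in> Basis" for b
  proof -
    let ?D = "\<lambda>v. (((G2 ?s / ?n ^ 2 * fst v + (G2 ?s / ?n ^ (2 + 1) - real 2 * G1 ?s / ?n ^ (2 + 2)) * (?y \<bullet> snd v))
           - (G1 ?s / ?n ^ 3 * fst v + (G1 ?s / ?n ^ (3 + 1) - real 3 * G ?s / ?n ^ (3 + 2)) * (?y \<bullet> snd v))))"
    have "((\<lambda>w. G1 (fst w + n (snd w)) / n (snd w) ^ 2 - G (fst w + n (snd w)) / n (snd w) ^ 3) has_derivative ?D) (at w)"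
      by (intro has_derivative_diff der[OF D1] der[OF D2])
    moreover have "((\<lambda>w. (snd w - z) \<bullet> b) has_derivative (\<lambda>v. snd v \<bullet> b)) (at w)"
      by (auto intro!: derivative_eq_intros)
    ultimately have "((\<lambda>w. (G1 (fst w + n (snd w)) / n (snd w) ^ 2 - G (fst w + n (snd w)) / n (snd w) ^ 3) * ((snd w - z) \<bullet> b))
      has_derivative (\<lambda>v. (G1 ?s / ?n ^ 2 - G ?s / ?n ^ 3) * (snd v \<bullet> b) + ?D v * (?y \<bullet> b))) (at w)"
      by (rule has_derivative_mult)
    from dir_deriv_cong_open[OF this S, of "dir_deriv (0, b) \<phi>" "(0, b)"] first
    have "dir_deriv (0, b) (dir_deriv (0, b) \<phi>) w
       = (G1 ?s / ?n ^ 2 - G ?s / ?n ^ 3) * (b \<bullet> b) + ?D (0, b) * (?y \<bullet> b)" by simp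
    also have "b \<bullet> b = 1" using that by (simp add: inner_Basis)
    also have "?D (0, b) = (G2 ?s / ?n ^ 3 - 3 * G1 ?s / ?n ^ 4 + 3 * G ?s / ?n ^ 5) * (?y \<bullet> b)"
      by (simp add: left_diff_distrib distrib_right)
    finally show ?thesis by (simp add: power2_eq_square)
  qed
  have sq: "(\<Sum>b\<in>Basis. (?y \<bullet> b)\<^sup>2) = ?n\<^sup>2 - \<epsilon>\<^sup>2"
    unfolding n_def soft_norm_square power2_norm_eq_inner euclidean_inner[of ?y ?y] by (simp add: power2_eq_square)
  have "(\<Sum>b\<in>Basis. dir_deriv (0, b) (dir_deriv (0, b) \<phi>) w)
      = (G2 ?s / ?n ^ 3 - 3 * G1 ?s / ?n ^ 4 + 3 * G ?s / ?n ^ 5) * (?n\<^sup>2 - \<epsilon>\<^sup>2) + 3 * (G1 ?s / ?n\<^sup>2 - G ?s / ?n ^ 3)"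
    unfolding sq[symmetric] by (simp add: xx sum.distrib sum_distrib_left)
  then have "dalembert \<phi> w = G2 ?s / ?n - ((G2 ?s / ?n ^ 3 - 3 * G1 ?s / ?n ^ 4 + 3 * G ?s / ?n ^ 5) * (?n\<^sup>2 - \<epsilon>\<^sup>2)
      + 3 * (G1 ?s / ?n\<^sup>2 - G ?s / ?n ^ 3))"
    by (simp add: dalembert_def tt)
  also have "\<dots> = \<epsilon>\<^sup>2 * (G2 ?s / ?n ^ 3 - 3 * G1 ?s / ?n ^ 4 + 3 * G ?s / ?n ^ 5)"
    using npos[of "snd w"] by (simp add: field_simps power_numeral_reduce)
  finally show ?thesis by (simp add: G1_def G2_def wave_defect_def n_def)
qed

text \<open>The assumption \<open>weak\<close> is the distributional wave equation for the extension
  of \<open>r\<close> by zero, with density \<open>Q\<close> relative to \<open>cone_delta\<close>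
  on the cone and source \<open>S\<close> inside. The zero initial state is encoded by the indicator
  of \<open>cone_set\<close>.\<close>

locale cone_wave =
  fixes r S :: "spacetime \<Rightarrow> real" and Q :: "real^3 \<Rightarrow> real"
  assumes r: "continuous_on cone_set r" and S: "continuous_on cone_set S" and Q: "continuous_on UNIV Q"
    and weak: "\<And>\<phi>. test_fun \<phi> \<Longrightarrow> (LINT w|lborel. indicator cone_set w * r w * dalembert \<phi> w)
       = (LINT x|lborel. Q x * \<phi> (norm x, x) / (4 * pi * norm x)) + (LINT w|lborel. indicator cone_set w * S w * \<phi> w)"

section \<open>Functions on the cone, extended by zero\<close>

lemma borel_measurable_cone_extension:
  assumes "continuous_on cone_set (f :: spacetime \<Rightarrow> real)"
  shows "(\<lambda>w. indicator cone_set w * f w) \<in> borel_measurable borel"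
  using borel_measurable_continuous_on_indicator[OF _ assms] closed_cone_set by simp

lemma compact_cone_slab: "compact (cone_set \<inter> {w. fst w \<le> \<beta>})"
proof -
  have "cone_set \<inter> {w :: spacetime. fst w \<le> \<beta>} = ({0..\<beta>} \<times> cball 0 \<beta>) \<inter> cone_set"
  proof (intro equalityI subsetI)
    fix w assume w: "w \<in> cone_set \<inter> {w. fst w \<le> \<beta>}"
    then have "norm (snd w) \<le> fst w" "fst w \<le> \<beta>" by (auto simp: cone_set_def)
    moreover have "0 \<le> norm (snd w)" by simp
    ultimately have "0 \<le> fst w" "fst w \<le> \<beta>" "norm (snd w) \<le> \<beta>" by linarith+
    then show "w \<in> ({0..\<beta>} \<times> cball 0 \<beta>) \<inter> cone_set" using w by (cases w) auto
  qed auto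
  then show ?thesis
    using compact_Int_closed[OF compact_Times[OF compact_Icc compact_cball] closed_cone_set] by simp
qed

lemma cone_extension_bounded:
  assumes "continuous_on cone_set (f :: spacetime \<Rightarrow> real)"
  obtains M where "0 \<le> M" "\<And>w. fst w \<le> \<beta> \<Longrightarrow> \<bar>indicator cone_set w * f w\<bar> \<le> M"
proof -
  have "compact (f ` (cone_set \<inter> {w. fst w \<le> \<beta>}))"
    by (rule compact_continuous_image[OF continuous_on_subset[OF assms] compact_cone_slab]) auto
  from compact_imp_bounded[OF this] obtain M where "\<forall>y\<in>f ` (cone_set \<inter> {w. fst w \<le> \<beta>}). norm y \<le> M"
    unfolding bounded_iff by blast
  then have M: "\<And>w. w \<in> cone_set \<Longrightarrow> fst w \<le> \<beta> \<Longrightarrow> \<bar>f w\<bar> \<le> M" by auto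
  have "\<bar>indicator cone_set w * f w\<bar> \<le> max M 0" if "fst w \<le> \<beta>" for w
    using M[OF _ that] by (auto split: split_indicator)
  then show ?thesis using that[of "max M 0"] by simp
qed

text \<open>On the line through \<open>z\<close> this covers every time except
  \<open>norm z\<close>, hence almost every point at which the approximate identity is
  evaluated.\<close>

lemma cone_extension_isCont:
  assumes f: "continuous_on cone_set (f :: spacetime \<Rightarrow> real)" and w: "fst w \<noteq> norm (snd w)"
  shows "isCont (\<lambda>w. indicator cone_set w * f w) w"
proof (cases "w \<in> cone_set")
  case True
  define I where "I = {w :: spacetime. norm (snd w) < fst w}"
  have "open I" unfolding I_def by (intro open_Collect_less continuous_intros)
  moreover have "I \<subseteq> cone_set" by (auto simp: I_def cone_set_def)
  moreover have "w \<in> I" using True w by (auto simp: I_def cone_set_def)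
  ultimately have "isCont f w" using f by (metis continuous_on_eq_continuous_at continuous_on_subset)
  moreover have "\<forall>\<^sub>F w in nhds w. indicator cone_set w * f w = f w"
    using \<open>open I\<close> \<open>w \<in> I\<close> \<open>I \<subseteq> cone_set\<close> unfolding eventually_nhds by (auto intro!: exI[of _ I])
  ultimately show ?thesis using isCont_cong by fast
next
  case False
  then have "\<forall>\<^sub>F w in nhds w. indicator cone_set w * f w = 0"
    using closed_cone_set unfolding eventually_nhds by (intro exI[of _ "- cone_set"]) auto
  moreover have "isCont (\<lambda>_. 0 :: real) w" by simp
  ultimately show ?thesis using isCont_cong by fast
qed

section \<open>Slabs, null sets and spatial rescaling in space-time\<close>

lemma integrable_slab:
  fixes h :: "'a::euclidean_space \<Rightarrow> real"
  assumes "integrable lborel h"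
  shows "integrable lborel (\<lambda>w :: real \<times> 'a. indicator {\<alpha>..\<beta>} (fst w) * h (snd w))"
proof (rule integrableI_bounded)
  have [measurable]: "h \<in> borel_measurable borel" using assms borel_measurable_integrable by force
  show "(\<lambda>w :: real \<times> 'a. indicator {\<alpha>..\<beta>} (fst w) * h (snd w)) \<in> borel_measurable lborel" by measurable
  have "(\<integral>\<^sup>+ w. ennreal (norm (indicator {\<alpha>..\<beta>} (fst w) * h (snd (w :: real \<times> 'a)))) \<partial>lborel)
      = (\<integral>\<^sup>+ y. \<integral>\<^sup>+ t. ennreal (norm (h y)) * indicator {\<alpha>..\<beta>} t \<partial>lborel \<partial>lborel)"
    by (subst nn_integral_lborel_Pair(2)) (auto simp: abs_mult intro!: nn_integral_cong split: split_indicator)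
  also have "\<dots> = (\<integral>\<^sup>+ y. ennreal (norm (h y)) * emeasure lborel {\<alpha>..\<beta>} \<partial>lborel)"
    by (intro nn_integral_cong nn_integral_cmult_indicator) auto
  also have "\<dots> = (\<integral>\<^sup>+ y. ennreal (norm (h y)) \<partial>lborel) * emeasure lborel {\<alpha>..\<beta>}"
    by (rule nn_integral_multc) auto
  also have "\<dots> < \<infinity>"
    using assms by (simp add: integrable_iff_bounded ennreal_mult_less_top emeasure_lborel_Icc_eq)
  finally show "(\<integral>\<^sup>+ w. ennreal (norm (indicator {\<alpha>..\<beta>} (fst w) * h (snd (w :: real \<times> 'a)))) \<partial>lborel) < \<infinity>" .
qed

lemma AE_spacetime_time: "AE w :: spacetime in lborel. fst w \<noteq> c"
proof -
  have "negligible {w :: spacetime. w \<bullet> (1, 0) = c}"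
    by (rule negligible_standard_hyperplane) (simp add: Basis_prod_def)
  then have "{w :: spacetime. fst w = c} \<in> null_sets lborel"
    by (simp add: negligible_iff_null_sets null_sets_completion_iff closed_Collect_eq continuous_intros borel_closed inner_prod_def)
  from AE_not_in[OF this] show ?thesis by simp
qed

lemma AE_spacetime_space: "AE w :: spacetime in lborel. snd w \<noteq> z"
proof -
  have "negligible {w :: spacetime. w \<bullet> (0, axis 1 1) = z $ 1}"
    by (rule negligible_standard_hyperplane) (auto simp: Basis_prod_def Basis_vec_def)
  then have "{w :: spacetime. snd w $ 1 = z $ 1} \<in> null_sets lborel"
    by (simp add: negligible_iff_null_sets null_sets_completion_iff closed_Collect_eq continuous_intros borel_closed
        inner_prod_def inner_axis)
  from AE_not_in[OF this] show ?thesis by eventually_elim auto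
qed

lemma integral_spacetime_rescale:
  fixes f :: "spacetime \<Rightarrow> real" and z :: "real^3"
  assumes \<epsilon>: "0 < \<epsilon>" and [measurable]: "f \<in> borel_measurable borel"
  shows "(LINT w|lborel. f w) = (LINT w|lborel. \<epsilon> ^ 3 * f (fst w, z + \<epsilon> *\<^sub>R snd w))"
proof -
  let ?c = "\<lambda>j :: spacetime. if j = (1, 0) then 1 else \<epsilon>"
  let ?T = "\<lambda>w :: spacetime. (0, z) + (\<Sum>j\<in>Basis. (?c j * (w \<bullet> j)) *\<^sub>R j)"
  have B: "Basis = insert (1, 0) (Pair (0 :: real) ` (Basis :: (real^3) set))" by (auto simp: Basis_prod_def)
  have ni: "(1, 0) \<notin> Pair (0 :: real) ` (Basis :: (real^3) set)" and inj: "inj_on (Pair (0 :: real)) (Basis :: (real^3) set)"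
    by (auto intro: inj_onI)
  have sumB: "sum f Basis = f (1, 0) + (\<Sum>b\<in>Basis. f (0, b))" for f :: "spacetime \<Rightarrow> spacetime"
    unfolding B using ni by (simp add: sum.reindex[OF inj] o_def)
  have prodB: "prod f Basis = f (1, 0) * (\<Prod>b\<in>Basis. f (0, b))" for f :: "spacetime \<Rightarrow> real"
    unfolding B using ni by (simp add: prod.reindex[OF inj] o_def)
  have T: "?T w = (fst w, z + \<epsilon> *\<^sub>R snd w)" for w
  proof -
    have "(\<Sum>j\<in>Basis. (?c j * (w \<bullet> j)) *\<^sub>R j) = (fst w, 0) + (\<Sum>b\<in>Basis. (\<epsilon> * (snd w \<bullet> b)) *\<^sub>R (0, b))"
      by (simp add: sumB inner_prod_def)
    also have "(\<Sum>b\<in>Basis. (\<epsilon> * (snd w \<bullet> b)) *\<^sub>R (0 :: real, b)) = (0, \<epsilon> *\<^sub>R (\<Sum>b\<in>Basis. (snd w \<bullet> b) *\<^sub>R b))"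
      by (simp add: prod_eq_iff fst_sum snd_sum scaleR_sum_right)
    finally show ?thesis by (simp add: euclidean_representation)
  qed
  have P: "(\<Prod>j\<in>Basis. \<bar>?c j\<bar>) = \<epsilon> ^ 3"
    using \<epsilon> by (simp add: prodB)
  have D: "lborel = density (distr lborel borel ?T) (\<lambda>_. ennreal (\<epsilon> ^ 3))"
    using lborel_affine_euclidean[where c="?c" and t="(0, z)"] \<epsilon> unfolding P by simp
  have [measurable]: "(\<lambda>w :: spacetime. (fst w, z + \<epsilon> *\<^sub>R snd w)) \<in> borel_measurable borel"
    by (intro borel_measurable_continuous_onI continuous_intros)
  have "(LINT w|lborel. f w) = (LINT w|density (distr lborel borel ?T) (\<lambda>_. ennreal (\<epsilon> ^ 3)). f w)"
    by (subst D) (rule refl)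
  also have "\<dots> = (LINT w|lborel. \<epsilon> ^ 3 * f (fst w, z + \<epsilon> *\<^sub>R snd w))"
    unfolding T using \<epsilon> by (subst integral_real_density) (auto simp: integral_distr)
  finally show ?thesis .
qed

lemma soft_norm_scale: "0 < \<epsilon> \<Longrightarrow> soft_norm \<epsilon> (\<epsilon> *\<^sub>R y) = \<epsilon> * soft_norm 1 y"
proof -
  assume "0 < \<epsilon>"
  have "(norm (\<epsilon> *\<^sub>R y))\<^sup>2 + \<epsilon>\<^sup>2 = \<epsilon>\<^sup>2 * ((norm y)\<^sup>2 + 1\<^sup>2)"
    by (simp add: power_mult_distrib algebra_simps)
  then show ?thesis using \<open>0 < \<epsilon>\<close> by (simp add: soft_norm_def real_sqrt_mult)
qed

lemma soft_norm_tendsto: "\<epsilon> \<longlonglongrightarrow> 0 \<Longrightarrow> (\<lambda>k. soft_norm (\<epsilon> k) y) \<longlonglongrightarrow> norm y"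
  unfolding soft_norm_def by (rule tendsto_eq_intros | simp)+

lemma continuous_soft_norm: "continuous_on UNIV (soft_norm \<epsilon>)"
  unfolding soft_norm_def[abs_def] by (intro continuous_intros)

lemmas borel_measurable_soft_norm [measurable] = borel_measurable_continuous_onI[OF continuous_soft_norm]

text \<open>The two-focus identity takes the place of polar coordinates. An auxiliary second focus
  at distance 1 from the origin keeps the sum \<open>s\<close> of the distances at least 1, so that
  the majorant s^(-3) is integrable over its whole range.\<close>

lemma integrable_poisson_kernel: "integrable lborel (\<lambda>y :: real^3. 1 / soft_norm 1 y ^ 5)"
proof (rule integrableI_bounded)
  let ?e = "axis 1 1 :: real^3"
  have e: "norm ?e = 1" by simp
  have "(\<integral>\<^sup>+ y. ennreal (norm (1 / soft_norm 1 y ^ 5)) \<partial>lborel)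
     \<le> (\<integral>\<^sup>+ y. ennreal (3 ^ 5 / (norm (y - 0) + norm (y - ?e)) ^ 3) * ennreal (1 / (norm (y - 0) * norm (y - ?e))) \<partial>lborel)"
  proof (rule nn_integral_mono_AE)
    have "AE y :: real^3 in lborel. y \<noteq> 0" "AE y in lborel. y \<noteq> ?e" by (rule AE_lborel_singleton)+
    then show "AE y in lborel. ennreal (norm (1 / soft_norm 1 y ^ 5)) \<le>
        ennreal (3 ^ 5 / (norm (y - 0) + norm (y - ?e)) ^ 3) * ennreal (1 / (norm (y - 0) * norm (y - ?e)))"
    proof eventually_elim
      case (elim y)
      let ?a = "norm (y - 0)" and ?c = "norm (y - ?e)" and ?n = "soft_norm 1 y"
      have pos: "0 < ?a" "0 < ?c" "0 < ?n" using elim soft_norm_pos[of 1 y] by auto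
      \<comment> \<open>Since \<open>?n\<close> is at least 1, the sum \<open>?a + ?c\<close> is at
        most \<open>3 * ?n\<close>; moreover \<open>?a * ?c\<close> is at most the square of that
        sum. Five powers of \<open>?n\<close> thus dominate the two-focus denominator times three
        powers of the sum, at the cost of \<open>3 ^ 5\<close>.\<close>
      have "1 \<le> ?n" unfolding soft_norm_def by simp
      moreover have "?c \<le> ?a + 1" using norm_triangle_ineq4[of y ?e] e by simp
      ultimately have s: "?a + ?c \<le> 3 * ?n" using soft_norm_ge[of y 1] by simp
      have "?a * ?c \<le> (?a + ?c) * (?a + ?c)" using pos by (intro mult_mono) auto
      then have "(?a + ?c) ^ 3 * (?a * ?c) \<le> (?a + ?c) ^ 3 * ((?a + ?c) * (?a + ?c))" using pos by (intro mult_left_mono) auto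
      also have "\<dots> = (?a + ?c) ^ 5" by (simp add: power_numeral_reduce)
      also have "\<dots> \<le> (3 * ?n) ^ 5" using s pos by (intro power_mono) auto
      finally have "(?a + ?c) ^ 3 * (?a * ?c) \<le> 3 ^ 5 * ?n ^ 5" by (simp add: power_mult_distrib)
      moreover have "1 / Y \<le> 3 ^ 5 / X" if "0 < X" "0 < Y" "X \<le> 3 ^ 5 * Y" for X Y :: real
        using that by (simp add: field_simps)
      moreover have "0 < (?a + ?c) ^ 3 * (?a * ?c)" "0 < ?n ^ 5"
        using mult_pos_pos[OF zero_less_power[OF add_pos_pos[OF pos(1,2)]] mult_pos_pos[OF pos(1,2)]]
          zero_less_power[OF pos(3)] by blast+
      ultimately have "1 / ?n ^ 5 \<le> 3 ^ 5 / ((?a + ?c) ^ 3 * (?a * ?c))" by blast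
      then have "1 / ?n ^ 5 \<le> 3 ^ 5 / (?a + ?c) ^ 3 * (1 / (?a * ?c))" by simp
      moreover have "0 \<le> 3 ^ 5 / (?a + ?c) ^ 3" "0 \<le> 1 / (?a * ?c)" using pos by auto
      ultimately show ?case using pos by (simp add: ennreal_mult[symmetric] ennreal_leI del: times_divide_eq_right)
    qed
  qed
  also have "\<dots> = ennreal (2 * pi) * (\<integral>\<^sup>+ s. ennreal (3 ^ 5 / s ^ 3) * indicator {norm (0 - ?e)..} s \<partial>lborel)"
    by (rule nn_integral_foci) auto
  also have "(\<integral>\<^sup>+ s. ennreal (3 ^ 5 / s ^ 3) * indicator {norm (0 - ?e)..} s \<partial>lborel) = ennreal (0 - (- (3 ^ 5 / (2 * 1 ^ 2))))"
  proof -
    have "(\<integral>\<^sup>+ s. ennreal (3 ^ 5 / s ^ 3) * indicator {1..} s \<partial>lborel) = ennreal (0 - (- (3 ^ 5 / (2 * 1 ^ 2))))"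
    proof (rule nn_integral_FTC_atLeast)
      fix s :: real assume s: "1 \<le> s"
      show "((\<lambda>s. - (3 ^ 5 / (2 * s ^ 2))) has_real_derivative 3 ^ 5 / s ^ 3) (at s)"
        using s by (auto intro!: derivative_eq_intros simp: field_simps power_numeral_reduce)
      show "0 \<le> 3 ^ 5 / s ^ 3" using s by simp
    next
      have "((\<lambda>s :: real. - (3 ^ 5 / 2) * inverse s ^ 2) \<longlongrightarrow> - (3 ^ 5 / 2) * 0 ^ 2) at_top"
        by (intro tendsto_intros tendsto_inverse_0_at_top filterlim_ident)
      moreover have "- (3 ^ 5 / 2) * inverse s ^ 2 = - (3 ^ 5 / (2 * s ^ 2))" for s :: real
        by (simp only: inverse_eq_divide power_one_over) simp
      ultimately show "((\<lambda>s :: real. - (3 ^ 5 / (2 * s ^ 2))) \<longlongrightarrow> 0) at_top" by (simp only:) simp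
    qed auto
    then show ?thesis using e by simp
  qed
  finally show "(\<integral>\<^sup>+ y. ennreal (norm (1 / soft_norm 1 y ^ 5)) \<partial>lborel) < \<infinity>"
    using order_le_less_trans by (fastforce simp: ennreal_mult_less_top)
qed auto

text \<open>The value is \<open>4 \<pi>\<close>, but only its sign matters.\<close>

definition kernel_const :: real where
  "kernel_const = (LINT y|lborel. 3 / soft_norm 1 (y :: real^3) ^ 5)"

lemma kernel_const_pos: "0 < kernel_const"
proof -
  have i: "integrable lborel (\<lambda>y :: real^3. 3 / soft_norm 1 y ^ 5)"
    using integrable_mult_right[OF integrable_poisson_kernel, of 3] by simp
  have p: "0 < 3 / soft_norm 1 y ^ 5" for y :: "real^3" by (simp add: soft_norm_pos)
  have "kernel_const \<noteq> 0"
  proof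
    assume "kernel_const = 0"
    then have "AE y :: real^3 in lborel. 3 / soft_norm 1 y ^ 5 = 0"
      unfolding kernel_const_def using integral_nonneg_eq_0_iff_AE[OF i] p less_imp_le by blast
    then have "AE y :: real^3 in lborel. False" using p by (auto elim!: eventually_mono simp: less_le)
    then show False by (simp add: ae_filter_eq_bot_iff)
  qed
  moreover have "0 \<le> kernel_const" unfolding kernel_const_def using p less_imp_le by (intro integral_nonneg_AE) blast
  ultimately show ?thesis by simp
qed

lemma bounded_of_compact_support:
  fixes G :: "real \<Rightarrow> real"
  assumes "continuous_on UNIV G" "\<And>s. s \<notin> {a..b} \<Longrightarrow> G s = 0"
  obtains K where "0 \<le> K" "\<And>s. \<bar>G s\<bar> \<le> K"
proof -
  have "compact (G ` {a..b})"
    by (rule compact_continuous_image[OF continuous_on_subset[OF assms(1)]]) auto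
  from compact_imp_bounded[OF this] obtain K where K: "\<forall>y\<in>G ` {a..b}. norm y \<le> K"
    unfolding bounded_iff by blast
  have "\<bar>G s\<bar> \<le> max K 0" for s
    using K assms(2)[of s] by (cases "s \<in> {a..b}") (auto simp: le_max_iff_disj)
  then show ?thesis using that[of "max K 0"] by simp
qed

lemma dir_deriv_zero_outside:
  fixes G :: "real \<Rightarrow> real"
  assumes "\<And>s. s \<notin> {a..b} \<Longrightarrow> G s = 0" "s \<notin> {a..b}"
  shows "dir_deriv v G s = 0"
proof -
  have "{x. G x \<noteq> 0} \<subseteq> {a..b}" using assms(1) by blast
  then have "supp G \<subseteq> {a..b}" unfolding supp_def by (rule closure_minimal) simp
  then show ?thesis using supp_dir_deriv_subset[of v G] supp_notin[of s "dir_deriv v G"] assms(2) by blast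
qed

section \<open>The wave equation tested with regularised spherical waves\<close>

context cone_wave
begin

text \<open>The support of G(t + n)/n is unbounded towards the past. Multiplication by the cutoff
  \<open>h\<close> in time makes it a test function and changes nothing near the cone, which lies in
  nonnegative times.\<close>

lemma weak_regularised:
  fixes G :: "real \<Rightarrow> real" and z :: "real^3"
  assumes G: "smooth G" and G0: "\<And>s. s \<notin> {a..b} \<Longrightarrow> G s = 0" and \<epsilon>: "0 < \<epsilon>"
  defines "n \<equiv> \<lambda>x. soft_norm \<epsilon> (x - z)"
  shows "(LINT w|lborel. indicator cone_set w * r w * wave_defect G \<epsilon> (snd w - z) (fst w))
    = (LINT x|lborel. Q x * (G (norm x + n x) / n x) / (4 * pi * norm x))
     + (LINT w|lborel. indicator cone_set w * S w * (G (fst w + n (snd w)) / n (snd w)))"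
proof -
  obtain h :: "real \<Rightarrow> real" where h: "smooth h" "\<And>t. t \<le> -1 \<Longrightarrow> h t = 0" "\<And>t. t \<ge> -1/2 \<Longrightarrow> h t = 1"
    using smooth_step_exists by blast
  define \<phi> where "\<phi> w = h (fst w) * (G (fst w + n (snd w)) * n (snd w) powr (-1))" for w :: spacetime
  have npos: "0 < n x" for x unfolding n_def by (rule soft_norm_pos[OF \<epsilon>])
  have npowr: "n x powr 1 = n x" "n x powr (-1) = 1 / n x" for x
    using npos[of x] by (auto simp: powr_minus divide_inverse)
  have sfst: "smooth (fst :: spacetime \<Rightarrow> real)" by (rule smooth_bounded_linear) (rule bounded_linear_fst)
  have sn: "smooth (\<lambda>w :: spacetime. n (snd w))"
    using smooth_soft_norm_powr[OF \<epsilon>, of z 1] less_imp_le[OF soft_norm_pos[OF \<epsilon>]] by (simp add: n_def)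
  have sm: "smooth \<phi>" unfolding \<phi>_def
    by (intro smooth_mult smooth_compose[OF h(1)] smooth_compose[OF G] smooth_add sfst sn)
       (use smooth_soft_norm_powr[OF \<epsilon>, of z "-1"] in \<open>simp add: n_def\<close>)
  have test: "test_fun \<phi>"
  proof (rule test_funI[OF sm])
    show "compact ({-1..b} \<times> cball z (b + 1) :: spacetime set)" by (intro compact_Times compact_Icc compact_cball)
    fix w :: spacetime assume w: "w \<notin> {-1..b} \<times> cball z (b + 1)"
    show "\<phi> w = 0"
    proof (rule ccontr)
      assume "\<phi> w \<noteq> 0"
      then have "h (fst w) \<noteq> 0" "G (fst w + n (snd w)) \<noteq> 0" by (auto simp: \<phi>_def)
      then have "-1 < fst w" "fst w + n (snd w) \<le> b" using h(2)[of "fst w"] G0[of "fst w + n (snd w)"] by fastforce+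
      moreover have "norm (snd w - z) \<le> n (snd w)" unfolding n_def by (rule soft_norm_ge)
      moreover note npos[of "snd w"]
      ultimately show False using w by (cases w) (auto simp: dist_norm norm_minus_commute)
    qed
  qed
  have eq: "\<phi> w = G (fst w + n (snd w)) / n (snd w)" if "w \<in> {w. -1/2 < fst w}" for w
    using that h(3)[of "fst w"] npos[of "snd w"] by (simp add: \<phi>_def npowr)
  have op: "open {w :: spacetime. -1/2 < fst w}" by (intro open_Collect_less continuous_intros)
  have cone: "w \<in> {w. -1/2 < fst w}" if "w \<in> cone_set" for w
  proof -
    have "norm (snd w) \<le> fst w" using that by (auto simp: cone_set_def)
    moreover have "0 \<le> norm (snd w)" by simp
    ultimately have "0 \<le> fst w" by linarith
    then show ?thesis by simp
  qed
  have eqx: "\<phi> (norm x, x) = G (norm x + n x) / n x" for x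
    using eq[OF cone[of "(norm x, x)"]] by (simp add: cone_set_def)
  have "(LINT w|lborel. indicator cone_set w * r w * dalembert \<phi> w)
    = (LINT w|lborel. indicator cone_set w * r w * wave_defect G \<epsilon> (snd w - z) (fst w))"
    using dalembert_regularised_wave[OF G \<epsilon> eq[unfolded n_def] op cone]
    by (intro Bochner_Integration.integral_cong refl) (auto split: split_indicator)
  moreover have "(LINT w|lborel. indicator cone_set w * S w * \<phi> w)
     = (LINT w|lborel. indicator cone_set w * S w * (G (fst w + n (snd w)) / n (snd w)))"
    using eq[OF cone] by (intro Bochner_Integration.integral_cong refl) (auto split: split_indicator)
  ultimately show ?thesis using weak[OF test] by (simp only: eqx)
qed

text \<open>Rescaling space by \<open>\<epsilon>\<close> around \<open>z\<close> turns the left-hand side into an approximate identity.\<close>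

lemma regularised_limit_left:
  fixes G :: "real \<Rightarrow> real" and z :: "real^3"
  assumes G: "smooth G" and G0: "\<And>s. s \<notin> {a..b} \<Longrightarrow> G s = 0"
    and \<epsilon>: "\<And>k. 0 < \<epsilon> k" "\<epsilon> \<longlonglongrightarrow> 0"
  shows "(\<lambda>k. LINT w|lborel. indicator cone_set w * r w * wave_defect G (\<epsilon> k) (snd w - z) (fst w))
    \<longlonglongrightarrow> kernel_const * (LINT t|lborel. indicator cone_set (t, z) * r (t, z) * G t)"
proof -
  define G1 where "G1 = dir_deriv 1 G"
  define G2 where "G2 = dir_deriv 1 G1"
  have sG: "smooth G1" "smooth G2" unfolding G1_def G2_def by (simp_all add: smooth_dir_deriv G)
  have cG: "continuous_on UNIV G" "continuous_on UNIV G1" "continuous_on UNIV G2"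
    using G sG smooth_continuous by auto
  have z1: "G1 s = 0" if "s \<notin> {a..b}" for s unfolding G1_def by (rule dir_deriv_zero_outside[OF G0 that])
  have z2: "G2 s = 0" if "s \<notin> {a..b}" for s unfolding G2_def by (rule dir_deriv_zero_outside[OF z1 that])
  obtain K0 where K0: "0 \<le> K0" "\<And>s. \<bar>G s\<bar> \<le> K0" using bounded_of_compact_support[OF cG(1) G0] by blast
  obtain K1 where K1: "0 \<le> K1" "\<And>s. \<bar>G1 s\<bar> \<le> K1" using bounded_of_compact_support[OF cG(2) z1] by blast
  obtain K2 where K2: "0 \<le> K2" "\<And>s. \<bar>G2 s\<bar> \<le> K2" using bounded_of_compact_support[OF cG(3) z2] by blast
  note [measurable] = cG[THEN borel_measurable_continuous_onI]
  define \<rho> where "\<rho> w = indicator cone_set w * r w" for w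
  have [measurable]: "\<rho> \<in> borel_measurable borel"
    unfolding \<rho>_def[abs_def] by (rule borel_measurable_cone_extension[OF r])
  \<comment> \<open>Time is nonnegative on the cone, so a nonzero value of \<open>G\<close> or its
    derivatives at t + n bounds both t and n by \<open>B\<close>. This turns the first and second
    derivative terms into bounded multiples of the integrable kernel.\<close>
  define B where "B = max b 0"
  obtain M where M: "0 \<le> M" "\<And>w. fst w \<le> B \<Longrightarrow> \<bar>\<rho> w\<bar> \<le> M"
    unfolding \<rho>_def using cone_extension_bounded[OF r] by blast
  let ?m = "\<lambda>w :: spacetime. soft_norm 1 (snd w)"
  define f where "f k w = \<rho> (fst w, z + \<epsilon> k *\<^sub>R snd w) * ((\<epsilon> k * ?m w)\<^sup>2 * G2 (fst w + \<epsilon> k * ?m w)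
      - 3 * (\<epsilon> k * ?m w) * G1 (fst w + \<epsilon> k * ?m w) + 3 * G (fst w + \<epsilon> k * ?m w)) / ?m w ^ 5" for k and w :: spacetime
  define g where "g w = \<rho> (fst w, z) * (3 * G (fst w)) / ?m w ^ 5" for w :: spacetime
  define D where "D = M * (B\<^sup>2 * K2 + 3 * B * K1 + 3 * K0)"
  have mpos: "0 < ?m w" for w by (rule soft_norm_pos) simp
  have B0: "0 \<le> B" by (simp add: B_def)
  have [measurable]: "(\<lambda>w :: spacetime. (fst w, z + \<epsilon> k *\<^sub>R snd w)) \<in> borel_measurable borel"
       "(\<lambda>w :: spacetime. (fst w, z)) \<in> borel_measurable borel"
       "(\<lambda>t :: real. (t, z)) \<in> borel_measurable borel" for k
    by (intro borel_measurable_continuous_onI continuous_intros)+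
  have eq: "(LINT w|lborel. indicator cone_set w * r w * wave_defect G (\<epsilon> k) (snd w - z) (fst w))
     = (LINT w|lborel. f k w)" for k
  proof -
    have alg: "e ^ 3 * (R * (e\<^sup>2 * (A2 / (e * m) ^ 3 - 3 * A1 / (e * m) ^ 4 + 3 * A0 / (e * m) ^ 5)))
       = R * ((e * m)\<^sup>2 * A2 - 3 * (e * m) * A1 + 3 * A0) / m ^ 5" if "0 < e" "0 < m" for e m R A0 A1 A2 :: real
      using that by (simp add: field_simps power_numeral_reduce)
    show ?thesis
      unfolding \<rho>_def[symmetric] wave_defect_def G1_def[symmetric] G2_def[symmetric]
      by (subst integral_spacetime_rescale[OF \<epsilon>(1)[of k], where z=z])
         (simp_all add: soft_norm_scale[OF \<epsilon>(1)] alg[OF \<epsilon>(1) mpos] f_def[abs_def])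
  qed
  have dom: "\<bar>f k w\<bar> \<le> indicator {0..B} (fst w) * (D / ?m w ^ 5)" for k w
  proof (cases "f k w = 0")
    case True
    have "0 \<le> D" unfolding D_def using M(1) B0 K0(1) K1(1) K2(1) by auto
    then show ?thesis using True mpos[of w] by simp
  next
    case False
    let ?n = "\<epsilon> k * ?m w" and ?s = "fst w + \<epsilon> k * ?m w"
    have n0: "0 < ?n" using \<epsilon>(1) mpos by simp
    have "\<rho> (fst w, z + \<epsilon> k *\<^sub>R snd w) \<noteq> 0" using False by (auto simp: f_def)
    then have "norm (z + \<epsilon> k *\<^sub>R snd w) \<le> fst w" by (auto simp: \<rho>_def cone_set_def split: split_indicator_asm)
    then have t0: "0 \<le> fst w" using norm_ge_zero order_trans by blast
    have "?s \<in> {a..b}"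
    proof (rule ccontr)
      assume "?s \<notin> {a..b}"
      then show False using False G0 z1 z2 by (simp add: f_def)
    qed
    then have "fst w \<le> B" "?n \<le> B" using n0 t0 by (auto simp: B_def)
    then have "\<bar>\<rho> (fst w, z + \<epsilon> k *\<^sub>R snd w)\<bar> \<le> M" by (intro M(2)) simp
    moreover have "\<bar>?n\<^sup>2 * G2 ?s - 3 * ?n * G1 ?s + 3 * G ?s\<bar> \<le> B\<^sup>2 * K2 + 3 * B * K1 + 3 * K0"
    proof -
      have "\<bar>?n\<^sup>2 * G2 ?s\<bar> \<le> B\<^sup>2 * K2" unfolding abs_mult
        using n0 \<open>?n \<le> B\<close> by (intro mult_mono K2(2)) (auto intro!: power_mono)
      moreover have "\<bar>3 * ?n * G1 ?s\<bar> \<le> 3 * B * K1" unfolding abs_mult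
        using n0 \<open>?n \<le> B\<close> by (intro mult_mono K1(2)) auto
      moreover have "\<bar>3 * G ?s\<bar> \<le> 3 * K0" using K0(2)[of ?s] by simp
      ultimately show ?thesis by linarith
    qed
    ultimately have "\<bar>\<rho> (fst w, z + \<epsilon> k *\<^sub>R snd w) * (?n\<^sup>2 * G2 ?s - 3 * ?n * G1 ?s + 3 * G ?s)\<bar> \<le> D"
      unfolding D_def abs_mult using M(1) by (intro mult_mono) auto
    then have "\<bar>f k w\<bar> \<le> D / ?m w ^ 5"
      unfolding f_def abs_divide using mpos[of w] by (simp add: divide_right_mono)
    then show ?thesis using t0 \<open>fst w \<le> B\<close> by simp
  qed
  have int_dom: "integrable lborel (\<lambda>w :: spacetime. indicator {0..B} (fst w) * (D / ?m w ^ 5))"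
    using integrable_slab[OF integrable_mult_right[OF integrable_poisson_kernel, of D], of 0 B] by simp
  \<comment> \<open>The extension of \<open>r\<close> by zero may jump at time
    \<open>norm z\<close>, a null set. Elsewhere the factors \<open>\<epsilon> k * ?m w\<close>
    remove the terms with \<open>G1\<close> and \<open>G2\<close> in the limit.\<close>
  have ptw: "AE w in lborel. (\<lambda>k. f k w) \<longlonglongrightarrow> g w"
    using AE_spacetime_time[of "norm z"]
  proof eventually_elim
    case (elim w)
    have "isCont \<rho> (fst w, z)"
      unfolding \<rho>_def[abs_def] using elim by (intro cone_extension_isCont[OF r]) simp
    moreover have "(\<lambda>k. (fst w, z + \<epsilon> k *\<^sub>R snd w)) \<longlonglongrightarrow> (fst w, z + 0 *\<^sub>R snd w)"
      by (intro tendsto_intros \<epsilon>(2))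
    ultimately have "(\<lambda>k. \<rho> (fst w, z + \<epsilon> k *\<^sub>R snd w)) \<longlonglongrightarrow> \<rho> (fst w, z)"
      using isCont_tendsto_compose[of "(fst w, z)" \<rho>] by simp
    moreover have e: "(\<lambda>k. \<epsilon> k * ?m w) \<longlonglongrightarrow> 0" using tendsto_mult[OF \<epsilon>(2) tendsto_const] by simp
    moreover have "(\<lambda>k. fst w + \<epsilon> k * ?m w) \<longlonglongrightarrow> fst w" using tendsto_add[OF tendsto_const e] by simp
    then have "(\<lambda>k. F (fst w + \<epsilon> k * ?m w)) \<longlonglongrightarrow> F (fst w)" if "continuous_on UNIV F" for F :: "real \<Rightarrow> real"
      using that isCont_tendsto_compose by (metis continuous_on_eq_continuous_at open_UNIV UNIV_I)
    note this[OF cG(1)] this[OF cG(2)] this[OF cG(3)]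
    ultimately have "(\<lambda>k. f k w) \<longlonglongrightarrow> \<rho> (fst w, z) * (0\<^sup>2 * G2 (fst w) - 3 * 0 * G1 (fst w) + 3 * G (fst w)) / ?m w ^ 5"
      unfolding f_def using mpos[of w] by (intro tendsto_intros) auto
    then show ?case by (simp add: g_def)
  qed
  have meas: "f k \<in> borel_measurable lborel" "g \<in> borel_measurable lborel" for k
    unfolding f_def[abs_def] g_def[abs_def] by measurable
  have lim: "(\<lambda>k. LINT w|lborel. f k w) \<longlonglongrightarrow> (LINT w|lborel. g w)"
    by (rule integral_dominated_convergence[OF meas(2,1) int_dom ptw]) (use dom in auto)
  have intg: "integrable lborel g"
    by (rule integrable_dominated_convergence[OF meas(2,1) int_dom ptw]) (use dom in auto)
  have "(LINT w|lborel. g w) = (LINT t|lborel. LINT y|lborel. g (t, y))"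
    using lborel_pair.integral_fst'[of g] intg by (simp add: lborel_prod)
  also have "\<dots> = (LINT t|lborel. (\<rho> (t, z) * G t) * kernel_const)"
  proof (intro Bochner_Integration.integral_cong refl)
    fix t
    have "(LINT y|lborel. g (t, y)) = (LINT y|lborel. (\<rho> (t, z) * G t) * (3 / soft_norm 1 y ^ 5))"
      by (intro Bochner_Integration.integral_cong refl) (simp add: g_def)
    then show "(LINT y|lborel. g (t, y)) = (\<rho> (t, z) * G t) * kernel_const"
      unfolding kernel_const_def integral_mult_right_zero .
  qed
  also have "\<dots> = kernel_const * (LINT t|lborel. \<rho> (t, z) * G t)" by simp
  finally have "(LINT w|lborel. g w) = kernel_const * (LINT t|lborel. indicator cone_set (t, z) * r (t, z) * G t)"
    by (simp add: \<rho>_def)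
  with lim show ?thesis unfolding eq[symmetric] by simp
qed

end

section \<open>Kirchhoff's formula tested against functions of time\<close>

context cone_wave
begin

lemma source_term_dominated:
  fixes z :: "real^3"
  obtains C where "0 \<le> C" "integrable lborel (\<lambda>x. indicator {x. norm x + norm (x - z) \<le> 2 * B} x * C / (norm x * norm (x - z)))"
    "\<And>x u. norm x \<le> B \<Longrightarrow> norm (x - z) \<le> B \<Longrightarrow> \<bar>u\<bar> \<le> K / norm (x - z) \<Longrightarrow>
       \<bar>Q x * u / (4 * pi * norm x)\<bar> \<le> indicator {x. norm x + norm (x - z) \<le> 2 * B} x * C / (norm x * norm (x - z))"
proof -
  have "compact (Q ` cball 0 B)"
    by (rule compact_continuous_image[OF continuous_on_subset[OF Q]]) auto
  from compact_imp_bounded[OF this] obtain M where M: "\<forall>y\<in>Q ` cball 0 B. norm y \<le> M"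
    unfolding bounded_iff by blast
  define C where "C = max M 0 * max K 0 / (4 * pi)"
  have C: "0 \<le> C" by (simp add: C_def)
  show ?thesis
  proof (rule that[OF C])
    have "integrable lborel (\<lambda>x. (indicator {x. norm x + norm (x - z) \<le> 2 * B} x * C) / (norm (x - 0) * norm (x - z)))"
      by (rule integrable_foci[where C=C and M="2 * B"]) (auto simp: C split: split_indicator)
    then show "integrable lborel (\<lambda>x. indicator {x. norm x + norm (x - z) \<le> 2 * B} x * C / (norm x * norm (x - z)))"
      by simp
    fix x :: "real^3" and u :: real
    assume x: "norm x \<le> B" "norm (x - z) \<le> B" and u: "\<bar>u\<bar> \<le> K / norm (x - z)"
    have "\<bar>Q x\<bar> \<le> max M 0" using M x(1) by (auto simp: le_max_iff_disj)
    moreover have "K / norm (x - z) \<le> max K 0 / norm (x - z)" by (intro divide_right_mono) auto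
    ultimately have "\<bar>Q x\<bar> * \<bar>u\<bar> \<le> max M 0 * (max K 0 / norm (x - z))"
      using u by (intro mult_mono) auto
    then have "\<bar>Q x\<bar> * \<bar>u\<bar> / (4 * pi * norm x) \<le> max M 0 * (max K 0 / norm (x - z)) / (4 * pi * norm x)"
      by (intro divide_right_mono) auto
    moreover have "max M 0 * (max K 0 / norm (x - z)) / (4 * pi * norm x) = C / (norm x * norm (x - z))"
      by (simp add: C_def)
    ultimately show "\<bar>Q x * u / (4 * pi * norm x)\<bar> \<le> indicator {x. norm x + norm (x - z) \<le> 2 * B} x * C / (norm x * norm (x - z))"
      using x by (simp add: abs_mult)
  qed
qed

lemma volume_term_dominated:
  fixes z :: "real^3"
  obtains C where "0 \<le> C" "integrable lborel (\<lambda>w :: spacetime. indicator {0..B} (fst w) * (indicator (cball z B) (snd w) * C / norm (snd w - z)))"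
    "\<And>w u. w \<in> cone_set \<Longrightarrow> fst w \<le> B \<Longrightarrow> norm (snd w - z) \<le> B \<Longrightarrow> \<bar>u\<bar> \<le> K / norm (snd w - z) \<Longrightarrow>
       \<bar>indicator cone_set w * S w * u\<bar> \<le> indicator {0..B} (fst w) * (indicator (cball z B) (snd w) * C / norm (snd w - z))"
proof -
  obtain M where M: "0 \<le> M" "\<And>w. fst w \<le> B \<Longrightarrow> \<bar>indicator cone_set w * S w\<bar> \<le> M"
    using cone_extension_bounded[OF S] by blast
  define C where "C = M * max K 0"
  have C: "0 \<le> C" using M(1) by (simp add: C_def)
  show ?thesis
  proof (rule that[OF C])
    have [measurable]: "cball z B \<in> sets borel" by simp
    have "integrable lborel (\<lambda>x. (indicator (cball z B) x * C) / norm (x - z))"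
      by (rule integrable_inverse_norm[where C=C and M=B])
         (auto simp: C dist_norm norm_minus_commute split: split_indicator)
    from integrable_slab[OF this, of 0 B]
    show "integrable lborel (\<lambda>w :: spacetime. indicator {0..B} (fst w) * (indicator (cball z B) (snd w) * C / norm (snd w - z)))" .
    fix w :: spacetime and u :: real
    assume w: "w \<in> cone_set" "fst w \<le> B" "norm (snd w - z) \<le> B" and u: "\<bar>u\<bar> \<le> K / norm (snd w - z)"
    have "norm (snd w) \<le> fst w" using w(1) by (auto simp: cone_set_def)
    then have t: "0 \<le> fst w" using norm_ge_zero order_trans by blast
    have "K / norm (snd w - z) \<le> max K 0 / norm (snd w - z)" by (intro divide_right_mono) auto
    then have "\<bar>indicator cone_set w * S w\<bar> * \<bar>u\<bar> \<le> M * (max K 0 / norm (snd w - z))"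
      using u M w(2) by (intro mult_mono) auto
    then show "\<bar>indicator cone_set w * S w * u\<bar> \<le> indicator {0..B} (fst w) * (indicator (cball z B) (snd w) * C / norm (snd w - z))"
      using w t by (simp add: abs_mult C_def dist_norm norm_minus_commute)
  qed
qed

text \<open>This serves two limits: removing the regularisation, and passing from smooth profiles to
  indicators. The restriction to nonzero \<open>y\<close> is essential in the first, since at the
  centre \<open>K / norm y\<close> is 0 by division by zero.\<close>

lemma profile_limits:
  fixes z :: "real^3" and u :: "nat \<Rightarrow> spacetime \<Rightarrow> real"
  assumes [measurable]: "\<And>k. u k \<in> borel_measurable borel" "v \<in> borel_measurable borel"
    and lim: "\<And>t y. y \<noteq> 0 \<Longrightarrow> (\<lambda>k. u k (t, y)) \<longlonglongrightarrow> v (t, y)"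
    and bound: "\<And>k t y. y \<noteq> 0 \<Longrightarrow> \<bar>u k (t, y)\<bar> \<le> K / norm y"
    and supp: "\<And>k t y. 0 \<le> t \<Longrightarrow> u k (t, y) \<noteq> 0 \<Longrightarrow> t \<le> B \<and> norm y \<le> B"
  shows "(\<lambda>k. LINT x|lborel. Q x * u k (norm x, x - z) / (4 * pi * norm x))
      \<longlonglongrightarrow> (LINT x|lborel. Q x * v (norm x, x - z) / (4 * pi * norm x))"
    and "(\<lambda>k. LINT w|lborel. indicator cone_set w * S w * u k (fst w, snd w - z))
      \<longlonglongrightarrow> (LINT w|lborel. indicator cone_set w * S w * v (fst w, snd w - z))"
proof -
  have [measurable]: "Q \<in> borel_measurable borel" by (rule borel_measurable_continuous_onI[OF Q])
  have [measurable]: "(\<lambda>w. indicator cone_set w * S w) \<in> borel_measurable borel"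
    by (rule borel_measurable_cone_extension[OF S])
  have [measurable]: "(\<lambda>x :: real^3. (norm x, x - z)) \<in> borel_measurable borel"
    "(\<lambda>w :: spacetime. (fst w, snd w - z)) \<in> borel_measurable borel"
    by (intro borel_measurable_continuous_onI continuous_intros)+
  obtain C1 where C1: "0 \<le> C1" "integrable lborel (\<lambda>x. indicator {x. norm x + norm (x - z) \<le> 2 * B} x * C1 / (norm x * norm (x - z)))"
    "\<And>x u. norm x \<le> B \<Longrightarrow> norm (x - z) \<le> B \<Longrightarrow> \<bar>u\<bar> \<le> K / norm (x - z) \<Longrightarrow>
       \<bar>Q x * u / (4 * pi * norm x)\<bar> \<le> indicator {x. norm x + norm (x - z) \<le> 2 * B} x * C1 / (norm x * norm (x - z))"
    using source_term_dominated by blast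
  obtain C2 where C2: "0 \<le> C2" "integrable lborel (\<lambda>w :: spacetime. indicator {0..B} (fst w) * (indicator (cball z B) (snd w) * C2 / norm (snd w - z)))"
    "\<And>w u. w \<in> cone_set \<Longrightarrow> fst w \<le> B \<Longrightarrow> norm (snd w - z) \<le> B \<Longrightarrow> \<bar>u\<bar> \<le> K / norm (snd w - z) \<Longrightarrow>
       \<bar>indicator cone_set w * S w * u\<bar> \<le> indicator {0..B} (fst w) * (indicator (cball z B) (snd w) * C2 / norm (snd w - z))"
    using volume_term_dominated by blast
  show "(\<lambda>k. LINT x|lborel. Q x * u k (norm x, x - z) / (4 * pi * norm x))
      \<longlonglongrightarrow> (LINT x|lborel. Q x * v (norm x, x - z) / (4 * pi * norm x))"
  proof (rule integral_dominated_convergence[OF _ _ C1(2)])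
    have AE: "AE x in lborel. x \<noteq> z" "AE x in lborel. x \<noteq> (0 :: real^3)" by (rule AE_lborel_singleton)+
    then show "AE x in lborel. (\<lambda>k. Q x * u k (norm x, x - z) / (4 * pi * norm x))
       \<longlonglongrightarrow> Q x * v (norm x, x - z) / (4 * pi * norm x)"
      by eventually_elim (intro tendsto_divide[OF tendsto_mult[OF tendsto_const lim] tendsto_const], auto)
    show "AE x in lborel. norm (Q x * u k (norm x, x - z) / (4 * pi * norm x))
       \<le> indicator {x. norm x + norm (x - z) \<le> 2 * B} x * C1 / (norm x * norm (x - z))" for k
      using AE(1)
    proof eventually_elim
      case (elim x)
      show ?case
      proof (cases "u k (norm x, x - z) = 0")
        case True
        then show ?thesis using C1(1) by simp
      next
        case False
        then show ?thesis using C1(3)[OF _ _ bound] elim supp[OF norm_ge_zero False] by simp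
      qed
    qed
  qed measurable
  show "(\<lambda>k. LINT w|lborel. indicator cone_set w * S w * u k (fst w, snd w - z))
      \<longlonglongrightarrow> (LINT w|lborel. indicator cone_set w * S w * v (fst w, snd w - z))"
  proof (rule integral_dominated_convergence[OF _ _ C2(2)])
    show "AE w in lborel. (\<lambda>k. indicator cone_set w * S w * u k (fst w, snd w - z))
       \<longlonglongrightarrow> indicator cone_set w * S w * v (fst w, snd w - z)"
      using AE_spacetime_space[of z] by eventually_elim (intro tendsto_mult[OF tendsto_const lim], auto)
    show "AE w in lborel. norm (indicator cone_set w * S w * u k (fst w, snd w - z))
       \<le> indicator {0..B} (fst w) * (indicator (cball z B) (snd w) * C2 / norm (snd w - z))" for k
      using AE_spacetime_space[of z]
    proof eventually_elim
      case (elim w)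
      show ?case
      proof (cases "w \<notin> cone_set \<or> u k (fst w, snd w - z) = 0")
        case True
        then show ?thesis using C2(1) by auto
      next
        case False
        then have c: "w \<in> cone_set" and g: "u k (fst w, snd w - z) \<noteq> 0" by auto
        have "norm (snd w) \<le> fst w" using c by (auto simp: cone_set_def)
        then have t: "0 \<le> fst w" using norm_ge_zero order_trans by blast
        show ?thesis using C2(3)[OF c _ _ bound] elim supp[OF t g] by simp
      qed
    qed
  qed measurable
qed

text \<open>A signal from the cone at \<open>x\<close> starts at time |x| and reaches
  \<open>z\<close> at |x| + |x - z|; a signal from (t, x) arrives at t + |x - z|. The function
  \<open>G\<close> is evaluated at these arrival times.\<close>

lemma weak_smooth_profile:
  fixes G :: "real \<Rightarrow> real" and z :: "real^3"
  assumes G: "smooth G" and G0: "\<And>s. s \<notin> {a..b} \<Longrightarrow> G s = 0"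
  shows "kernel_const * (LINT t|lborel. indicator cone_set (t, z) * r (t, z) * G t)
    = (LINT x|lborel. Q x * (G (norm x + norm (x - z)) / norm (x - z)) / (4 * pi * norm x))
     + (LINT w|lborel. indicator cone_set w * S w * (G (fst w + norm (snd w - z)) / norm (snd w - z)))"
proof -
  define \<epsilon> where "\<epsilon> k = inverse (real (Suc k))" for k
  have \<epsilon>: "\<And>k. 0 < \<epsilon> k" "\<epsilon> \<longlonglongrightarrow> 0"
    using LIMSEQ_inverse_real_of_nat unfolding \<epsilon>_def[abs_def] by auto
  have cG: "continuous_on UNIV G" using G by (rule smooth_continuous)
  obtain K where K: "0 \<le> K" "\<And>s. \<bar>G s\<bar> \<le> K" using bounded_of_compact_support[OF cG G0] by blast
  note [measurable] = borel_measurable_continuous_onI[OF cG]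
  define u where "u k w = G (fst w + soft_norm (\<epsilon> k) (snd w)) / soft_norm (\<epsilon> k) (snd w)" for k and w :: spacetime
  define v where "v w = G (fst w + norm (snd w)) / norm (snd w)" for w :: spacetime
  have mu: "u k \<in> borel_measurable borel" and mv: "v \<in> borel_measurable borel" for k
    unfolding u_def[abs_def] v_def[abs_def] by measurable
  have supp: "t \<le> max b 0 \<and> norm y \<le> max b 0" if "0 \<le> t" "u k (t, y) \<noteq> 0" for k t and y :: "real^3"
  proof -
    have "G (t + soft_norm (\<epsilon> k) y) \<noteq> 0" using that(2) by (auto simp: u_def)
    then have "t + soft_norm (\<epsilon> k) y \<le> b" using G0 by fastforce
    then show ?thesis using that(1) soft_norm_ge[of y "\<epsilon> k"] norm_ge_zero[of y] by linarith
  qed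
  have bound: "\<bar>u k (t, y)\<bar> \<le> K / norm y" if "y \<noteq> 0" for k t and y :: "real^3"
  proof -
    have "\<bar>G (t + soft_norm (\<epsilon> k) y)\<bar> / soft_norm (\<epsilon> k) y \<le> K / norm y"
      using K soft_norm_ge[of y "\<epsilon> k"] that by (intro frac_le) auto
    then show ?thesis using soft_norm_pos[OF \<epsilon>(1), of k y] by (simp add: u_def)
  qed
  have lim: "(\<lambda>k. u k (t, y)) \<longlonglongrightarrow> v (t, y)" if "y \<noteq> 0" for t and y :: "real^3"
    unfolding u_def v_def fst_conv snd_conv
  proof (intro tendsto_divide)
    have "isCont G (t + norm y)" using cG by (simp add: continuous_on_eq_continuous_at)
    moreover have "(\<lambda>k. t + soft_norm (\<epsilon> k) y) \<longlonglongrightarrow> t + norm y"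
      by (intro tendsto_intros soft_norm_tendsto \<epsilon>(2))
    ultimately show "(\<lambda>k. G (t + soft_norm (\<epsilon> k) y)) \<longlonglongrightarrow> G (t + norm y)"
      by (rule isCont_tendsto_compose)
  qed (use that soft_norm_tendsto[OF \<epsilon>(2)] in auto)
  have "(LINT x|lborel. Q x * u k (norm x, x - z) / (4 * pi * norm x))
      + (LINT w|lborel. indicator cone_set w * S w * u k (fst w, snd w - z))
    = (LINT w|lborel. indicator cone_set w * r w * wave_defect G (\<epsilon> k) (snd w - z) (fst w))" for k
    unfolding u_def fst_conv snd_conv by (rule weak_regularised[OF G _ \<epsilon>(1), symmetric]) (rule G0)
  then have "(\<lambda>k. (LINT x|lborel. Q x * u k (norm x, x - z) / (4 * pi * norm x))
      + (LINT w|lborel. indicator cone_set w * S w * u k (fst w, snd w - z)))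
    \<longlonglongrightarrow> kernel_const * (LINT t|lborel. indicator cone_set (t, z) * r (t, z) * G t)"
    by (simp only:) (rule regularised_limit_left[OF G _ \<epsilon>], rule G0)
  from LIMSEQ_unique[OF this tendsto_add[OF profile_limits[OF mu mv lim bound supp]]]
  show ?thesis by (simp add: v_def)
qed

text \<open>With indicators the formula speaks about time intervals, the form needed both for the
  data and for the later subdivision argument.\<close>

lemma weak_interval:
  fixes z :: "real^3"
  shows "kernel_const * (LINT t|lborel. indicator cone_set (t, z) * r (t, z) * indicat_real {a<..<b} t)
    = (LINT x|lborel. Q x * (indicat_real {a<..<b} (norm x + norm (x - z)) / norm (x - z)) / (4 * pi * norm x))
     + (LINT w|lborel. indicator cone_set w * S w * (indicat_real {a<..<b} (fst w + norm (snd w - z)) / norm (snd w - z)))"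
proof -
  obtain G where G: "\<And>n. smooth (G n)" "\<And>n s. 0 \<le> G n s" "\<And>n s. G n s \<le> 1"
    and G0: "\<And>n s. s \<notin> {a<..<b} \<Longrightarrow> G n s = 0" and limG: "\<And>s. (\<lambda>n. G n s) \<longlonglongrightarrow> indicat_real {a<..<b} s"
    using interval_indicator_approx by blast
  have G0': "G n s = 0" if "s \<notin> {a..b}" for n s using G0[of s n] that by auto
  note [measurable] = borel_measurable_continuous_onI[OF smooth_continuous[OF G(1)]]
  have [measurable]: "(\<lambda>w. indicator cone_set w * r w) \<in> borel_measurable borel"
    by (rule borel_measurable_cone_extension[OF r])
  define u where "u k w = G k (fst w + norm (snd w)) / norm (snd w)" for k and w :: spacetime
  define v where "v w = indicat_real {a<..<b} (fst w + norm (snd w)) / norm (snd w)" for w :: spacetime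
  have mu: "u k \<in> borel_measurable borel" and mv: "v \<in> borel_measurable borel" for k
    unfolding u_def[abs_def] v_def[abs_def] by measurable
  have supp: "t \<le> max b 0 \<and> norm y \<le> max b 0" if "0 \<le> t" "u k (t, y) \<noteq> 0" for k t and y :: "real^3"
  proof -
    have "G k (t + norm y) \<noteq> 0" using that(2) by (auto simp: u_def)
    then have "t + norm y \<le> b" using G0' by fastforce
    then show ?thesis using that(1) norm_ge_zero[of y] by linarith
  qed
  have bound: "\<bar>u k (t, y)\<bar> \<le> 1 / norm y" for k t and y :: "real^3"
    using G(2,3)[of k "t + norm y"] by (simp add: u_def divide_right_mono)
  have lim: "(\<lambda>k. u k (t, y)) \<longlonglongrightarrow> v (t, y)" for t and y :: "real^3"
    unfolding u_def v_def divide_inverse fst_conv snd_conv by (intro tendsto_intros limG)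
  have l0: "(\<lambda>k. LINT t|lborel. indicator cone_set (t, z) * r (t, z) * G k t)
    \<longlonglongrightarrow> (LINT t|lborel. indicator cone_set (t, z) * r (t, z) * indicat_real {a<..<b} t)"
  proof -
    obtain M where M: "0 \<le> M" "\<And>w. fst w \<le> max b 0 \<Longrightarrow> \<bar>indicator cone_set w * r w\<bar> \<le> M"
      using cone_extension_bounded[OF r] by blast
    have [measurable]: "(\<lambda>t :: real. (t, z)) \<in> borel_measurable borel"
      by (intro borel_measurable_continuous_onI continuous_intros)
    have m: "(\<lambda>t. indicator cone_set (t, z) * r (t, z)) \<in> borel_measurable borel"
      using measurable_compose[of "\<lambda>t. (t, z)" borel borel "\<lambda>w. indicator cone_set w * r w"] by simp
    note m[measurable]
    show ?thesis
    proof (rule integral_dominated_convergence)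
      show "integrable lborel (\<lambda>t. indicat_real {a..b} t *\<^sub>R M)"
        by (rule borel_integrable_compact) auto
      show "AE t in lborel. (\<lambda>k. indicator cone_set (t, z) * r (t, z) * G k t)
        \<longlonglongrightarrow> indicator cone_set (t, z) * r (t, z) * indicat_real {a<..<b} t"
        by (intro always_eventually allI tendsto_intros limG)
      show "AE t in lborel. norm (indicator cone_set (t, z) * r (t, z) * G k t) \<le> indicat_real {a..b} t *\<^sub>R M" for k
      proof (intro always_eventually allI)
        fix t
        show "norm (indicator cone_set (t, z) * r (t, z) * G k t) \<le> indicat_real {a..b} t *\<^sub>R M"
        proof (cases "t \<in> {a..b}")
          case True
          then have "\<bar>indicator cone_set (t, z) * r (t, z)\<bar> * \<bar>G k t\<bar> \<le> M * 1"
            using M G(2,3)[of k t] by (intro mult_mono) (auto simp: le_max_iff_disj)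
          then show ?thesis using True by (simp add: abs_mult)
        qed (simp add: G0')
      qed
    qed measurable
  qed
  have "kernel_const * (LINT t|lborel. indicator cone_set (t, z) * r (t, z) * G k t)
    = (LINT x|lborel. Q x * u k (norm x, x - z) / (4 * pi * norm x))
     + (LINT w|lborel. indicator cone_set w * S w * u k (fst w, snd w - z))" for k
    using G0' unfolding u_def fst_conv snd_conv by (intro weak_smooth_profile[OF G(1)])
  then have "(\<lambda>k. (LINT x|lborel. Q x * u k (norm x, x - z) / (4 * pi * norm x))
      + (LINT w|lborel. indicator cone_set w * S w * u k (fst w, snd w - z)))
    \<longlonglongrightarrow> kernel_const * (LINT t|lborel. indicator cone_set (t, z) * r (t, z) * indicat_real {a<..<b} t)"
    using tendsto_mult_left[OF l0, of kernel_const] by (simp only:)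
  from LIMSEQ_unique[OF this tendsto_add[OF profile_limits[OF mu mv lim bound supp]]]
  show ?thesis by (simp add: v_def)
qed

end

section \<open>Integral inequalities\<close>

text \<open>A non-integrable function has integral 0 by convention, so the estimates below can pass
  to nonnegative integrals, where Tonelli applies.\<close>

lemma ennreal_abs_integral_le:
  fixes f :: "'a \<Rightarrow> real"
  shows "ennreal \<bar>integral\<^sup>L M f\<bar> \<le> (\<integral>\<^sup>+ x. ennreal \<bar>f x\<bar> \<partial>M)"
proof (cases "integrable M f")
  case True
  then show ?thesis using integral_norm_bound_ennreal[of M f] by simp
qed (simp add: not_integrable_integral_eq)

text \<open>The supremum \<open>W\<close> of \<open>F\<close> weighted by exp(-2 C s) satisfies W
  \<le> A + W/2, because \<open>C\<close> times the integral of exp(2 C u) over [0, s] is at most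
  exp(2 C s)/2. The bound \<open>M\<close> makes \<open>W\<close> finite, so that W/2 can be
  subtracted.\<close>

lemma gronwall_ennreal:
  fixes F :: "real \<Rightarrow> ennreal"
  assumes [measurable]: "F \<in> borel_measurable borel" and C: "0 < C"
    and fin: "M < \<infinity>" "\<And>s. 0 \<le> s \<Longrightarrow> s \<le> \<tau> \<Longrightarrow> F s \<le> M"
    and ineq: "\<And>s. 0 \<le> s \<Longrightarrow> s \<le> \<tau> \<Longrightarrow> F s \<le> A + ennreal C * (\<integral>\<^sup>+ u. F u * indicator {0..s} u \<partial>lborel)"
    and s: "0 \<le> s" "s \<le> \<tau>"
  shows "F s \<le> 2 * A * ennreal (exp (2 * C * s))"
proof -
  define W where "W = (SUP s\<in>{0..\<tau>}. F s * ennreal (exp (- 2 * C * s)))"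
  have ee: "ennreal (exp (- 2 * C * s)) * ennreal (exp (2 * C * s)) = 1" for s
    by (simp add: ennreal_mult[symmetric] exp_minus field_simps)
  have FW: "F s \<le> W * ennreal (exp (2 * C * s))" if "0 \<le> s" "s \<le> \<tau>" for s
  proof -
    have "F s * ennreal (exp (- 2 * C * s)) \<le> W" unfolding W_def using that by (intro SUP_upper) auto
    then have "F s * ennreal (exp (- 2 * C * s)) * ennreal (exp (2 * C * s)) \<le> W * ennreal (exp (2 * C * s))"
      by (rule mult_right_mono) simp
    then show ?thesis by (simp only: mult.assoc[of "F s" "ennreal (exp (- 2 * C * s))"] ee mult_1_right)
  qed
  have "W \<le> M" unfolding W_def
  proof (rule SUP_least)
    fix s assume "s \<in> {0..\<tau>}"
    then have "F s * ennreal (exp (- 2 * C * s)) \<le> M * 1"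
      using fin(2)[of s] C by (intro mult_mono) (auto simp flip: ennreal_1 intro!: ennreal_leI)
    then show "F s * ennreal (exp (- 2 * C * s)) \<le> M" by simp
  qed
  then have Wfin: "W < \<infinity>" using fin(1) by (rule order_le_less_trans)
  have key: "F s * ennreal (exp (- 2 * C * s)) \<le> A + W * ennreal (1 / 2)" if "s \<in> {0..\<tau>}" for s
  proof -
    note \<open>s \<in> {0..\<tau>}\<close>
    then have s: "0 \<le> s" "s \<le> \<tau>" by auto
    have "(\<integral>\<^sup>+ u. F u * indicator {0..s} u \<partial>lborel) \<le> (\<integral>\<^sup>+ u. W * (ennreal (exp (2 * C * u)) * indicator {0..s} u) \<partial>lborel)"
      using FW s by (intro nn_integral_mono) (auto split: split_indicator)
    also have "\<dots> = W * (\<integral>\<^sup>+ u. ennreal (exp (2 * C * u)) * indicator {0..s} u \<partial>lborel)"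
      by (rule nn_integral_cmult) auto
    also have "(\<integral>\<^sup>+ u. ennreal (exp (2 * C * u)) * indicator {0..s} u \<partial>lborel)
        = ennreal (exp (2 * C * s) / (2 * C) - exp (2 * C * 0) / (2 * C))"
      using s C by (intro nn_integral_FTC_Icc) (auto intro!: derivative_eq_intros)
    also have "\<dots> \<le> ennreal (exp (2 * C * s) / (2 * C))" using C by (intro ennreal_leI) simp
    finally have "(\<integral>\<^sup>+ u. F u * indicator {0..s} u \<partial>lborel) \<le> W * ennreal (exp (2 * C * s) / (2 * C))"
      using mult_left_mono by fastforce
    then have "ennreal C * (\<integral>\<^sup>+ u. F u * indicator {0..s} u \<partial>lborel) \<le> ennreal C * (W * ennreal (exp (2 * C * s) / (2 * C)))"
      by (rule mult_left_mono) simp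
    also have "\<dots> = W * ennreal (C * (exp (2 * C * s) / (2 * C)))"
      using C by (simp add: ennreal_mult[symmetric] mult.left_commute[of "ennreal C"])
    also have "C * (exp (2 * C * s) / (2 * C)) = exp (2 * C * s) / 2" using C by simp
    finally have "F s \<le> A + W * ennreal (exp (2 * C * s) / 2)"
      using ineq[OF s] by (meson add_left_mono order_trans)
    then have "F s * ennreal (exp (- 2 * C * s)) \<le> (A + W * ennreal (exp (2 * C * s) / 2)) * ennreal (exp (- 2 * C * s))"
      by (rule mult_right_mono) simp
    also have "\<dots> = A * ennreal (exp (- 2 * C * s)) + W * (ennreal (exp (2 * C * s) / 2) * ennreal (exp (- 2 * C * s)))"
      by (simp add: distrib_right mult.assoc)
    also have "ennreal (exp (2 * C * s) / 2) * ennreal (exp (- 2 * C * s)) = ennreal (1 / 2)"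
      by (simp add: ennreal_mult[symmetric] exp_minus field_simps)
    also have "A * ennreal (exp (- 2 * C * s)) \<le> A * 1"
      using C s by (intro mult_left_mono) (auto simp flip: ennreal_1 intro!: ennreal_leI)
    finally show ?thesis by (simp only: mult_1_right add_right_mono)
  qed
  have "(SUP s\<in>{0..\<tau>}. F s * ennreal (exp (- 2 * C * s))) \<le> A + W * ennreal (1 / 2)"
    by (rule SUP_least) (rule key)
  then have le: "W \<le> A + W * ennreal (1 / 2)" unfolding W_def[symmetric] .
  have "W \<le> 2 * A"
  proof (cases "A = \<infinity>")
    case False
    obtain w where w: "W = ennreal w" "0 \<le> w" using Wfin by (cases W) auto
    obtain a where a: "A = ennreal a" "0 \<le> a" using False by (cases A) auto
    have "A + W * ennreal (1 / 2) = ennreal (a + w * (1 / 2))"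
      using w a by (simp only: ennreal_mult[symmetric] ennreal_plus[symmetric] zero_le_divide_1_iff zero_le_numeral
          mult_nonneg_nonneg)
    with le w a have "w \<le> a + w * (1 / 2)" by (simp only: ennreal_le_iff add_nonneg_nonneg mult_nonneg_nonneg
          zero_le_divide_1_iff zero_le_numeral)
    then have "ennreal w \<le> ennreal (2 * a)" by (intro ennreal_leI) linarith
    then show ?thesis using w a by (simp add: ennreal_mult)
  qed (simp add: ennreal_mult_eq_top_iff)
  then have "W * ennreal (exp (2 * C * s)) \<le> 2 * A * ennreal (exp (2 * C * s))"
    by (rule mult_right_mono) simp
  then show ?thesis using FW[OF s] by (rule order_trans[rotated])
qed

lemma tonelli_lborel:
  fixes f :: "'a::euclidean_space \<Rightarrow> 'b::euclidean_space \<Rightarrow> ennreal"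
  assumes "(\<lambda>(x, y). f x y) \<in> borel_measurable (lborel \<Otimes>\<^sub>M lborel)"
  shows "(\<integral>\<^sup>+ x. \<integral>\<^sup>+ y. f x y \<partial>lborel \<partial>lborel) = (\<integral>\<^sup>+ y. \<integral>\<^sup>+ x. f x y \<partial>lborel \<partial>lborel)"
  using lborel_pair.Fubini'[OF assms] by simp

text \<open>On pieces where \<open>f\<close> varies little, the absolute value of the integral
  nearly equals the integral of the absolute value; superadditivity of \<open>F\<close> then
  collects the pieces. This converts the signed information of \<open>weak_interval\<close> into
  \<open>L^1\<close> bounds.\<close>

lemma nn_integral_abs_le_of_subintervals:
  fixes f :: "real \<Rightarrow> real" and F :: "real \<Rightarrow> real \<Rightarrow> ennreal"
  assumes f: "continuous_on {a..b} f" and ab: "a \<le> b"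
    and add: "\<And>u v w. a \<le> u \<Longrightarrow> u \<le> v \<Longrightarrow> v \<le> w \<Longrightarrow> w \<le> b \<Longrightarrow> F u v + F v w \<le> F u w"
    and le: "\<And>u v. a \<le> u \<Longrightarrow> u \<le> v \<Longrightarrow> v \<le> b \<Longrightarrow> ennreal \<bar>LINT t|lborel. f t * indicator {u<..<v} t\<bar> \<le> F u v"
  shows "(\<integral>\<^sup>+ t. ennreal \<bar>f t\<bar> * indicator {a..b} t \<partial>lborel) \<le> F a b"
proof (rule ennreal_le_epsilon)
  fix \<epsilon> :: real assume "0 < \<epsilon>"
  define \<delta> where "\<delta> = \<epsilon> / (b - a + 1)"
  have \<delta>: "0 < \<delta>" "\<delta> * (b - a) \<le> \<epsilon>" using \<open>0 < \<epsilon>\<close> ab by (auto simp: \<delta>_def field_simps)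
  let ?N = "\<lambda>u v. \<integral>\<^sup>+ t. ennreal \<bar>f t\<bar> * indicator {u..v} t \<partial>lborel"
  \<comment> \<open>The error is proportional to the length, hence additive under subdivision.
    Outside \<open>{a..b}\<close> the predicate is vacuous, because the bisection principle ranges
    over all intervals.\<close>
  define P where "P u v \<longleftrightarrow> (a \<le> u \<longrightarrow> u \<le> v \<longrightarrow> v \<le> b \<longrightarrow> ?N u v \<le> F u v + ennreal (\<delta> * (v - u)))" for u v
  have meas: "(\<lambda>t. ennreal \<bar>f t\<bar> * indicator {u..v} t) \<in> borel_measurable lborel" if "a \<le> u" "v \<le> b" for u v
  proof -
    have "{u..v} \<subseteq> {a..b}" using that by auto
    then have "continuous_on {u..v} f" using f continuous_on_subset by blast
    then have [measurable]: "(\<lambda>t. indicator {u..v} t * f t) \<in> borel_measurable borel"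
      using borel_measurable_continuous_on_indicator[of "{u..v}" f] by simp
    have "(\<lambda>t. ennreal \<bar>indicator {u..v} t * f t\<bar>) \<in> borel_measurable lborel" by measurable
    also have "(\<lambda>t. ennreal \<bar>indicator {u..v} t * f t\<bar>) = (\<lambda>t. ennreal \<bar>f t\<bar> * indicator {u..v} t)"
      by (auto split: split_indicator)
    finally show ?thesis .
  qed
  have "P a b"
  proof (rule Bolzano[OF ab])
    fix u v w assume uv: "P u v" and vw: "P v w" and le1: "u \<le> v" "v \<le> w"
    show "P u w" unfolding P_def
    proof (intro impI)
      assume g: "a \<le> u" "u \<le> w" "w \<le> b"
      have "?N u w \<le> (\<integral>\<^sup>+ t. ennreal \<bar>f t\<bar> * indicator {u..v} t + ennreal \<bar>f t\<bar> * indicator {v..w} t \<partial>lborel)"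
        by (intro nn_integral_mono) (auto split: split_indicator)
      also have "\<dots> = ?N u v + ?N v w"
        using g le1 by (intro nn_integral_add meas) auto
      also have "\<dots> \<le> (F u v + ennreal (\<delta> * (v - u))) + (F v w + ennreal (\<delta> * (w - v)))"
        using uv vw g le1 unfolding P_def by (intro add_mono) auto
      also have "\<dots> = (F u v + F v w) + (ennreal (\<delta> * (v - u)) + ennreal (\<delta> * (w - v)))"
        by (simp add: ac_simps)
      also have "ennreal (\<delta> * (v - u)) + ennreal (\<delta> * (w - v)) = ennreal (\<delta> * (w - u))"
        using \<delta>(1) le1 by (subst ennreal_plus[symmetric]) (auto simp: algebra_simps)
      also have "F u v + F v w \<le> F u w" using g le1 by (intro add) auto
      finally show "?N u w \<le> F u w + ennreal (\<delta> * (w - u))" by (simp add: add_right_mono)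
    qed
  next
    fix x assume x: "a \<le> x" "x \<le> b"
    then obtain d where d: "0 < d" "\<And>t. t \<in> {a..b} \<Longrightarrow> dist t x < d \<Longrightarrow> dist (f t) (f x) < \<delta> / 2"
      using f \<delta>(1) unfolding continuous_on_iff by (metis atLeastAtMost_iff half_gt_zero)
    have "P u v" if uv: "u \<le> x" "x \<le> v" "v - u < d" for u v
      unfolding P_def
    proof (intro impI)
      assume g: "a \<le> u" "u \<le> v" "v \<le> b"
      have near: "\<bar>f t - f x\<bar> \<le> \<delta> / 2" if "t \<in> {u..v}" for t
      proof -
        have "\<bar>t - x\<bar> < d" "t \<in> {a..b}" using that uv g by auto
        then show ?thesis using d(2)[of t] by (simp add: dist_real_def)
      qed
      have near': "f x - \<delta> / 2 \<le> f t" "f t \<le> f x + \<delta> / 2" if "t \<in> {u..v}" for t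
        using near[OF that] by linarith+
      have "{u..v} \<subseteq> {a..b}" using g by auto
      then have "continuous_on {u..v} f" using f continuous_on_subset by blast
      then have i0: "integrable lborel (\<lambda>t. indicator {u..v} t *\<^sub>R f t)"
        by (intro borel_integrable_compact) auto
      have i: "integrable lborel (\<lambda>t. f t * indicator {u<..<v} t)"
      proof -
        have "integrable lborel (\<lambda>t. indicat_real {u<..<v} t *\<^sub>R (indicator {u..v} t *\<^sub>R f t))"
          by (rule integrable_mult_indicator[OF _ i0]) simp
        also have "(\<lambda>t. indicat_real {u<..<v} t *\<^sub>R (indicator {u..v} t *\<^sub>R f t)) = (\<lambda>t. f t * indicator {u<..<v} t)"
          by (auto split: split_indicator)
        finally show ?thesis .
      qed
      have c: "integrable lborel (\<lambda>t. k * indicat_real {u<..<v} t)" "(LINT t|lborel. k * indicat_real {u<..<v} t) = k * (v - u)" for k :: real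
        using g by (auto simp: emeasure_lborel_Ioo)
      \<comment> \<open>On this piece \<open>f\<close> stays within \<delta>/2 of
        \<open>f x\<close>. The lower bound here and the upper bound (|f x| + \<delta>/2) (v - u)
        below therefore differ by \<delta> (v - u), the error allowed in \<open>P\<close>.\<close>
      have low: "(\<bar>f x\<bar> - \<delta> / 2) * (v - u) \<le> \<bar>LINT t|lborel. f t * indicator {u<..<v} t\<bar>"
      proof (cases "0 \<le> f x")
        case True
        have "(\<bar>f x\<bar> - \<delta> / 2) * indicat_real {u<..<v} t \<le> f t * indicator {u<..<v} t" for t
          using near'[of t] True by (cases "t \<in> {u<..<v}") auto
        then have "(LINT t|lborel. (\<bar>f x\<bar> - \<delta> / 2) * indicat_real {u<..<v} t) \<le> (LINT t|lborel. f t * indicator {u<..<v} t)"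
          by (intro integral_mono c i)
        then show ?thesis by (simp only: c)
      next
        case False
        have "(\<bar>f x\<bar> - \<delta> / 2) * indicat_real {u<..<v} t \<le> - (f t * indicator {u<..<v} t)" for t
          using near'[of t] False by (cases "t \<in> {u<..<v}") auto
        then have "(LINT t|lborel. (\<bar>f x\<bar> - \<delta> / 2) * indicat_real {u<..<v} t) \<le> (LINT t|lborel. - (f t * indicator {u<..<v} t))"
          by (intro integral_mono c Bochner_Integration.integrable_minus i)
        then show ?thesis by (simp only: c Bochner_Integration.integral_minus)
      qed
      have "?N u v \<le> (\<integral>\<^sup>+ t. ennreal (\<bar>f x\<bar> + \<delta> / 2) * indicator {u..v} t \<partial>lborel)"
      proof (intro nn_integral_mono)
        fix t
        show "ennreal \<bar>f t\<bar> * indicator {u..v} t \<le> ennreal (\<bar>f x\<bar> + \<delta> / 2) * indicator {u..v} t"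
        proof (cases "t \<in> {u..v}")
          case True
          then have "\<bar>f t\<bar> \<le> \<bar>f x\<bar> + \<delta> / 2" using near'[of t] by linarith
          then show ?thesis using True by (simp only: indicator_simps mult_1_right ennreal_leI)
        qed simp
      qed
      also have "\<dots> = ennreal ((\<bar>f x\<bar> + \<delta> / 2) * (v - u))"
        using g \<delta>(1) by (subst nn_integral_cmult_indicator) (auto simp: ennreal_mult)
      also have "\<dots> \<le> ennreal (\<bar>LINT t|lborel. f t * indicator {u<..<v} t\<bar> + \<delta> * (v - u))"
      proof (rule ennreal_leI)
        have "(\<bar>f x\<bar> + \<delta> / 2) * (v - u) = (\<bar>f x\<bar> - \<delta> / 2) * (v - u) + \<delta> * (v - u)"
          by (simp add: field_simps)
        then show "(\<bar>f x\<bar> + \<delta> / 2) * (v - u) \<le> \<bar>LINT t|lborel. f t * indicator {u<..<v} t\<bar> + \<delta> * (v - u)"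
          using low by linarith
      qed
      also have "\<dots> = ennreal \<bar>LINT t|lborel. f t * indicator {u<..<v} t\<bar> + ennreal (\<delta> * (v - u))"
        using g \<delta>(1) by (intro ennreal_plus) auto
      also have "\<dots> \<le> F u v + ennreal (\<delta> * (v - u))"
        using le g by (intro add_right_mono) auto
      finally show "?N u v \<le> F u v + ennreal (\<delta> * (v - u))" .
    qed
    then show "\<exists>d>0. \<forall>u v. u \<le> x \<and> x \<le> v \<and> v - u < d \<longrightarrow> P u v" using d(1) by blast
  qed
  then have "?N a b \<le> F a b + ennreal (\<delta> * (b - a))" using ab by (simp add: P_def)
  also have "\<dots> \<le> F a b + ennreal \<epsilon>" using \<delta>(2) by (intro add_left_mono ennreal_leI)
  finally show "?N a b \<le> F a b + ennreal \<epsilon>" .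
qed

section \<open>Volterra estimates\<close>

text \<open>As an equality of measures the two-focus identity also transfers integrals of functions
  of changing sign.\<close>

lemma distr_foci:
  fixes p z :: "real^3"
  shows "distr (density lborel (\<lambda>x. ennreal (1 / (norm (x - p) * norm (x - z))))) borel (\<lambda>x. norm (x - p) + norm (x - z))
    = density lborel (\<lambda>s. ennreal (2 * pi) * indicator {norm (p - z)..} s)" (is "?M = ?N")
proof (rule measure_eqI)
  fix A assume "A \<in> sets ?M"
  then have A[measurable]: "A \<in> sets borel" by simp
  have "(\<lambda>x :: real^3. norm (x - p) + norm (x - z)) \<in> borel_measurable borel" by measurable
  from measurable_sets[OF this A] have "(\<lambda>x. norm (x - p) + norm (x - z)) -` A \<in> sets borel" by simp
  then have "emeasure ?M A = (\<integral>\<^sup>+ x. indicator A (norm (x - p) + norm (x - z)) * ennreal (1 / (norm (x - p) * norm (x - z))) \<partial>lborel)"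
    by (subst emeasure_distr, simp, simp, subst emeasure_density)
       (auto intro!: nn_integral_cong split: split_indicator)
  also have "\<dots> = ennreal (2 * pi) * (\<integral>\<^sup>+ s. indicator A s * indicator {norm (p - z)..} s \<partial>lborel)"
    by (rule nn_integral_foci) auto
  also have "\<dots> = emeasure ?N A"
    by (subst emeasure_density) (auto simp: nn_integral_cmult[symmetric] mult_ac)
  finally show "emeasure ?M A = emeasure ?N A" .
qed simp

lemma integral_foci:
  fixes p z :: "real^3" and g :: "real \<Rightarrow> real"
  assumes [measurable]: "g \<in> borel_measurable borel"
  shows "(LINT x|lborel. g (norm (x - p) + norm (x - z)) / (norm (x - p) * norm (x - z)))
    = 2 * pi * (LINT s|lborel. indicator {norm (p - z)..} s * g s)"
proof -
  have "(LINT x|lborel. g (norm (x - p) + norm (x - z)) / (norm (x - p) * norm (x - z)))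
      = (LINT x|density lborel (\<lambda>x. ennreal (1 / (norm (x - p) * norm (x - z)))). g (norm (x - p) + norm (x - z)))"
    by (subst integral_real_density) auto
  also have "\<dots> = (LINT s|distr (density lborel (\<lambda>x. ennreal (1 / (norm (x - p) * norm (x - z))))) borel (\<lambda>x. norm (x - p) + norm (x - z)). g s)"
    by (subst integral_distr) auto
  also have "\<dots> = (LINT s|density lborel (\<lambda>s. ennreal (2 * pi * indicator {norm (p - z)..} s)). g s)"
    unfolding distr_foci by (simp add: ennreal_mult ennreal_indicator)
  also have "\<dots> = (LINT s|lborel. (2 * pi * indicator {norm (p - z)..} s) * g s)"
    by (subst integral_real_density) auto
  finally show ?thesis by (simp add: mult.assoc)
qed

text \<open>The density in the sum of the distances is constant, so an interval contributes at most
  its length wherever the foci are. The shift \<open>c\<close> is the time already elapsed at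
  \<open>p\<close>.\<close>

lemma nn_integral_foci_interval:
  fixes p z :: "real^3"
  shows "(\<integral>\<^sup>+ x. indicator {a<..b} (c + norm (x - p) + norm (x - z)) * ennreal (1 / (norm (x - p) * norm (x - z))) \<partial>lborel)
    \<le> ennreal (2 * pi) * (ennreal (b - a) * indicator {..b} (c + norm (p - z)))"
proof -
  have "(\<integral>\<^sup>+ x. indicator {a<..b} (c + norm (x - p) + norm (x - z)) * ennreal (1 / (norm (x - p) * norm (x - z))) \<partial>lborel)
      = (\<integral>\<^sup>+ x. indicator {a - c<..b - c} (norm (x - p) + norm (x - z)) * ennreal (1 / (norm (x - p) * norm (x - z))) \<partial>lborel)"
    by (intro nn_integral_cong) (auto split: split_indicator)
  also have "\<dots> = ennreal (2 * pi) * (\<integral>\<^sup>+ s. indicator {a - c<..b - c} s * indicator {norm (p - z)..} s \<partial>lborel)"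
    by (rule nn_integral_foci) auto
  also have "(\<integral>\<^sup>+ s. indicator {a - c<..b - c} s * indicator {norm (p - z)..} s \<partial>lborel)
      \<le> (\<integral>\<^sup>+ s. indicator {..b} (c + norm (p - z)) * indicator {a - c<..b - c} s \<partial>lborel)"
    by (intro nn_integral_mono) (auto split: split_indicator)
  also have "\<dots> = indicator {..b} (c + norm (p - z)) * emeasure lborel {a - c<..b - c}"
    by (subst nn_integral_cmult_indicator) auto
  also have "\<dots> \<le> ennreal (b - a) * indicator {..b} (c + norm (p - z))"
    by (cases "a \<le> b") (auto simp: mult.commute)
  finally show ?thesis by (simp add: mult_left_mono)
qed

lemma nn_integral_foci_sublevel:
  fixes p z :: "real^3"
  shows "(\<integral>\<^sup>+ x. indicator {..b} (c + norm (x - p) + norm (x - z)) * ennreal (1 / (norm (x - p) * norm (x - z))) \<partial>lborel)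
    = ennreal (2 * pi) * ennreal (b - (c + norm (p - z)))"
proof -
  have "(\<integral>\<^sup>+ x. indicator {..b} (c + norm (x - p) + norm (x - z)) * ennreal (1 / (norm (x - p) * norm (x - z))) \<partial>lborel)
      = (\<integral>\<^sup>+ x. indicator {..b - c} (norm (x - p) + norm (x - z)) * ennreal (1 / (norm (x - p) * norm (x - z))) \<partial>lborel)"
    by (intro nn_integral_cong) (auto split: split_indicator)
  also have "\<dots> = ennreal (2 * pi) * (\<integral>\<^sup>+ s. indicator {..b - c} s * indicator {norm (p - z)..} s \<partial>lborel)"
    by (rule nn_integral_foci) auto
  also have "(\<integral>\<^sup>+ s. indicator {..b - c} s * indicator {norm (p - z)..} s \<partial>lborel)
      = (\<integral>\<^sup>+ s. indicator {norm (p - z)..b - c} s \<partial>lborel)"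
    by (intro nn_integral_cong) (auto split: split_indicator)
  also have "\<dots> = ennreal (b - (c + norm (p - z)))"
    by (cases "norm (p - z) \<le> b - c") (auto simp: algebra_simps ennreal_neg)
  finally show ?thesis .
qed

text \<open>Here \<open>b\<close> is the profile of the unknown coefficient difference, \<open>\<kappa> i\<close> the \<open>i\<close>-th row sum of the
  constant matrix it multiplies, and \<open>r\<close> the difference of the two regular parts. Only the first
  component of the measured data is used.\<close>

locale ellipsoidal_difference =
  fixes T :: real and e :: "real^3" and b :: "real \<Rightarrow> real"
    and r S :: "2 \<Rightarrow> spacetime \<Rightarrow> real" and \<kappa> :: "2 \<Rightarrow> real" and C\<^sub>0 :: real
  assumes T: "1 < T" and e: "norm e = 1" and b: "continuous_on UNIV b"
    and wave: "\<And>i. cone_wave (r i) (S i) (\<lambda>x. \<kappa> i * b (norm x + norm (x - e)))"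
    and S_bound: "\<And>i w. w \<in> cone_set \<Longrightarrow> fst w + norm (snd w - e) \<le> T \<Longrightarrow>
      \<bar>S i w\<bar> \<le> C\<^sub>0 * (\<bar>b (norm (snd w) + norm (snd w - e))\<bar> + (\<Sum>j\<in>UNIV. \<bar>r j w\<bar>))"
    and vanish: "\<And>t. 1 < t \<Longrightarrow> t \<le> T \<Longrightarrow> r 1 (t, e) = 0"
    and \<kappa>: "\<kappa> 1 \<noteq> 0"
begin

definition q :: "real^3 \<Rightarrow> ennreal" where
  "q x = ennreal \<bar>b (norm x + norm (x - e))\<bar>"

definition m :: "spacetime \<Rightarrow> ennreal" where
  "m w = ennreal (\<Sum>j\<in>UNIV. \<bar>indicator cone_set w * r j w\<bar>)"

definition src :: "spacetime \<Rightarrow> ennreal" where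
  "src w = indicator cone_set w * (q (snd w) + m w)"

text \<open>Up to constants, the retarded potential at \<open>z\<close> of the sources, as a measure in time.\<close>

definition \<mu> :: "real^3 \<Rightarrow> real set \<Rightarrow> ennreal" where
  "\<mu> z I = (\<integral>\<^sup>+ x. q x * indicator I (norm x + norm (x - z)) * ennreal (1 / (norm x * norm (x - z))) \<partial>lborel)
    + (\<integral>\<^sup>+ w. src w * indicator I (fst w + norm (snd w - z)) * ennreal (1 / norm (snd w - z)) \<partial>lborel)"

text \<open>One constant serves both components. The sign of \<open>C\<^sub>0\<close> is not
  prescribed, hence the absolute value.\<close>

definition K :: real where
  "K = ((\<Sum>j\<in>UNIV. \<bar>\<kappa> j\<bar>) + \<bar>C\<^sub>0\<bar>) / kernel_const"

lemma K_nonneg: "0 \<le> K"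
  unfolding K_def using kernel_const_pos by (intro divide_nonneg_pos add_nonneg_nonneg sum_nonneg) auto

lemma b_measurable [measurable]: "b \<in> borel_measurable borel"
  using b by (rule borel_measurable_continuous_onI)

lemma q_measurable [measurable]: "q \<in> borel_measurable borel"
  unfolding q_def[abs_def] by measurable

lemma cone_set_measurable [measurable]: "cone_set \<in> sets borel"
  using closed_cone_set by simp

lemma r_continuous: "continuous_on cone_set (r i)"
  using cone_wave.r[OF wave] .

lemma r_measurable [measurable]: "(\<lambda>w. indicator cone_set w * r i w) \<in> borel_measurable borel"
  by (rule borel_measurable_cone_extension[OF r_continuous])

lemma m_measurable [measurable]: "m \<in> borel_measurable borel"
  unfolding m_def[abs_def] by measurable

lemma src_measurable [measurable]: "src \<in> borel_measurable borel"
  unfolding src_def[abs_def] by measurable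

lemma m_zero: "w \<notin> cone_set \<Longrightarrow> m w = 0"
  by (simp add: m_def)

lemma src_eq: "src w = indicator cone_set w * q (snd w) + m w"
  using m_zero[of w] by (cases "w \<in> cone_set") (auto simp: src_def)

text \<open>A source whose signal reaches \<open>z\<close> by time \<open>v\<close> could reach
  \<open>e\<close> by time v + |z - e| \<le> T, by the triangle inequality. It therefore lies in the
  region where \<open>S\<close> is controlled.\<close>

lemma S_term_bound:
  assumes "v \<le> T - norm (z - e)"
  shows "ennreal \<bar>indicator cone_set w * S i w * (indicat_real {u<..<v} (fst w + norm (snd w - z)) / norm (snd w - z))\<bar>
    \<le> ennreal ((\<Sum>j\<in>UNIV. \<bar>\<kappa> j\<bar>) + \<bar>C\<^sub>0\<bar>) * (src w * indicator {u<..v} (fst w + norm (snd w - z)) * ennreal (1 / norm (snd w - z)))"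
proof (cases "fst w + norm (snd w - z) \<in> {u<..<v} \<and> w \<in> cone_set")
  let ?c = "(\<Sum>j\<in>UNIV. \<bar>\<kappa> j\<bar>) + \<bar>C\<^sub>0\<bar>"
  let ?B = "\<lambda>w. indicator cone_set w * S i w * (indicat_real {u<..<v} (fst w + norm (snd w - z)) / norm (snd w - z))"
  have c0: "0 \<le> ?c" by (intro add_nonneg_nonneg sum_nonneg) auto
  have Ci: "\<bar>C\<^sub>0\<bar> \<le> ?c" using sum_nonneg[of UNIV "\<lambda>j. \<bar>\<kappa> j\<bar>"] by simp
  case True
  have "norm (snd w - e) \<le> norm (snd w - z) + norm (z - e)" using norm_triangle_ineq[of "snd w - z" "z - e"] by simp
  then have "fst w + norm (snd w - e) \<le> T" using True assms by auto
  then have "\<bar>S i w\<bar> \<le> C\<^sub>0 * (\<bar>b (norm (snd w) + norm (snd w - e))\<bar> + (\<Sum>j\<in>UNIV. \<bar>r j w\<bar>))"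
    using True S_bound by blast
  also have "\<dots> \<le> ?c * (\<bar>b (norm (snd w) + norm (snd w - e))\<bar> + (\<Sum>j\<in>UNIV. \<bar>r j w\<bar>))"
    using order_trans[OF abs_ge_self Ci] by (intro mult_right_mono add_nonneg_nonneg sum_nonneg) simp_all
  finally have "ennreal \<bar>S i w\<bar> \<le> ennreal (?c * (\<bar>b (norm (snd w) + norm (snd w - e))\<bar> + (\<Sum>j\<in>UNIV. \<bar>r j w\<bar>)))"
    by (rule ennreal_leI)
  also have "\<dots> = ennreal ?c * src w"
    using True c0 by (simp add: src_def q_def m_def ennreal_mult ennreal_plus[symmetric] sum_nonneg del: ennreal_plus)
  finally have "ennreal \<bar>S i w\<bar> * ennreal (1 / norm (snd w - z)) \<le> ennreal ?c * src w * ennreal (1 / norm (snd w - z))"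
    by (rule mult_right_mono) simp
  moreover have "ennreal \<bar>?B w\<bar> = ennreal \<bar>S i w\<bar> * ennreal (1 / norm (snd w - z))"
    using True by (simp add: abs_mult ennreal_mult[symmetric])
  ultimately show ?thesis using True by (simp add: mult.assoc)
qed auto

text \<open>The open interval comes from \<open>weak_interval\<close>. The bound uses half-open
  ones, since adjacent half-open intervals are disjoint and join without gaps, which makes
  \<open>\<mu>\<close> additive along a subdivision.\<close>

lemma interval_bound:
  assumes "v \<le> T - norm (z - e)"
  shows "ennreal \<bar>LINT t|lborel. indicator cone_set (t, z) * r i (t, z) * indicator {u<..<v} t\<bar> \<le> ennreal K * \<mu> z {u<..v}"
proof -
  interpret cone_wave "r i" "S i" "\<lambda>x. \<kappa> i * b (norm x + norm (x - e))" by (rule wave)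
  let ?I = "indicat_real {u<..<v}"
  let ?L = "LINT t|lborel. indicator cone_set (t, z) * r i (t, z) * ?I t"
  let ?A = "\<lambda>x. \<kappa> i * b (norm x + norm (x - e)) * (?I (norm x + norm (x - z)) / norm (x - z)) / (4 * pi * norm x)"
  let ?B = "\<lambda>w. indicator cone_set w * S i w * (?I (fst w + norm (snd w - z)) / norm (snd w - z))"
  let ?c = "(\<Sum>j\<in>UNIV. \<bar>\<kappa> j\<bar>) + \<bar>C\<^sub>0\<bar>"
  have c0: "0 \<le> ?c" by (intro add_nonneg_nonneg sum_nonneg) auto
  have ki: "\<bar>\<kappa> i\<bar> \<le> ?c" using member_le_sum[of i UNIV "\<lambda>j. \<bar>\<kappa> j\<bar>"] by simp
  have A: "ennreal \<bar>?A x\<bar> \<le> ennreal ?c * (q x * indicator {u<..v} (norm x + norm (x - z)) * ennreal (1 / (norm x * norm (x - z))))" for x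
  proof (cases "norm x + norm (x - z) \<in> {u<..<v}")
    case True
    have "\<bar>?A x\<bar> = (\<bar>\<kappa> i\<bar> / (4 * pi)) * (\<bar>b (norm x + norm (x - e))\<bar> * (1 / (norm x * norm (x - z))))"
      using True by (simp add: abs_mult)
    also have "\<dots> \<le> ?c * (\<bar>b (norm x + norm (x - e))\<bar> * (1 / (norm x * norm (x - z))))"
    proof (rule mult_right_mono)
      have "\<bar>\<kappa> i\<bar> / (4 * pi) \<le> \<bar>\<kappa> i\<bar> / 1" using pi_gt3 by (intro divide_left_mono) auto
      then show "\<bar>\<kappa> i\<bar> / (4 * pi) \<le> ?c" using ki by simp
    qed simp
    finally have "ennreal \<bar>?A x\<bar> \<le> ennreal (?c * (\<bar>b (norm x + norm (x - e))\<bar> * (1 / (norm x * norm (x - z)))))"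
      by (rule ennreal_leI)
    also have "\<dots> = ennreal ?c * (q x * ennreal (1 / (norm x * norm (x - z))))"
      unfolding q_def using c0 by (simp only: ennreal_mult abs_ge_zero zero_le_mult_iff norm_ge_zero mult_nonneg_nonneg
          zero_le_divide_1_iff disj_commute simp_thms)
    finally show ?thesis using True by simp
  qed simp
  note B = S_term_bound[OF assms, of _ i u]
  have "kernel_const * \<bar>?L\<bar> = \<bar>(LINT x|lborel. ?A x) + (LINT w|lborel. ?B w)\<bar>"
    unfolding weak_interval[symmetric] using kernel_const_pos by (simp add: abs_mult)
  then have "ennreal (kernel_const * \<bar>?L\<bar>) \<le> ennreal (\<bar>LINT x|lborel. ?A x\<bar> + \<bar>LINT w|lborel. ?B w\<bar>)"
    using abs_triangle_ineq by (intro ennreal_leI) simp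
  also have "\<dots> = ennreal \<bar>LINT x|lborel. ?A x\<bar> + ennreal \<bar>LINT w|lborel. ?B w\<bar>" by simp
  also have "\<dots> \<le> (\<integral>\<^sup>+ x. ennreal \<bar>?A x\<bar> \<partial>lborel) + (\<integral>\<^sup>+ w. ennreal \<bar>?B w\<bar> \<partial>lborel)"
    by (intro add_mono ennreal_abs_integral_le)
  also have "\<dots> \<le> (\<integral>\<^sup>+ x. ennreal ?c * (q x * indicator {u<..v} (norm x + norm (x - z)) * ennreal (1 / (norm x * norm (x - z)))) \<partial>lborel)
      + (\<integral>\<^sup>+ w. ennreal ?c * (src w * indicator {u<..v} (fst w + norm (snd w - z)) * ennreal (1 / norm (snd w - z))) \<partial>lborel)"
    by (intro add_mono nn_integral_mono A B)
  also have "\<dots> = ennreal ?c * \<mu> z {u<..v}"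
    unfolding \<mu>_def distrib_left by (subst (1 2) nn_integral_cmult) auto
  finally have "ennreal (1 / kernel_const) * ennreal (kernel_const * \<bar>?L\<bar>) \<le> ennreal (1 / kernel_const) * (ennreal ?c * \<mu> z {u<..v})"
    by (rule mult_left_mono) simp
  moreover have "ennreal (1 / kernel_const) * ennreal (kernel_const * \<bar>?L\<bar>) = ennreal \<bar>?L\<bar>"
    using kernel_const_pos by (simp add: ennreal_mult[symmetric])
  moreover have "ennreal (1 / kernel_const) * ennreal ?c = ennreal K"
  proof -
    have "ennreal (1 / kernel_const) * ennreal ?c = ennreal (1 / kernel_const * ?c)"
      using kernel_const_pos c0 by (intro ennreal_mult[symmetric]) auto
    then show ?thesis by (simp add: K_def)
  qed
  ultimately show ?thesis by (simp add: mult.assoc[symmetric])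
qed

lemma \<mu>_add:
  assumes [measurable]: "A \<in> sets borel" "B \<in> sets borel" and d: "A \<inter> B = {}"
  shows "\<mu> z A + \<mu> z B = \<mu> z (A \<union> B)"
proof -
  have ind: "indicator (A \<union> B) s = (indicator A s + indicator B s :: ennreal)" for s
    using d by (auto split: split_indicator)
  have 1: "(\<integral>\<^sup>+ x. q x * indicator (A \<union> B) (norm x + norm (x - z)) * ennreal (1 / (norm x * norm (x - z))) \<partial>lborel)
    = (\<integral>\<^sup>+ x. q x * indicator A (norm x + norm (x - z)) * ennreal (1 / (norm x * norm (x - z))) \<partial>lborel)
    + (\<integral>\<^sup>+ x. q x * indicator B (norm x + norm (x - z)) * ennreal (1 / (norm x * norm (x - z))) \<partial>lborel)"
    unfolding ind distrib_left distrib_right by (rule nn_integral_add) auto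
  have 2: "(\<integral>\<^sup>+ w. src w * indicator (A \<union> B) (fst w + norm (snd w - z)) * ennreal (1 / norm (snd w - z)) \<partial>lborel)
    = (\<integral>\<^sup>+ w. src w * indicator A (fst w + norm (snd w - z)) * ennreal (1 / norm (snd w - z)) \<partial>lborel)
    + (\<integral>\<^sup>+ w. src w * indicator B (fst w + norm (snd w - z)) * ennreal (1 / norm (snd w - z)) \<partial>lborel)"
    unfolding ind distrib_left distrib_right by (rule nn_integral_add) auto
  show ?thesis unfolding \<mu>_def 1 2 by (simp add: ac_simps)
qed

lemma \<mu>_mono: "A \<subseteq> B \<Longrightarrow> \<mu> z A \<le> \<mu> z B"
  unfolding \<mu>_def by (intro add_mono nn_integral_mono mult_mono) (auto split: split_indicator)

text \<open>Every subinterval gives a bound on a signed integral by the additive quantity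
  \<open>\<mu>\<close>; subdivision upgrades this to absolute values. The factor 2 counts the
  components.\<close>

lemma m_bound:
  assumes v: "v \<le> T - norm (z - e)"
  shows "(\<integral>\<^sup>+ t. m (t, z) * indicator {u<..v} t \<partial>lborel) \<le> ennreal (2 * K) * \<mu> z {u<..v}"
proof (cases "norm z \<le> v \<and> u \<le> v")
  case False
  then have "m (t, z) * indicator {u<..v} t = 0" for t
    by (auto simp: m_def cone_set_def split: split_indicator)
  then have "(\<integral>\<^sup>+ t. m (t, z) * indicator {u<..v} t \<partial>lborel) = (\<integral>\<^sup>+ t. 0 \<partial>(lborel :: real measure))"
    by (simp only:)
  then show ?thesis by simp
next
  case True
  \<comment> \<open>Before time \<open>norm z\<close> the point is outside the cone and
    \<open>m\<close> vanishes; from \<open>a\<close> on, the extension of \<open>r\<close> by zero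
    is continuous.\<close>
  define a where "a = max u (norm z)"
  have a: "a \<le> v" "norm z \<le> a" "u \<le> a" using True by (auto simp: a_def)
  have one: "(\<integral>\<^sup>+ t. ennreal \<bar>indicator cone_set (t, z) * r i (t, z)\<bar> * indicator {a..v} t \<partial>lborel) \<le> ennreal K * \<mu> z {u<..v}" for i
  proof -
    have "continuous_on {a..v} (\<lambda>t. r i (t, z))"
      using a by (intro continuous_on_compose2[OF r_continuous] continuous_intros) (auto simp: cone_set_def)
    then have c: "continuous_on {a..v} (\<lambda>t. indicator cone_set (t, z) * r i (t, z))"
      by (rule continuous_on_eq) (use a in \<open>auto simp: cone_set_def\<close>)
    have "(\<integral>\<^sup>+ t. ennreal \<bar>indicator cone_set (t, z) * r i (t, z)\<bar> * indicator {a..v} t \<partial>lborel) \<le> ennreal K * \<mu> z {a<..v}"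
    proof (rule nn_integral_abs_le_of_subintervals[OF c a(1)])
      fix u' v' w' assume *: "a \<le> u'" "u' \<le> v'" "v' \<le> w'" "w' \<le> v"
      have "\<mu> z {u'<..v'} + \<mu> z {v'<..w'} = \<mu> z ({u'<..v'} \<union> {v'<..w'})" by (rule \<mu>_add) auto
      also have "{u'<..v'} \<union> {v'<..w'} = {u'<..w'}" using * by auto
      finally show "ennreal K * \<mu> z {u'<..v'} + ennreal K * \<mu> z {v'<..w'} \<le> ennreal K * \<mu> z {u'<..w'}"
        by (simp add: distrib_left[symmetric])
    next
      fix u' v' assume "a \<le> u'" "u' \<le> v'" "v' \<le> v"
      then show "ennreal \<bar>LINT t|lborel. indicator cone_set (t, z) * r i (t, z) * indicator {u'<..<v'} t\<bar> \<le> ennreal K * \<mu> z {u'<..v'}"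
        using v by (intro interval_bound) auto
    qed
    also have "\<dots> \<le> ennreal K * \<mu> z {u<..v}" using a by (intro mult_left_mono \<mu>_mono) auto
    finally show ?thesis .
  qed
  have [measurable]: "(\<lambda>t :: real. (t, z)) \<in> borel_measurable borel"
    by (intro borel_measurable_continuous_onI continuous_intros)
  have [measurable]: "(\<lambda>t. indicator cone_set (t, z) * r i (t, z)) \<in> borel_measurable borel" for i
    using measurable_compose[of "\<lambda>t. (t, z)" borel borel "\<lambda>w. indicator cone_set w * r i w"] by simp
  have "(\<integral>\<^sup>+ t. m (t, z) * indicator {u<..v} t \<partial>lborel)
    \<le> (\<integral>\<^sup>+ t. (\<Sum>i\<in>UNIV. ennreal \<bar>indicator cone_set (t, z) * r i (t, z)\<bar> * indicator {a..v} t) \<partial>lborel)"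
  proof (intro nn_integral_mono)
    fix t
    show "m (t, z) * indicator {u<..v} t \<le> (\<Sum>i\<in>UNIV. ennreal \<bar>indicator cone_set (t, z) * r i (t, z)\<bar> * indicator {a..v} t)"
    proof (cases "t \<in> {u<..v} \<and> norm z \<le> t")
      case True
      then have "t \<in> {a..v}" by (auto simp: a_def)
      then show ?thesis using True by (simp add: m_def sum_ennreal)
    next
      case False
      then have "m (t, z) * indicator {u<..v} t = 0" by (auto simp: m_def cone_set_def split: split_indicator)
      then show ?thesis by (simp only: zero_le)
    qed
  qed
  also have "\<dots> = (\<Sum>i\<in>UNIV. \<integral>\<^sup>+ t. ennreal \<bar>indicator cone_set (t, z) * r i (t, z)\<bar> * indicator {a..v} t \<partial>lborel)"
    by (rule nn_integral_sum) auto
  also have "\<dots> \<le> (\<Sum>i\<in>(UNIV :: 2 set). ennreal K * \<mu> z {u<..v})" by (intro sum_mono one)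
  also have "\<dots> = ennreal (2 * K) * \<mu> z {u<..v}"
    using K_nonneg by (simp add: ennreal_mult mult.assoc)
  finally show ?thesis .
qed

end

section \<open>\<open>L^1\<close> quantities on the region that can influence
  \<open>e\<close>\<close>

context ellipsoidal_difference
begin

definition \<beta> :: "real \<Rightarrow> ennreal" where
  "\<beta> \<tau> = (\<integral>\<^sup>+ s. ennreal \<bar>b s\<bar> * indicator {1..\<tau>} s \<partial>lborel)"

text \<open>An \<open>L^1\<close> norm of \<open>r\<close>, not a quadratic energy, over the part of
  the cone whose signals reach \<open>e\<close> by time \<open>\<tau>\<close>.\<close>

definition energy :: "real \<Rightarrow> ennreal" where
  "energy \<tau> = (\<integral>\<^sup>+ w. m w * indicator {..\<tau>} (fst w + norm (snd w - e)) \<partial>lborel)"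

lemma cone_setD: "w \<in> cone_set \<Longrightarrow> norm (snd w) \<le> fst w \<and> 0 \<le> fst w"
  by (cases w) (auto simp: cone_set_def intro: order_trans[OF norm_ge_zero])

text \<open>Since \<open>q\<close> depends only on the sum of the distances to \<open>0\<close> and
  \<open>e\<close>, a weight dominated by the weight with these foci reduces the integral to the
  one-dimensional \<open>\<beta>\<close>.\<close>

lemma q_weight:
  assumes [measurable]: "h \<in> borel_measurable borel" and c: "0 \<le> c"
    and h: "\<And>x. x \<noteq> 0 \<Longrightarrow> x \<noteq> e \<Longrightarrow> norm x + norm (x - e) \<le> \<tau> \<Longrightarrow> h x \<le> ennreal (c / (norm x * norm (x - e)))"
  shows "(\<integral>\<^sup>+ x. q x * indicator {..\<tau>} (norm x + norm (x - e)) * h x \<partial>lborel) \<le> ennreal (2 * pi * c) * \<beta> \<tau>"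
proof -
  have "(\<integral>\<^sup>+ x. q x * indicator {..\<tau>} (norm x + norm (x - e)) * h x \<partial>lborel)
    \<le> (\<integral>\<^sup>+ x. ennreal c * ((ennreal \<bar>b (norm (x - 0) + norm (x - e))\<bar> * indicator {..\<tau>} (norm (x - 0) + norm (x - e)))
        * ennreal (1 / (norm (x - 0) * norm (x - e)))) \<partial>lborel)"
  proof (rule nn_integral_mono_AE)
    have "AE x :: real^3 in lborel. x \<noteq> 0" "AE x in lborel. x \<noteq> e" by (rule AE_lborel_singleton)+
    then show "AE x in lborel. q x * indicator {..\<tau>} (norm x + norm (x - e)) * h x
      \<le> ennreal c * ((ennreal \<bar>b (norm (x - 0) + norm (x - e))\<bar> * indicator {..\<tau>} (norm (x - 0) + norm (x - e)))
        * ennreal (1 / (norm (x - 0) * norm (x - e))))"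
    proof eventually_elim
      case (elim x)
      show ?case
      proof (cases "norm x + norm (x - e) \<le> \<tau>")
        case True
        have "q x * h x \<le> q x * ennreal (c * (1 / (norm x * norm (x - e))))"
          using h[OF elim True] by (intro mult_left_mono) auto
        also have "\<dots> = ennreal c * (q x * ennreal (1 / (norm x * norm (x - e))))"
          using c by (subst ennreal_mult) (auto simp: ac_simps)
        finally show ?thesis using True by (simp add: q_def)
      qed simp
    qed
  qed
  also have "\<dots> = ennreal c * (ennreal (2 * pi) * (\<integral>\<^sup>+ s. ennreal \<bar>b s\<bar> * indicator {..\<tau>} s * indicator {norm (0 - e)..} s \<partial>lborel))"
    by (subst nn_integral_cmult, simp, subst nn_integral_foci) auto
  also have "(\<integral>\<^sup>+ s. ennreal \<bar>b s\<bar> * indicator {..\<tau>} s * indicator {norm (0 - e)..} s \<partial>lborel) = \<beta> \<tau>"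
    unfolding \<beta>_def using e by (intro nn_integral_cong) (auto split: split_indicator)
  also have "ennreal c * (ennreal (2 * pi) * \<beta> \<tau>) = ennreal (2 * pi * c) * \<beta> \<tau>"
    using c by (simp add: ennreal_mult mult_ac)
  finally show ?thesis .
qed

text \<open>Both focal distances are at most \<open>T\<close> on the region, so each missing factor
  of the two-focus weight costs one factor \<open>T\<close>.\<close>

lemma q_near:
  assumes "\<tau> \<le> T"
  shows "(\<integral>\<^sup>+ x. q x * indicator {..\<tau>} (norm x + norm (x - e)) * ennreal (1 / norm x) \<partial>lborel) \<le> ennreal (2 * pi * T) * \<beta> \<tau>"
    and "(\<integral>\<^sup>+ x. q x * indicator {..\<tau>} (norm x + norm (x - e)) * ennreal (1 / norm (x - e)) \<partial>lborel) \<le> ennreal (2 * pi * T) * \<beta> \<tau>"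
    and "(\<integral>\<^sup>+ x. q x * indicator {..\<tau>} (norm x + norm (x - e)) * 1 \<partial>lborel) \<le> ennreal (2 * pi * (T * T)) * \<beta> \<tau>"
proof -
  have le: "norm x \<le> T" "norm (x - e) \<le> T" if "norm x + norm (x - e) \<le> \<tau>" for x
    using that assms norm_ge_zero[of x] norm_ge_zero[of "x - e"] by linarith+
  show "(\<integral>\<^sup>+ x. q x * indicator {..\<tau>} (norm x + norm (x - e)) * ennreal (1 / norm x) \<partial>lborel) \<le> ennreal (2 * pi * T) * \<beta> \<tau>"
    using T le by (intro q_weight ennreal_leI) (auto simp: divide_simps)
  show "(\<integral>\<^sup>+ x. q x * indicator {..\<tau>} (norm x + norm (x - e)) * ennreal (1 / norm (x - e)) \<partial>lborel) \<le> ennreal (2 * pi * T) * \<beta> \<tau>"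
    using T le by (intro q_weight ennreal_leI) (auto simp: divide_simps)
  show "(\<integral>\<^sup>+ x. q x * indicator {..\<tau>} (norm x + norm (x - e)) * 1 \<partial>lborel) \<le> ennreal (2 * pi * (T * T)) * \<beta> \<tau>"
  proof (rule q_weight)
    fix x assume x: "x \<noteq> 0" "x \<noteq> e" "norm x + norm (x - e) \<le> \<tau>"
    have "norm x * norm (x - e) \<le> T * T" using le[OF x(3)] T by (intro mult_mono) auto
    then have "1 \<le> T * T / (norm x * norm (x - e))" using x by (simp add: divide_simps)
    then show "1 \<le> ennreal (T * T / (norm x * norm (x - e)))" by simp
  qed (use T in auto)
qed

lemma q_cone_time:
  assumes "\<tau> \<le> T"
  shows "(\<integral>\<^sup>+ t. indicator cone_set (t, x) * indicator {..\<tau>} (t + norm (x - e)) \<partial>lborel)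
    \<le> ennreal T * indicator {..\<tau>} (norm x + norm (x - e))"
proof -
  have "(\<integral>\<^sup>+ t. indicator cone_set (t, x) * indicator {..\<tau>} (t + norm (x - e)) \<partial>lborel)
      = (\<integral>\<^sup>+ t. indicator {norm x..\<tau> - norm (x - e)} t \<partial>lborel)"
    by (intro nn_integral_cong) (auto simp: cone_set_def split: split_indicator)
  also have "\<dots> = emeasure lborel {norm x..\<tau> - norm (x - e)}" by simp
  also have "\<dots> \<le> ennreal T * indicator {..\<tau>} (norm x + norm (x - e))"
  proof (cases "norm x + norm (x - e) \<le> \<tau>")
    case True
    have "\<tau> - norm (x - e) - norm x \<le> T" using assms norm_ge_zero[of x] norm_ge_zero[of "x - e"] by linarith
    then show ?thesis using True by (simp add: ennreal_leI)
  qed simp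
  finally show ?thesis .
qed

lemma q_cone:
  assumes "\<tau> \<le> T"
  shows "(\<integral>\<^sup>+ w. indicator cone_set w * q (snd w) * indicator {..\<tau>} (fst w + norm (snd w - e)) \<partial>lborel)
    \<le> ennreal T * (ennreal (2 * pi * (T * T)) * \<beta> \<tau>)"
proof -
  have "(\<integral>\<^sup>+ w. indicator cone_set w * q (snd w) * indicator {..\<tau>} (fst w + norm (snd w - e)) \<partial>lborel)
    = (\<integral>\<^sup>+ x. \<integral>\<^sup>+ t. indicator cone_set (t, x) * q x * indicator {..\<tau>} (t + norm (x - e)) \<partial>lborel \<partial>lborel)"
    by (subst nn_integral_lborel_Pair(2)) auto
  also have "\<dots> = (\<integral>\<^sup>+ x. q x * (\<integral>\<^sup>+ t. indicator cone_set (t, x) * indicator {..\<tau>} (t + norm (x - e)) \<partial>lborel) \<partial>lborel)"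
  proof (intro nn_integral_cong)
    fix x :: "real^3"
    have [measurable]: "(\<lambda>t :: real. (t, x)) \<in> borel_measurable borel"
      by (intro borel_measurable_continuous_onI continuous_intros)
    show "(\<integral>\<^sup>+ t. indicator cone_set (t, x) * q x * indicator {..\<tau>} (t + norm (x - e)) \<partial>lborel)
      = q x * (\<integral>\<^sup>+ t. indicator cone_set (t, x) * indicator {..\<tau>} (t + norm (x - e)) \<partial>lborel)"
      by (subst nn_integral_cmult[symmetric]) (auto simp: ac_simps)
  qed
  also have "\<dots> \<le> (\<integral>\<^sup>+ x. q x * (ennreal T * indicator {..\<tau>} (norm x + norm (x - e))) \<partial>lborel)"
    by (intro nn_integral_mono mult_left_mono q_cone_time assms) auto
  also have "\<dots> = ennreal T * (\<integral>\<^sup>+ x. q x * indicator {..\<tau>} (norm x + norm (x - e)) * 1 \<partial>lborel)"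
    by (subst nn_integral_cmult[symmetric]) (auto simp: ac_simps)
  also have "\<dots> \<le> ennreal T * (ennreal (2 * pi * (T * T)) * \<beta> \<tau>)"
    by (intro mult_left_mono q_near assms) auto
  finally show ?thesis .
qed

text \<open>For fixed \<open>x\<close> the times in question fill a window of length at most
  \<open>v - u\<close>. What remains is a spatial integral with one focal factor missing.\<close>

lemma q_cone_interval:
  assumes "v \<le> T" "u \<le> v"
  shows "(\<integral>\<^sup>+ w. indicator cone_set w * q (snd w) * indicator {u<..v} (fst w + norm (snd w - e)) * ennreal (1 / norm (snd w - e)) \<partial>lborel)
    \<le> ennreal (v - u) * (ennreal (2 * pi * T) * \<beta> v)"
proof -
  have time: "(\<integral>\<^sup>+ t. indicator cone_set (t, x) * indicator {u<..v} (t + norm (x - e)) \<partial>lborel)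
      \<le> ennreal (v - u) * indicator {..v} (norm x + norm (x - e))" for x
  proof -
    have "(\<integral>\<^sup>+ t. indicator cone_set (t, x) * indicator {u<..v} (t + norm (x - e)) \<partial>lborel)
      \<le> (\<integral>\<^sup>+ t. indicator {..v} (norm x + norm (x - e)) * indicator {u - norm (x - e)<..v - norm (x - e)} t \<partial>lborel)"
      by (intro nn_integral_mono) (auto simp: cone_set_def split: split_indicator)
    also have "\<dots> = indicator {..v} (norm x + norm (x - e)) * emeasure lborel {u - norm (x - e)<..v - norm (x - e)}"
      by (rule nn_integral_cmult_indicator) auto
    finally show ?thesis using assms(2) by (simp add: mult.commute)
  qed
  have "(\<integral>\<^sup>+ w. indicator cone_set w * q (snd w) * indicator {u<..v} (fst w + norm (snd w - e)) * ennreal (1 / norm (snd w - e)) \<partial>lborel)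
    = (\<integral>\<^sup>+ x. \<integral>\<^sup>+ t. indicator cone_set (t, x) * q x * indicator {u<..v} (t + norm (x - e)) * ennreal (1 / norm (x - e)) \<partial>lborel \<partial>lborel)"
    by (subst nn_integral_lborel_Pair(2)) auto
  also have "\<dots> = (\<integral>\<^sup>+ x. (q x * ennreal (1 / norm (x - e))) * (\<integral>\<^sup>+ t. indicator cone_set (t, x) * indicator {u<..v} (t + norm (x - e)) \<partial>lborel) \<partial>lborel)"
  proof (intro nn_integral_cong)
    fix x :: "real^3"
    have [measurable]: "(\<lambda>t :: real. (t, x)) \<in> borel_measurable borel"
      by (intro borel_measurable_continuous_onI continuous_intros)
    show "(\<integral>\<^sup>+ t. indicator cone_set (t, x) * q x * indicator {u<..v} (t + norm (x - e)) * ennreal (1 / norm (x - e)) \<partial>lborel)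
      = (q x * ennreal (1 / norm (x - e))) * (\<integral>\<^sup>+ t. indicator cone_set (t, x) * indicator {u<..v} (t + norm (x - e)) \<partial>lborel)"
      by (subst nn_integral_cmult[symmetric]) (auto simp: ac_simps)
  qed
  also have "\<dots> \<le> (\<integral>\<^sup>+ x. (q x * ennreal (1 / norm (x - e))) * (ennreal (v - u) * indicator {..v} (norm x + norm (x - e))) \<partial>lborel)"
    by (intro nn_integral_mono mult_left_mono time) auto
  also have "\<dots> = ennreal (v - u) * (\<integral>\<^sup>+ x. q x * indicator {..v} (norm x + norm (x - e)) * ennreal (1 / norm (x - e)) \<partial>lborel)"
    by (subst nn_integral_cmult[symmetric]) (auto simp: ac_simps)
  also have "\<dots> \<le> ennreal (v - u) * (ennreal (2 * pi * T) * \<beta> v)"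
    by (intro mult_left_mono q_near assms) auto
  finally show ?thesis .
qed

lemma energy_measurable [measurable]: "energy \<in> borel_measurable borel"
proof -
  \<comment> \<open>Writing the moving half-line as a relation between two reals gives joint
    measurability in \<open>w\<close> and \<open>\<tau>\<close>.\<close>
  have "energy \<tau> = (\<integral>\<^sup>+ w. m w * indicator {p. fst p \<le> snd p} (fst w + norm (snd w - e), \<tau>) \<partial>lborel)" for \<tau>
    unfolding energy_def by (intro nn_integral_cong) (auto split: split_indicator)
  then show ?thesis by (simp add: energy_def[abs_def])
qed

text \<open>Continuity of \<open>r\<close> on a compact piece of the cone gives the a priori bound
  without which Gronwall's argument could not subtract.\<close>

lemma energy_finite: "\<tau> \<le> T \<Longrightarrow> energy \<tau> \<le> energy T" "energy T < \<infinity>"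
proof -
  show "energy \<tau> \<le> energy T" if "\<tau> \<le> T"
    unfolding energy_def using that by (intro nn_integral_mono mult_left_mono) (auto split: split_indicator)
  have "\<exists>M. \<forall>w. fst w \<le> T \<longrightarrow> \<bar>indicator cone_set w * r i w\<bar> \<le> M" for i
    using cone_extension_bounded[OF r_continuous, of T i] by metis
  then obtain M where M: "\<And>i w. fst w \<le> T \<Longrightarrow> \<bar>indicator cone_set w * r i w\<bar> \<le> M i" by metis
  have "energy T \<le> (\<integral>\<^sup>+ w. ennreal (\<Sum>i\<in>UNIV. M i) * indicator (cone_set \<inter> {w. fst w \<le> T}) w \<partial>lborel)"
    unfolding energy_def
  proof (intro nn_integral_mono)
    fix w
    show "m w * indicator {..T} (fst w + norm (snd w - e)) \<le> ennreal (\<Sum>i\<in>UNIV. M i) * indicator (cone_set \<inter> {w. fst w \<le> T}) w"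
    proof (cases "w \<in> cone_set \<and> fst w + norm (snd w - e) \<le> T")
      case True
      then have t: "fst w \<le> T" using norm_ge_zero[of "snd w - e"] by linarith
      have "m w \<le> ennreal (\<Sum>i\<in>UNIV. M i)" unfolding m_def by (intro ennreal_leI sum_mono M t)
      then show ?thesis using True t by simp
    qed (use m_zero[of w] in auto)
  qed
  also have "\<dots> = ennreal (\<Sum>i\<in>UNIV. M i) * emeasure lborel (cone_set \<inter> {w. fst w \<le> T})"
    by (rule nn_integral_cmult_indicator) (use compact_imp_closed[OF compact_cone_slab] in simp)
  also have "\<dots> < \<infinity>"
    using emeasure_compact_finite[OF compact_cone_slab] by (simp add: ennreal_mult_less_top)
  finally show "energy T < \<infinity>" .
qed

text \<open>Inserting the missing factor |z - e| \<le> T produces the weight with foci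
  \<open>x\<close> and \<open>e\<close>. The result is proportional to the slack left at
  \<open>\<tau>\<close> by a signal going straight from \<open>x\<close> to
  \<open>e\<close>.\<close>

lemma inner_sublevel:
  fixes x :: "real^3"
  assumes "\<tau> \<le> T" "0 \<le> c"
  shows "(\<integral>\<^sup>+ z. indicator {..\<tau>} (c + norm (z - x) + norm (z - e)) * ennreal (1 / norm (z - x)) \<partial>lborel)
    \<le> ennreal (T * (2 * pi)) * ennreal (\<tau> - (c + norm (x - e)))"
proof -
  have "(\<integral>\<^sup>+ z. indicator {..\<tau>} (c + norm (z - x) + norm (z - e)) * ennreal (1 / norm (z - x)) \<partial>lborel)
    \<le> (\<integral>\<^sup>+ z. ennreal T * (indicator {..\<tau>} (c + norm (z - x) + norm (z - e)) * ennreal (1 / (norm (z - x) * norm (z - e)))) \<partial>lborel)"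
  proof (rule nn_integral_mono_AE)
    have "AE z in lborel. z \<noteq> e" by (rule AE_lborel_singleton)
    then show "AE z in lborel. indicator {..\<tau>} (c + norm (z - x) + norm (z - e)) * ennreal (1 / norm (z - x))
      \<le> ennreal T * (indicator {..\<tau>} (c + norm (z - x) + norm (z - e)) * ennreal (1 / (norm (z - x) * norm (z - e))))"
    proof eventually_elim
      case (elim z)
      show ?case
      proof (cases "c + norm (z - x) + norm (z - e) \<le> \<tau>")
        case True
        then have le: "norm (z - e) \<le> T" using assms norm_ge_zero[of "z - x"] by linarith
        have "1 / norm (z - x) = norm (z - e) * (1 / (norm (z - x) * norm (z - e)))" using elim by simp
        also have "\<dots> \<le> T * (1 / (norm (z - x) * norm (z - e)))" by (intro mult_right_mono le) simp
        finally have "ennreal (1 / norm (z - x)) \<le> ennreal (T * (1 / (norm (z - x) * norm (z - e))))" by (rule ennreal_leI)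
        also have "\<dots> = ennreal T * ennreal (1 / (norm (z - x) * norm (z - e)))"
          using T by (intro ennreal_mult) auto
        finally show ?thesis using True by simp
      qed simp
    qed
  qed
  also have "\<dots> = ennreal T * (ennreal (2 * pi) * ennreal (\<tau> - (c + norm (x - e))))"
    by (subst nn_integral_cmult, simp, subst nn_integral_foci_sublevel) simp
  also have "\<dots> = ennreal (T * (2 * pi)) * ennreal (\<tau> - (c + norm (x - e)))"
    using T by (simp add: ennreal_mult mult.assoc)
  finally show ?thesis .
qed

text \<open>The slack, cut off at 0 by \<open>ennreal\<close>, is the integral over \<sigma> in
  [0, \<tau>] of the indicator of arrival by \<sigma>. Exchanging the integrals turns the moment of
  \<open>m\<close> into the time integral of \<open>energy\<close>, as Gronwall's lemma
  requires.\<close>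

lemma src_moment:
  assumes "\<tau> \<le> T"
  shows "(\<integral>\<^sup>+ w. src w * ennreal (\<tau> - (fst w + norm (snd w - e))) \<partial>lborel)
    \<le> ennreal T * (ennreal T * (ennreal (2 * pi * (T * T)) * \<beta> \<tau>)) + (\<integral>\<^sup>+ \<sigma>. energy \<sigma> * indicator {0..\<tau>} \<sigma> \<partial>lborel)"
proof -
  let ?u = "\<lambda>w :: spacetime. fst w + norm (snd w - e)"
  have "(\<integral>\<^sup>+ w. src w * ennreal (\<tau> - ?u w) \<partial>lborel)
     = (\<integral>\<^sup>+ w. indicator cone_set w * q (snd w) * ennreal (\<tau> - ?u w) + m w * ennreal (\<tau> - ?u w) \<partial>lborel)"
    by (intro nn_integral_cong) (simp add: src_eq distrib_right)
  also have "\<dots> = (\<integral>\<^sup>+ w. indicator cone_set w * q (snd w) * ennreal (\<tau> - ?u w) \<partial>lborel) + (\<integral>\<^sup>+ w. m w * ennreal (\<tau> - ?u w) \<partial>lborel)"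
    by (rule nn_integral_add) auto
  also have "(\<integral>\<^sup>+ w. indicator cone_set w * q (snd w) * ennreal (\<tau> - ?u w) \<partial>lborel)
     \<le> (\<integral>\<^sup>+ w. ennreal T * (indicator cone_set w * q (snd w) * indicator {..\<tau>} (?u w)) \<partial>lborel)"
  proof (intro nn_integral_mono)
    fix w
    show "indicator cone_set w * q (snd w) * ennreal (\<tau> - ?u w) \<le> ennreal T * (indicator cone_set w * q (snd w) * indicator {..\<tau>} (?u w))"
    proof (cases "w \<in> cone_set \<and> ?u w \<le> \<tau>")
      case True
      then have "\<tau> - ?u w \<le> T" using cone_setD[of w] assms norm_ge_zero[of "snd w - e"] by linarith
      then have "q (snd w) * ennreal (\<tau> - ?u w) \<le> q (snd w) * ennreal T" by (intro mult_left_mono ennreal_leI) auto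
      then show ?thesis using True by (simp add: mult.commute)
    qed (auto simp: ennreal_neg)
  qed
  also have "\<dots> = ennreal T * (\<integral>\<^sup>+ w. indicator cone_set w * q (snd w) * indicator {..\<tau>} (?u w) \<partial>lborel)"
    by (rule nn_integral_cmult) auto
  also have "\<dots> \<le> ennreal T * (ennreal T * (ennreal (2 * pi * (T * T)) * \<beta> \<tau>))"
    by (intro mult_left_mono q_cone assms) auto
  also have "(\<integral>\<^sup>+ w. m w * ennreal (\<tau> - ?u w) \<partial>lborel) = (\<integral>\<^sup>+ w. \<integral>\<^sup>+ \<sigma>. m w * indicator {..\<sigma>} (?u w) * indicator {0..\<tau>} \<sigma> \<partial>lborel \<partial>lborel)"
  proof (intro nn_integral_cong)
    fix w
    show "m w * ennreal (\<tau> - ?u w) = (\<integral>\<^sup>+ \<sigma>. m w * indicator {..\<sigma>} (?u w) * indicator {0..\<tau>} \<sigma> \<partial>lborel)"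
    proof (cases "w \<in> cone_set")
      case True
      then have u0: "0 \<le> ?u w" using cone_setD[of w] by simp
      have "(\<integral>\<^sup>+ \<sigma>. m w * indicator {..\<sigma>} (?u w) * indicator {0..\<tau>} \<sigma> \<partial>lborel) = (\<integral>\<^sup>+ \<sigma>. m w * indicator {?u w..\<tau>} \<sigma> \<partial>lborel)"
        using u0 by (intro nn_integral_cong) (auto split: split_indicator)
      also have "\<dots> = m w * emeasure lborel {?u w..\<tau>}" by (rule nn_integral_cmult_indicator) auto
      also have "emeasure lborel {?u w..\<tau>} = ennreal (\<tau> - ?u w)"
        by (cases "?u w \<le> \<tau>") (auto simp: ennreal_neg)
      finally show ?thesis by simp
    qed (simp add: m_zero)
  qed
  also have "\<dots> = (\<integral>\<^sup>+ \<sigma>. \<integral>\<^sup>+ w. m w * indicator {..\<sigma>} (?u w) * indicator {0..\<tau>} \<sigma> \<partial>lborel \<partial>lborel)"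
  proof (rule tonelli_lborel)
    have "(\<lambda>(w, \<sigma>). m w * indicator {..\<sigma>} (?u w) * indicator {0..\<tau>} \<sigma>)
       = (\<lambda>(w, \<sigma>). m w * indicator {p. fst p \<le> snd p} (?u w, \<sigma>) * indicator {0..\<tau>} \<sigma>)"
      by (auto split: split_indicator)
    also have "\<dots> \<in> borel_measurable (lborel \<Otimes>\<^sub>M lborel)" by measurable
    finally show "(\<lambda>(w, \<sigma>). m w * indicator {..\<sigma>} (?u w) * indicator {0..\<tau>} \<sigma>) \<in> borel_measurable (lborel \<Otimes>\<^sub>M lborel)" .
  qed
  also have "\<dots> = (\<integral>\<^sup>+ \<sigma>. energy \<sigma> * indicator {0..\<tau>} \<sigma> \<partial>lborel)"
    unfolding energy_def by (intro nn_integral_cong nn_integral_multc) auto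
  finally show ?thesis by (simp add: add_right_mono)
qed

end

lemma ennreal_scale_scale: "0 \<le> c \<Longrightarrow> 0 \<le> d \<Longrightarrow> ennreal c * (ennreal d * x) = ennreal (c * d) * x"
  by (simp add: ennreal_mult mult.assoc)

lemma ennreal_scale_add: "0 \<le> c \<Longrightarrow> 0 \<le> d \<Longrightarrow> ennreal c * x + ennreal d * x = ennreal (c + d) * x"
  by (simp add: distrib_right)

lemma ennreal_scale_combine:
  assumes "0 \<le> k" "0 \<le> c" "0 \<le> d" "0 \<le> l"
  shows "ennreal k * ((ennreal c * x + ennreal d * x) + ennreal l * y) = ennreal (k * (c + d)) * x + ennreal (k * l) * y"
  using assms by (simp only: ennreal_scale_add distrib_left ennreal_scale_scale add_nonneg_nonneg)

section \<open>The potential bound integrated over all observation points\<close>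

context ellipsoidal_difference
begin

text \<open>Distances are now measured from \<open>z\<close>, because the next integrations run over
  \<open>z\<close> with the source point as a focus.\<close>

lemma \<mu>_le:
  assumes "A \<in> sets borel"
  shows "\<mu> z A \<le> (\<integral>\<^sup>+ x. q x * ennreal (1 / norm x) * (indicator A (norm x + norm (z - x)) * ennreal (1 / norm (z - x))) \<partial>lborel)
    + (\<integral>\<^sup>+ w. src w * (indicator A (fst w + norm (z - snd w)) * ennreal (1 / norm (z - snd w))) \<partial>lborel)"
proof -
  have "ennreal (1 / (norm x * norm (x - z))) = ennreal (1 / norm x) * ennreal (1 / norm (x - z))" for x
    by (simp add: ennreal_mult[symmetric])
  then show ?thesis
    unfolding \<mu>_def by (simp add: norm_minus_commute[of z] mult_ac)
qed

text \<open>The observation point \<open>z\<close> is integrated out first, with foci at the source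
  point and \<open>e\<close>, which leaves the slack as weight. For the cone source the slack is at
  most \<open>T\<close>; for the volume source it is treated by \<open>src_moment\<close>. The
  constant \<open>a1\<close> collects the resulting factors.\<close>

lemma energy_inequality:
  assumes "\<tau> \<le> T"
  defines "a1 \<equiv> 2 * K * (T * (2 * pi) * (T * (2 * pi * T)) + T * (2 * pi) * (T * (T * (2 * pi * (T * T)))))"
  shows "energy \<tau> \<le> ennreal a1 * \<beta> \<tau> + ennreal (2 * K * (T * (2 * pi))) * (\<integral>\<^sup>+ \<sigma>. energy \<sigma> * indicator {0..\<tau>} \<sigma> \<partial>lborel)"
proof -
  let ?I = "\<integral>\<^sup>+ \<sigma>. energy \<sigma> * indicator {0..\<tau>} \<sigma> \<partial>lborel"
  let ?X = "\<lambda>z x. q x * ennreal (1 / norm x) * (indicator {..\<tau>} (norm x + norm (z - x) + norm (z - e)) * ennreal (1 / norm (z - x)))"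
  let ?Y = "\<lambda>z w. src w * (indicator {..\<tau>} (fst w + norm (z - snd w) + norm (z - e)) * ennreal (1 / norm (z - snd w)))"
  have "energy \<tau> = (\<integral>\<^sup>+ z. \<integral>\<^sup>+ t. m (t, z) * indicator {..\<tau>} (t + norm (z - e)) \<partial>lborel \<partial>lborel)"
    unfolding energy_def by (subst nn_integral_lborel_Pair(2)) auto
  also have "\<dots> \<le> (\<integral>\<^sup>+ z. ennreal (2 * K) * ((\<integral>\<^sup>+ x. ?X z x \<partial>lborel) + (\<integral>\<^sup>+ w. ?Y z w \<partial>lborel)) \<partial>lborel)"
  proof (intro nn_integral_mono)
    fix z :: "real^3"
    \<comment> \<open>Any negative left end keeps time 0 inside the half-open interval.\<close>
    let ?A = "{-1<..\<tau> - norm (z - e)}"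
    have "(\<integral>\<^sup>+ t. m (t, z) * indicator {..\<tau>} (t + norm (z - e)) \<partial>lborel) \<le> (\<integral>\<^sup>+ t. m (t, z) * indicator ?A t \<partial>lborel)"
    proof (intro nn_integral_mono)
      fix t
      show "m (t, z) * indicator {..\<tau>} (t + norm (z - e)) \<le> m (t, z) * indicator ?A t"
        using cone_setD[of "(t, z)"] m_zero[of "(t, z)"] by (cases "(t, z) \<in> cone_set") (auto split: split_indicator)
    qed
    also have "\<dots> \<le> ennreal (2 * K) * \<mu> z ?A" using assms by (intro m_bound) simp
    also have "\<mu> z ?A \<le> (\<integral>\<^sup>+ x. ?X z x \<partial>lborel) + (\<integral>\<^sup>+ w. ?Y z w \<partial>lborel)"
      by (rule order_trans[OF \<mu>_le]) (auto intro!: add_mono nn_integral_mono mult_left_mono mult_right_mono split: split_indicator)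
    finally show "(\<integral>\<^sup>+ t. m (t, z) * indicator {..\<tau>} (t + norm (z - e)) \<partial>lborel)
        \<le> ennreal (2 * K) * ((\<integral>\<^sup>+ x. ?X z x \<partial>lborel) + (\<integral>\<^sup>+ w. ?Y z w \<partial>lborel))"
      by (simp add: mult_left_mono)
  qed
  also have "\<dots> = ennreal (2 * K) * ((\<integral>\<^sup>+ z. \<integral>\<^sup>+ x. ?X z x \<partial>lborel \<partial>lborel) + (\<integral>\<^sup>+ z. \<integral>\<^sup>+ w. ?Y z w \<partial>lborel \<partial>lborel))"
    by (subst nn_integral_cmult, simp, subst nn_integral_add) auto
  also have "(\<integral>\<^sup>+ z. \<integral>\<^sup>+ x. ?X z x \<partial>lborel \<partial>lborel) = (\<integral>\<^sup>+ x. \<integral>\<^sup>+ z. ?X z x \<partial>lborel \<partial>lborel)"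
    by (rule tonelli_lborel) measurable
  also have "\<dots> \<le> (\<integral>\<^sup>+ x. ennreal (T * (2 * pi)) * (ennreal T * (q x * indicator {..\<tau>} (norm x + norm (x - e)) * ennreal (1 / norm x))) \<partial>lborel)"
  proof (intro nn_integral_mono)
    fix x
    have "(\<integral>\<^sup>+ z. ?X z x \<partial>lborel) = q x * ennreal (1 / norm x) *
        (\<integral>\<^sup>+ z. indicator {..\<tau>} (norm x + norm (z - x) + norm (z - e)) * ennreal (1 / norm (z - x)) \<partial>lborel)"
      by (rule nn_integral_cmult) auto
    also have "\<dots> \<le> q x * ennreal (1 / norm x) * (ennreal (T * (2 * pi)) * ennreal (\<tau> - (norm x + norm (x - e))))"
      by (intro mult_left_mono inner_sublevel assms) auto
    also have "\<dots> \<le> q x * ennreal (1 / norm x) * (ennreal (T * (2 * pi)) * (ennreal T * indicator {..\<tau>} (norm x + norm (x - e))))"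
    proof (intro mult_left_mono)
      have "\<tau> - (norm x + norm (x - e)) \<le> T" using assms norm_ge_zero[of x] norm_ge_zero[of "x - e"] by linarith
      then show "ennreal (\<tau> - (norm x + norm (x - e))) \<le> ennreal T * indicator {..\<tau>} (norm x + norm (x - e))"
        by (cases "norm x + norm (x - e) \<le> \<tau>") (auto simp: ennreal_neg intro: ennreal_leI)
    qed auto
    finally show "(\<integral>\<^sup>+ z. ?X z x \<partial>lborel) \<le> ennreal (T * (2 * pi)) * (ennreal T * (q x * indicator {..\<tau>} (norm x + norm (x - e)) * ennreal (1 / norm x)))"
      by (simp only: mult_ac)
  qed
  also have "\<dots> = ennreal (T * (2 * pi)) * (ennreal T * (\<integral>\<^sup>+ x. q x * indicator {..\<tau>} (norm x + norm (x - e)) * ennreal (1 / norm x) \<partial>lborel))"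
    by (subst nn_integral_cmult, simp, subst nn_integral_cmult) auto
  also have "\<dots> \<le> ennreal (T * (2 * pi)) * (ennreal T * (ennreal (2 * pi * T) * \<beta> \<tau>))"
    by (intro mult_left_mono q_near assms) auto
  also have "(\<integral>\<^sup>+ z. \<integral>\<^sup>+ w. ?Y z w \<partial>lborel \<partial>lborel) = (\<integral>\<^sup>+ w. \<integral>\<^sup>+ z. ?Y z w \<partial>lborel \<partial>lborel)"
    by (rule tonelli_lborel) measurable
  also have "\<dots> \<le> (\<integral>\<^sup>+ w. ennreal (T * (2 * pi)) * (src w * ennreal (\<tau> - (fst w + norm (snd w - e)))) \<partial>lborel)"
  proof (intro nn_integral_mono)
    fix w
    show "(\<integral>\<^sup>+ z. ?Y z w \<partial>lborel) \<le> ennreal (T * (2 * pi)) * (src w * ennreal (\<tau> - (fst w + norm (snd w - e))))"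
    proof (cases "w \<in> cone_set")
      case True
      have "(\<integral>\<^sup>+ z. ?Y z w \<partial>lborel) = src w *
        (\<integral>\<^sup>+ z. indicator {..\<tau>} (fst w + norm (z - snd w) + norm (z - e)) * ennreal (1 / norm (z - snd w)) \<partial>lborel)"
        by (rule nn_integral_cmult) auto
      also have "\<dots> \<le> src w * (ennreal (T * (2 * pi)) * ennreal (\<tau> - (fst w + norm (snd w - e))))"
        using cone_setD[OF True] by (intro mult_left_mono inner_sublevel assms) auto
      finally show ?thesis by (simp only: mult_ac)
    qed (simp add: src_def)
  qed
  also have "\<dots> = ennreal (T * (2 * pi)) * (\<integral>\<^sup>+ w. src w * ennreal (\<tau> - (fst w + norm (snd w - e))) \<partial>lborel)"
    by (rule nn_integral_cmult) auto
  also have "\<dots> \<le> ennreal (T * (2 * pi)) * (ennreal T * (ennreal T * (ennreal (2 * pi * (T * T)) * \<beta> \<tau>)) + ?I)"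
    by (intro mult_left_mono src_moment assms) auto
  finally have "energy \<tau> \<le> ennreal (2 * K) * (ennreal (T * (2 * pi)) * (ennreal T * (ennreal (2 * pi * T) * \<beta> \<tau>))
      + ennreal (T * (2 * pi)) * (ennreal T * (ennreal T * (ennreal (2 * pi * (T * T)) * \<beta> \<tau>)) + ?I))"
    by (simp only: mult_left_mono add_left_mono add_right_mono zero_le)
  also have "\<dots> = ennreal (2 * K) * ((ennreal (T * (2 * pi) * (T * (2 * pi * T))) * \<beta> \<tau>
      + ennreal (T * (2 * pi) * (T * (T * (2 * pi * (T * T))))) * \<beta> \<tau>) + ennreal (T * (2 * pi)) * ?I)"
    using T by (simp add: ennreal_scale_scale distrib_left add.assoc)
  also have "\<dots> = ennreal a1 * \<beta> \<tau> + ennreal (2 * K * (T * (2 * pi))) * ?I"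
    unfolding a1_def using T K_nonneg by (intro ennreal_scale_combine) auto
  finally show ?thesis .
qed

lemma energy_bound: obtains a where "0 \<le> a" "\<And>\<tau>. 0 \<le> \<tau> \<Longrightarrow> \<tau> \<le> T \<Longrightarrow> energy \<tau> \<le> ennreal a * \<beta> \<tau>"
proof -
  define a1 where "a1 = 2 * K * (T * (2 * pi) * (T * (2 * pi * T)) + T * (2 * pi) * (T * (T * (2 * pi * (T * T)))))"
  \<comment> \<open>The summand 1 makes the Gronwall constant positive even when \<open>K\<close> is
    0.\<close>
  define a2 where "a2 = 2 * K * (T * (2 * pi)) + 1"
  have a1: "0 \<le> a1" and a2: "0 < a2" using T K_nonneg by (auto simp: a1_def a2_def intro!: add_nonneg_pos)
  have mono: "\<beta> s \<le> \<beta> \<tau>" if "s \<le> \<tau>" for s \<tau>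
    unfolding \<beta>_def using that by (intro nn_integral_mono mult_left_mono) (auto split: split_indicator)
  have "energy \<tau> \<le> ennreal (2 * a1 * exp (2 * a2 * T)) * \<beta> \<tau>" if \<tau>: "0 \<le> \<tau>" "\<tau> \<le> T" for \<tau>
  proof -
    \<comment> \<open>Gronwall's lemma is applied on [0, \<tau>] for each \<tau> separately, with
      the monotone term \<open>\<beta> s\<close> frozen at its final value.\<close>
    have "energy \<tau> \<le> 2 * (ennreal a1 * \<beta> \<tau>) * ennreal (exp (2 * a2 * \<tau>))"
    proof (rule gronwall_ennreal[OF energy_measurable a2 energy_finite(2) _ _ \<tau>(1) order_refl])
      fix s assume s: "0 \<le> s" "s \<le> \<tau>"
      show "energy s \<le> energy T" using s \<tau> by (intro energy_finite) auto
      have "energy s \<le> ennreal a1 * \<beta> s + ennreal (2 * K * (T * (2 * pi))) * (\<integral>\<^sup>+ u. energy u * indicator {0..s} u \<partial>lborel)"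
        unfolding a1_def using s \<tau> by (intro energy_inequality) auto
      also have "\<dots> \<le> ennreal a1 * \<beta> \<tau> + ennreal a2 * (\<integral>\<^sup>+ u. energy u * indicator {0..s} u \<partial>lborel)"
        using s by (intro add_mono mult_left_mono mult_right_mono mono ennreal_leI) (auto simp: a2_def)
      finally show "energy s \<le> ennreal a1 * \<beta> \<tau> + ennreal a2 * (\<integral>\<^sup>+ u. energy u * indicator {0..s} u \<partial>lborel)" .
    qed
    also have "\<dots> \<le> 2 * (ennreal a1 * \<beta> \<tau>) * ennreal (exp (2 * a2 * T))"
      using a2 \<tau> by (intro mult_left_mono ennreal_leI) auto
    also have "\<dots> = ennreal (2 * a1 * exp (2 * a2 * T)) * \<beta> \<tau>"
      using a1 by (simp add: ennreal_mult mult_ac)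
    finally show ?thesis .
  qed
  moreover have "0 \<le> 2 * a1 * exp (2 * a2 * T)" using a1 by simp
  ultimately show ?thesis using that by blast
qed

text \<open>The factor 1/|z - e| from the formula at \<open>e\<close> and the factor 1/|z - x| from
  the potential at \<open>z\<close> form exactly the weight with foci \<open>x\<close> and
  \<open>e\<close>. Integrating over \<open>z\<close> therefore yields the length
  \<open>v - u\<close> of the time window.\<close>

lemma m_interval:
  assumes "v \<le> T" "u \<le> v"
  shows "(\<integral>\<^sup>+ w. m w * (indicator {u<..v} (fst w + norm (snd w - e)) * ennreal (1 / norm (snd w - e))) \<partial>lborel)
    \<le> ennreal (2 * K) * (ennreal (2 * pi) * ennreal (v - u) *
        (ennreal (2 * pi * T) * \<beta> v + (ennreal T * (ennreal (2 * pi * (T * T)) * \<beta> v) + energy v)))"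
proof -
  let ?k = "\<lambda>c z x. indicator {u<..v} (c + norm (z - x) + norm (z - e)) * ennreal (1 / (norm (z - x) * norm (z - e)))"
  let ?X = "\<lambda>z x. q x * ennreal (1 / norm x) * ?k (norm x) z x"
  let ?Y = "\<lambda>z (w :: spacetime). src w * ?k (fst w) z (snd w)"
  let ?J = "\<lambda>c x. ennreal (2 * pi) * (ennreal (v - u) * indicator {..v} (c + norm (x - e)))"
  have "(\<integral>\<^sup>+ w. m w * (indicator {u<..v} (fst w + norm (snd w - e)) * ennreal (1 / norm (snd w - e))) \<partial>lborel)
    = (\<integral>\<^sup>+ z. \<integral>\<^sup>+ t. m (t, z) * (indicator {u<..v} (t + norm (z - e)) * ennreal (1 / norm (z - e))) \<partial>lborel \<partial>lborel)"
    by (subst nn_integral_lborel_Pair(2)) auto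
  also have "\<dots> \<le> (\<integral>\<^sup>+ z. ennreal (2 * K) * ((\<integral>\<^sup>+ x. ?X z x \<partial>lborel) + (\<integral>\<^sup>+ w. ?Y z w \<partial>lborel)) \<partial>lborel)"
  proof (intro nn_integral_mono)
    fix z :: "real^3"
    let ?A = "{u - norm (z - e)<..v - norm (z - e)}" and ?c = "ennreal (1 / norm (z - e))"
    have [measurable]: "(\<lambda>t :: real. (t, z)) \<in> borel_measurable borel"
      by (intro borel_measurable_continuous_onI continuous_intros)
    have "(\<integral>\<^sup>+ t. m (t, z) * (indicator {u<..v} (t + norm (z - e)) * ?c) \<partial>lborel) = (\<integral>\<^sup>+ t. ?c * (m (t, z) * indicator ?A t) \<partial>lborel)"
      by (intro nn_integral_cong) (auto split: split_indicator simp: mult.commute)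
    also have "\<dots> = ?c * (\<integral>\<^sup>+ t. m (t, z) * indicator ?A t \<partial>lborel)"
      by (rule nn_integral_cmult) auto
    also have "\<dots> \<le> ?c * (ennreal (2 * K) * \<mu> z ?A)" using assms by (intro mult_left_mono m_bound) auto
    also have "\<dots> \<le> ?c * (ennreal (2 * K) * ((\<integral>\<^sup>+ x. q x * ennreal (1 / norm x) * (indicator ?A (norm x + norm (z - x)) * ennreal (1 / norm (z - x))) \<partial>lborel)
      + (\<integral>\<^sup>+ w. src w * (indicator ?A (fst w + norm (z - snd w)) * ennreal (1 / norm (z - snd w))) \<partial>lborel)))"
      by (intro mult_left_mono \<mu>_le) auto
    also have "\<dots> = ennreal (2 * K) * ((\<integral>\<^sup>+ x. ?c * (q x * ennreal (1 / norm x) * (indicator ?A (norm x + norm (z - x)) * ennreal (1 / norm (z - x)))) \<partial>lborel)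
      + (\<integral>\<^sup>+ w. ?c * (src w * (indicator ?A (fst w + norm (z - snd w)) * ennreal (1 / norm (z - snd w)))) \<partial>lborel))"
      by (subst (1 2) nn_integral_cmult) (auto simp: mult_ac distrib_left)
    also have "(\<integral>\<^sup>+ x. ?c * (q x * ennreal (1 / norm x) * (indicator ?A (norm x + norm (z - x)) * ennreal (1 / norm (z - x)))) \<partial>lborel) = (\<integral>\<^sup>+ x. ?X z x \<partial>lborel)"
    proof (intro nn_integral_cong)
      fix x
      have "ennreal (1 / (norm (z - x) * norm (z - e))) = ennreal (1 / norm (z - x)) * ?c" by (simp add: ennreal_mult[symmetric])
      then show "?c * (q x * ennreal (1 / norm x) * (indicator ?A (norm x + norm (z - x)) * ennreal (1 / norm (z - x)))) = ?X z x"
        by (auto split: split_indicator simp: mult_ac)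
    qed
    also have "(\<integral>\<^sup>+ w. ?c * (src w * (indicator ?A (fst w + norm (z - snd w)) * ennreal (1 / norm (z - snd w)))) \<partial>lborel) = (\<integral>\<^sup>+ w. ?Y z w \<partial>lborel)"
    proof (intro nn_integral_cong)
      fix w :: spacetime
      have "ennreal (1 / (norm (z - snd w) * norm (z - e))) = ennreal (1 / norm (z - snd w)) * ?c" by (simp add: ennreal_mult[symmetric])
      then show "?c * (src w * (indicator ?A (fst w + norm (z - snd w)) * ennreal (1 / norm (z - snd w)))) = ?Y z w"
        by (auto split: split_indicator simp: mult_ac)
    qed
    finally show "(\<integral>\<^sup>+ t. m (t, z) * (indicator {u<..v} (t + norm (z - e)) * ?c) \<partial>lborel)
      \<le> ennreal (2 * K) * ((\<integral>\<^sup>+ x. ?X z x \<partial>lborel) + (\<integral>\<^sup>+ w. ?Y z w \<partial>lborel))" .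
  qed
  also have "\<dots> = ennreal (2 * K) * ((\<integral>\<^sup>+ z. \<integral>\<^sup>+ x. ?X z x \<partial>lborel \<partial>lborel) + (\<integral>\<^sup>+ z. \<integral>\<^sup>+ w. ?Y z w \<partial>lborel \<partial>lborel))"
    by (subst nn_integral_cmult, simp, subst nn_integral_add) auto
  also have "(\<integral>\<^sup>+ z. \<integral>\<^sup>+ x. ?X z x \<partial>lborel \<partial>lborel) = (\<integral>\<^sup>+ x. \<integral>\<^sup>+ z. ?X z x \<partial>lborel \<partial>lborel)"
    by (rule tonelli_lborel) measurable
  also have "\<dots> \<le> (\<integral>\<^sup>+ x. ennreal (2 * pi) * ennreal (v - u) * (q x * indicator {..v} (norm x + norm (x - e)) * ennreal (1 / norm x)) \<partial>lborel)"
  proof (intro nn_integral_mono)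
    fix x
    have "(\<integral>\<^sup>+ z. ?X z x \<partial>lborel) = q x * ennreal (1 / norm x) * (\<integral>\<^sup>+ z. ?k (norm x) z x \<partial>lborel)"
      by (rule nn_integral_cmult) auto
    also have "\<dots> \<le> q x * ennreal (1 / norm x) * ?J (norm x) x"
      by (intro mult_left_mono nn_integral_foci_interval) auto
    finally show "(\<integral>\<^sup>+ z. ?X z x \<partial>lborel) \<le> ennreal (2 * pi) * ennreal (v - u) * (q x * indicator {..v} (norm x + norm (x - e)) * ennreal (1 / norm x))"
      by (simp only: mult_ac)
  qed
  also have "\<dots> = ennreal (2 * pi) * ennreal (v - u) * (\<integral>\<^sup>+ x. q x * indicator {..v} (norm x + norm (x - e)) * ennreal (1 / norm x) \<partial>lborel)"
    by (rule nn_integral_cmult) auto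
  also have "\<dots> \<le> ennreal (2 * pi) * ennreal (v - u) * (ennreal (2 * pi * T) * \<beta> v)"
    by (intro mult_left_mono q_near assms) auto
  also have "(\<integral>\<^sup>+ z. \<integral>\<^sup>+ w. ?Y z w \<partial>lborel \<partial>lborel) = (\<integral>\<^sup>+ w. \<integral>\<^sup>+ z. ?Y z w \<partial>lborel \<partial>lborel)"
    by (rule tonelli_lborel) measurable
  also have "\<dots> \<le> (\<integral>\<^sup>+ w. ennreal (2 * pi) * ennreal (v - u) * (src w * indicator {..v} (fst w + norm (snd w - e))) \<partial>lborel)"
  proof (intro nn_integral_mono)
    fix w
    have "(\<integral>\<^sup>+ z. ?Y z w \<partial>lborel) = src w * (\<integral>\<^sup>+ z. ?k (fst w) z (snd w) \<partial>lborel)"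
      by (rule nn_integral_cmult) auto
    also have "\<dots> \<le> src w * ?J (fst w) (snd w)"
      by (intro mult_left_mono nn_integral_foci_interval) auto
    finally show "(\<integral>\<^sup>+ z. ?Y z w \<partial>lborel) \<le> ennreal (2 * pi) * ennreal (v - u) * (src w * indicator {..v} (fst w + norm (snd w - e)))"
      by (simp only: mult_ac)
  qed
  also have "\<dots> = ennreal (2 * pi) * ennreal (v - u) * (\<integral>\<^sup>+ w. src w * indicator {..v} (fst w + norm (snd w - e)) \<partial>lborel)"
    by (rule nn_integral_cmult) auto
  also have "(\<integral>\<^sup>+ w. src w * indicator {..v} (fst w + norm (snd w - e)) \<partial>lborel)
     = (\<integral>\<^sup>+ w. indicator cone_set w * q (snd w) * indicator {..v} (fst w + norm (snd w - e)) \<partial>lborel) + energy v"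
    unfolding energy_def src_eq distrib_right by (rule nn_integral_add) auto
  also have "(\<integral>\<^sup>+ w. indicator cone_set w * q (snd w) * indicator {..v} (fst w + norm (snd w - e)) \<partial>lborel)
      \<le> ennreal T * (ennreal (2 * pi * (T * T)) * \<beta> v)"
    by (rule q_cone) (rule assms)
  finally have "(\<integral>\<^sup>+ w. m w * (indicator {u<..v} (fst w + norm (snd w - e)) * ennreal (1 / norm (snd w - e))) \<partial>lborel)
    \<le> ennreal (2 * K) * (ennreal (2 * pi) * ennreal (v - u) * (ennreal (2 * pi * T) * \<beta> v)
      + ennreal (2 * pi) * ennreal (v - u) * (ennreal T * (ennreal (2 * pi * (T * T)) * \<beta> v) + energy v))"
    by (simp only: mult_left_mono add_left_mono add_right_mono zero_le)
  then show ?thesis by (simp only: distrib_left)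
qed

end

section \<open>The Volterra inequality and the vanishing of the profile\<close>

context ellipsoidal_difference
begin

text \<open>For \<open>z = e\<close> the left-hand side of \<open>weak_interval\<close> vanishes, so
  the cone term balances the volume term. The factor 1/(4 pi) of the source and the density 2 pi of
  the ellipsoids make the former \<open>\<kappa> 1 / 2\<close> times the integral of
  \<open>b\<close>; the latter carries the factor \<open>v - u\<close>.\<close>

lemma b_interval:
  obtains D where "0 \<le> D"
    "\<And>u v. 1 \<le> u \<Longrightarrow> u \<le> v \<Longrightarrow> v \<le> T \<Longrightarrow> ennreal \<bar>LINT s|lborel. b s * indicator {u<..<v} s\<bar> \<le> ennreal (D * (v - u)) * \<beta> v"
proof -
  obtain a where a: "0 \<le> a" "\<And>\<tau>. 0 \<le> \<tau> \<Longrightarrow> \<tau> \<le> T \<Longrightarrow> energy \<tau> \<le> ennreal a * \<beta> \<tau>" using energy_bound by blast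
  let ?c = "(\<Sum>j\<in>UNIV. \<bar>\<kappa> j\<bar>) + \<bar>C\<^sub>0\<bar>"
  define D1 where "D1 = 2 * pi * T + 2 * K * (2 * pi * (2 * pi * T + (T * (2 * pi * (T * T)) + a)))"
  define D where "D = 2 / \<bar>\<kappa> 1\<bar> * ?c * D1"
  have c0: "0 \<le> ?c" by (intro add_nonneg_nonneg sum_nonneg) auto
  have T0: "0 \<le> T" using T by simp
  have D1: "0 \<le> D1" unfolding D1_def using T0 K_nonneg a(1) by (intro add_nonneg_nonneg mult_nonneg_nonneg) auto
  have D: "0 \<le> D" unfolding D_def using D1 c0 by (intro mult_nonneg_nonneg) auto
  show ?thesis
  proof (rule that[OF D])
    fix u v :: real assume uv: "1 \<le> u" "u \<le> v" "v \<le> T"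
    interpret cone_wave "r 1" "S 1" "\<lambda>x. \<kappa> 1 * b (norm x + norm (x - e))" by (rule wave)
    let ?I = "indicat_real {u<..<v}"
    let ?B = "\<lambda>w. indicator cone_set w * S 1 w * (?I (fst w + norm (snd w - e)) / norm (snd w - e))"
    let ?Y = "\<integral>\<^sup>+ w. src w * indicator {u<..v} (fst w + norm (snd w - e)) * ennreal (1 / norm (snd w - e)) \<partial>lborel"
    have "indicator cone_set (t, e) * r 1 (t, e) * ?I t = 0" for t
      using vanish[of t] uv by (cases "t \<in> {u<..<v}") auto
    then have "(LINT t|lborel. indicator cone_set (t, e) * r 1 (t, e) * ?I t) = 0" by (simp only: integral_zero)
    then have zero: "0 = (LINT x|lborel. \<kappa> 1 * b (norm x + norm (x - e)) * (?I (norm x + norm (x - e)) / norm (x - e)) / (4 * pi * norm x))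
        + (LINT w|lborel. ?B w)"
      unfolding weak_interval[symmetric] by (simp only: mult_zero_right)
    have "(LINT x|lborel. \<kappa> 1 * b (norm x + norm (x - e)) * (?I (norm x + norm (x - e)) / norm (x - e)) / (4 * pi * norm x))
      = (LINT x|lborel. (\<kappa> 1 / (4 * pi)) * ((b (norm (x - 0) + norm (x - e)) * ?I (norm (x - 0) + norm (x - e))) / (norm (x - 0) * norm (x - e))))"
      by (intro Bochner_Integration.integral_cong refl) (simp add: mult_ac)
    also have "\<dots> = (\<kappa> 1 / (4 * pi)) * (2 * pi * (LINT s|lborel. indicator {norm (0 - e)..} s * (b s * ?I s)))"
      by (subst integral_mult_right_zero, subst integral_foci[where g="\<lambda>s. b s * ?I s"]) auto
    \<comment> \<open>The ellipsoids start at \<open>norm e = 1\<close>, which is at most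
      \<open>u\<close>, so the lower limit cuts off nothing.\<close>
    also have "(LINT s|lborel. indicator {norm (0 - e)..} s * (b s * ?I s)) = (LINT s|lborel. b s * ?I s)"
      using e uv by (intro Bochner_Integration.integral_cong refl) (auto split: split_indicator)
    also have "(\<kappa> 1 / (4 * pi)) * (2 * pi * (LINT s|lborel. b s * ?I s)) = \<kappa> 1 / 2 * (LINT s|lborel. b s * ?I s)" by simp
    finally have "\<kappa> 1 / 2 * (LINT s|lborel. b s * ?I s) = - (LINT w|lborel. ?B w)" using zero by linarith
    then have "\<bar>\<kappa> 1 / 2 * (LINT s|lborel. b s * ?I s)\<bar> = \<bar>- (LINT w|lborel. ?B w)\<bar>" by (rule arg_cong)
    then have "\<bar>\<kappa> 1\<bar> / 2 * \<bar>LINT s|lborel. b s * ?I s\<bar> = \<bar>LINT w|lborel. ?B w\<bar>"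
      by (simp only: abs_mult abs_minus_cancel abs_divide abs_numeral)
    then have "ennreal (\<bar>\<kappa> 1\<bar> / 2 * \<bar>LINT s|lborel. b s * ?I s\<bar>) \<le> (\<integral>\<^sup>+ w. ennreal \<bar>?B w\<bar> \<partial>lborel)"
      using ennreal_abs_integral_le[of lborel ?B] by simp
    also have "\<dots> \<le> (\<integral>\<^sup>+ w. ennreal ?c * (src w * indicator {u<..v} (fst w + norm (snd w - e)) * ennreal (1 / norm (snd w - e))) \<partial>lborel)"
      using uv by (intro nn_integral_mono S_term_bound) simp
    also have "\<dots> = ennreal ?c * ?Y" by (rule nn_integral_cmult) auto
    also have "?Y = (\<integral>\<^sup>+ w. indicator cone_set w * q (snd w) * indicator {u<..v} (fst w + norm (snd w - e)) * ennreal (1 / norm (snd w - e)) \<partial>lborel)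
      + (\<integral>\<^sup>+ w. m w * (indicator {u<..v} (fst w + norm (snd w - e)) * ennreal (1 / norm (snd w - e))) \<partial>lborel)"
      by (subst nn_integral_add[symmetric]) (auto simp: src_eq distrib_right mult.assoc)
    also have "\<dots> \<le> ennreal (v - u) * (ennreal (2 * pi * T) * \<beta> v) + ennreal (2 * K) * (ennreal (2 * pi) * ennreal (v - u) *
        (ennreal (2 * pi * T) * \<beta> v + (ennreal T * (ennreal (2 * pi * (T * T)) * \<beta> v) + ennreal a * \<beta> v)))"
    proof (intro add_mono q_cone_interval uv order_trans[OF m_interval])
      show "ennreal (2 * K) * (ennreal (2 * pi) * ennreal (v - u) *
        (ennreal (2 * pi * T) * \<beta> v + (ennreal T * (ennreal (2 * pi * (T * T)) * \<beta> v) + energy v)))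
       \<le> ennreal (2 * K) * (ennreal (2 * pi) * ennreal (v - u) *
        (ennreal (2 * pi * T) * \<beta> v + (ennreal T * (ennreal (2 * pi * (T * T)) * \<beta> v) + ennreal a * \<beta> v)))"
        using uv by (intro mult_left_mono add_left_mono a(2)) auto
    qed
    also have "\<dots> = ennreal ((v - u) * D1) * \<beta> v"
    proof -
      have "ennreal (2 * pi * T) * \<beta> v + (ennreal T * (ennreal (2 * pi * (T * T)) * \<beta> v) + ennreal a * \<beta> v)
          = ennreal (2 * pi * T + (T * (2 * pi * (T * T)) + a)) * \<beta> v"
        using T0 a(1) by (simp only: ennreal_scale_scale ennreal_scale_add mult_nonneg_nonneg add_nonneg_nonneg pi_ge_zero zero_le_numeral)
      moreover have "ennreal (2 * K) * (ennreal (2 * pi) * ennreal (v - u) * (ennreal x * \<beta> v)) = ennreal ((v - u) * (2 * K * (2 * pi * x))) * \<beta> v"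
        if "0 \<le> x" for x
      proof -
        have "ennreal (2 * K) * (ennreal (2 * pi) * ennreal (v - u) * (ennreal x * \<beta> v)) = ennreal (2 * K * (2 * pi * ((v - u) * x))) * \<beta> v"
          using that uv K_nonneg by (simp only: mult.assoc[of "ennreal (2 * pi)"] ennreal_scale_scale mult_nonneg_nonneg
              pi_ge_zero zero_le_numeral diff_ge_0_iff_ge)
        also have "2 * K * (2 * pi * ((v - u) * x)) = (v - u) * (2 * K * (2 * pi * x))" by (simp only: mult_ac)
        finally show ?thesis .
      qed
      ultimately show ?thesis
        using uv T0 a(1) K_nonneg
        by (simp only: ennreal_scale_scale ennreal_scale_add mult_nonneg_nonneg add_nonneg_nonneg pi_ge_zero
            zero_le_numeral diff_ge_0_iff_ge D1_def distrib_left[of "v - u"])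
    qed
    finally have "ennreal (\<bar>\<kappa> 1\<bar> / 2 * \<bar>LINT s|lborel. b s * ?I s\<bar>) \<le> ennreal ?c * (ennreal ((v - u) * D1) * \<beta> v)"
      by (simp only: mult_left_mono zero_le)
    then have "ennreal (2 / \<bar>\<kappa> 1\<bar>) * ennreal (\<bar>\<kappa> 1\<bar> / 2 * \<bar>LINT s|lborel. b s * ?I s\<bar>)
       \<le> ennreal (2 / \<bar>\<kappa> 1\<bar>) * (ennreal ?c * (ennreal ((v - u) * D1) * \<beta> v))"
      by (rule mult_left_mono) simp
    moreover have "ennreal (2 / \<bar>\<kappa> 1\<bar>) * ennreal (\<bar>\<kappa> 1\<bar> / 2 * \<bar>LINT s|lborel. b s * ?I s\<bar>) = ennreal \<bar>LINT s|lborel. b s * ?I s\<bar>"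
      using \<kappa> by (simp add: ennreal_mult[symmetric])
    moreover have "ennreal (2 / \<bar>\<kappa> 1\<bar>) * (ennreal ?c * (ennreal ((v - u) * D1) * \<beta> v)) = ennreal (D * (v - u)) * \<beta> v"
    proof -
      have "ennreal (2 / \<bar>\<kappa> 1\<bar>) * (ennreal ?c * (ennreal ((v - u) * D1) * \<beta> v)) = ennreal (2 / \<bar>\<kappa> 1\<bar> * (?c * ((v - u) * D1))) * \<beta> v"
        using c0 uv D1 by (subst ennreal_scale_scale, simp, simp, subst ennreal_scale_scale) auto
      also have "2 / \<bar>\<kappa> 1\<bar> * (?c * ((v - u) * D1)) = D * (v - u)" by (simp add: D_def)
      finally show ?thesis .
    qed
    ultimately show "ennreal \<bar>LINT s|lborel. b s * ?I s\<bar> \<le> ennreal (D * (v - u)) * \<beta> v" by simp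
  qed
qed

lemma \<beta>_finite: "\<beta> \<tau> < \<infinity>"
proof -
  have "compact (b ` {1..\<tau>})" by (rule compact_continuous_image[OF continuous_on_subset[OF b]]) auto
  from compact_imp_bounded[OF this] obtain M where M: "\<forall>y\<in>b ` {1..\<tau>}. norm y \<le> M"
    unfolding bounded_iff by blast
  have "\<beta> \<tau> \<le> (\<integral>\<^sup>+ s. ennreal M * indicator {1..\<tau>} s \<partial>lborel)"
    unfolding \<beta>_def using M by (intro nn_integral_mono) (auto split: split_indicator intro: ennreal_leI)
  also have "\<dots> = ennreal M * emeasure lborel {1..\<tau>}" by (rule nn_integral_cmult_indicator) auto
  also have "\<dots> < \<infinity>" by (simp add: ennreal_mult_less_top emeasure_lborel_Icc_eq)
  finally show ?thesis .
qed

text \<open>A factor below \<open>1\<close> in front of \<open>\<beta> \<tau>\<close> absorbs it, so the zero set of \<open>\<beta>\<close> grows by a fixed step.\<close>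

lemma \<beta>_step:
  assumes D: "0 \<le> D" "\<And>u v. 1 \<le> u \<Longrightarrow> u \<le> v \<Longrightarrow> v \<le> T \<Longrightarrow> ennreal \<bar>LINT s|lborel. b s * indicator {u<..<v} s\<bar> \<le> ennreal (D * (v - u)) * \<beta> v"
    and a: "1 \<le> a" "a \<le> \<tau>" "\<tau> \<le> T" "D * (\<tau> - a) \<le> 1 / 2" "\<beta> a = 0"
  shows "\<beta> \<tau> = 0"
proof -
  have mono: "\<beta> s \<le> \<beta> \<tau>" if "s \<le> \<tau>" for s
    unfolding \<beta>_def using that by (intro nn_integral_mono mult_left_mono) (auto split: split_indicator)
  have "(\<integral>\<^sup>+ s. ennreal \<bar>b s\<bar> * indicator {a..\<tau>} s \<partial>lborel) \<le> ennreal (D * (\<tau> - a)) * \<beta> \<tau>"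
  \<comment> \<open>The factor is frozen at \<open>\<beta> \<tau>\<close>, which makes the bound
    additive in the interval.\<close>
  proof (rule nn_integral_abs_le_of_subintervals[where F="\<lambda>u v. ennreal (D * (v - u)) * \<beta> \<tau>"])
    show "continuous_on {a..\<tau>} b" using b by (rule continuous_on_subset) auto
    show "a \<le> \<tau>" by (rule a(2))
    fix u v :: real assume u: "a \<le> u" "u \<le> v" 
    { assume v: "v \<le> \<tau>"
      have "ennreal \<bar>LINT s|lborel. b s * indicator {u<..<v} s\<bar> \<le> ennreal (D * (v - u)) * \<beta> v" using u v a by (intro D(2)) auto
      also have "\<dots> \<le> ennreal (D * (v - u)) * \<beta> \<tau>" by (intro mult_left_mono mono v) auto
      finally show "ennreal \<bar>LINT s|lborel. b s * indicator {u<..<v} s\<bar> \<le> ennreal (D * (v - u)) * \<beta> \<tau>" . }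
    { fix w assume "v \<le> w" "w \<le> \<tau>"
      then have "0 \<le> D * (v - u)" "0 \<le> D * (w - v)" using u D(1) by (auto intro: mult_nonneg_nonneg)
      moreover have "D * (v - u) + D * (w - v) = D * (w - u)" by (simp add: algebra_simps)
      ultimately show "ennreal (D * (v - u)) * \<beta> \<tau> + ennreal (D * (w - v)) * \<beta> \<tau> \<le> ennreal (D * (w - u)) * \<beta> \<tau>"
        by (simp only: ennreal_scale_add order_refl) }
  qed
  moreover have "\<beta> \<tau> \<le> \<beta> a + (\<integral>\<^sup>+ s. ennreal \<bar>b s\<bar> * indicator {a..\<tau>} s \<partial>lborel)"
    unfolding \<beta>_def by (subst nn_integral_add[symmetric]) (auto intro!: nn_integral_mono split: split_indicator)
  ultimately have "\<beta> \<tau> \<le> ennreal (D * (\<tau> - a)) * \<beta> \<tau>" using a(5) by simp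
  also have "\<dots> \<le> ennreal (1 / 2) * \<beta> \<tau>" using a(4) by (intro mult_right_mono ennreal_leI) auto
  finally have le: "\<beta> \<tau> \<le> ennreal (1 / 2) * \<beta> \<tau>" .
  obtain x where x: "\<beta> \<tau> = ennreal x" "0 \<le> x" using \<beta>_finite[of \<tau>] by (cases "\<beta> \<tau>") auto
  have "ennreal x \<le> ennreal (1 / 2 * x)" using le x by (simp only: ennreal_mult[symmetric] zero_le_divide_1_iff zero_le_numeral)
  then have "x \<le> 1 / 2 * x" using x(2) by (simp add: ennreal_le_iff)
  then show ?thesis using x by simp
qed

lemma b_zero:
  assumes "1 \<le> s" "s \<le> T"
  shows "b s = 0"
proof -
  obtain D where D: "0 \<le> D" "\<And>u v. 1 \<le> u \<Longrightarrow> u \<le> v \<Longrightarrow> v \<le> T \<Longrightarrow>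
      ennreal \<bar>LINT s|lborel. b s * indicator {u<..<v} s\<bar> \<le> ennreal (D * (v - u)) * \<beta> v"
    using b_interval by blast
  \<comment> \<open>The step length gives \<open>D * h\<close> at most 1/2; the summand 1 covers
    \<open>D = 0\<close>. It does not depend on the position, so finitely many steps reach
    \<open>T\<close>.\<close>
  define h where "h = 1 / (2 * (D + 1))"
  have h: "0 < h" "D * h \<le> 1 / 2" using D(1) by (auto simp: h_def field_simps)
  have iter: "\<beta> (min T (1 + real n * h)) = 0" for n
  proof (induction n)
    case 0
    have "\<beta> 1 = (\<integral>\<^sup>+ s. ennreal \<bar>b s\<bar> * indicator {1} s \<partial>lborel)" by (simp add: \<beta>_def)
    also have "\<dots> = 0" by (simp add: nn_integral_indicator_singleton)
    finally show ?case using T by simp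
  next
    case (Suc n)
    let ?a = "min T (1 + real n * h)" and ?t = "min T (1 + real (Suc n) * h)"
    have le: "?a \<le> ?t" "?t - ?a \<le> h" using h(1) by (auto simp: min_def algebra_simps)
    have "D * (?t - ?a) \<le> D * h" using le D(1) by (intro mult_left_mono)
    then have "D * (?t - ?a) \<le> 1 / 2" using h(2) by linarith
    then show ?case using T h(1) le Suc by (intro \<beta>_step[OF D, of ?a ?t]) auto
  qed
  obtain n where "(T - 1) / h \<le> real n" using real_arch_simple by blast
  then have "T \<le> 1 + real n * h" using h(1) by (simp add: field_simps)
  then have "\<beta> T = 0" using iter[of n] by (simp add: min_absorb1)
  then have "AE s in lborel. ennreal \<bar>b s\<bar> * indicator {1..T} s = 0"
    unfolding \<beta>_def by (subst (asm) nn_integral_0_iff_AE) auto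
  then have AE: "AE s\<in>{1<..<T} in lborel. s \<in> {s. b s = 0}"
    by eventually_elim (auto split: split_indicator_asm simp: ennreal_eq_0_iff)
  \<comment> \<open>Closedness of the zero set upgrades almost everywhere to everywhere on the open
    interval, and then adds both endpoints.\<close>
  have cl: "closed {s. b s = 0}" using b by (intro closed_Collect_eq) (auto intro: continuous_intros)
  have "{1<..<T} \<subseteq> {s. b s = 0}"
  proof
    fix s assume "s \<in> {1<..<T}"
    then show "s \<in> {s. b s = 0}"
      by (rule mem_closed_if_AE_lebesgue_open[OF open_greaterThanLessThan cl AE_completion[OF AE]])
  qed
  then have "closure {1<..<T} \<subseteq> {s. b s = 0}" using cl by (rule closure_minimal)
  then show ?thesis using T assms by auto
qed

end

section \<open>Reduction of the three classes to one scalar profile\<close>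

lemma admissible_difference:
  assumes "p \<in> {1, 2, 3}" "P1 \<in> admissible f g p" "P2 \<in> admissible f g p"
  obtains k :: "2 \<Rightarrow> 2 \<Rightarrow> real" and i\<^sub>0 j\<^sub>0 :: 2 where
    "\<And>x i j. P1 x $ i $ j - P2 x $ i $ j = k i j * (P1 x $ i\<^sub>0 $ j\<^sub>0 - P2 x $ i\<^sub>0 $ j\<^sub>0)"
    "\<And>i j. \<bar>k i j\<bar> \<le> 1" "(\<Sum>j\<in>UNIV. k 1 j) \<noteq> 0"
proof -
  consider "p = 1" | "p = 2" | "p = 3" using assms(1) by blast
  \<comment> \<open>The prescribed entries cancel. The fixed matrix is all ones for
    \<open>p = 1\<close>, the identity for \<open>p = 2\<close> and the exchange of components for
    \<open>p = 3\<close>; its first row sums to 2, 1 and 1.\<close>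
  then show ?thesis
  proof cases
    case 1
    then obtain \<beta>1 \<beta>2 where "\<And>x. P1 x = vector [vector [\<beta>1 x, \<beta>1 x], vector [\<beta>1 x, \<beta>1 x]]"
      "\<And>x. P2 x = vector [vector [\<beta>2 x, \<beta>2 x], vector [\<beta>2 x, \<beta>2 x]]"
      using assms by (auto simp: admissible_def)
    then have "P1 x $ i $ j - P2 x $ i $ j = 1 * (P1 x $ 1 $ 1 - P2 x $ 1 $ 1)" for x i j
      using exhaust_2[of i] exhaust_2[of j] by auto
    then show ?thesis by (rule that) (auto simp: sum_2)
  next
    case 2
    then obtain \<beta>1 \<beta>2 where "\<And>x. P1 x = vector [vector [\<beta>1 x, f x], vector [g x, \<beta>1 x]]"
      "\<And>x. P2 x = vector [vector [\<beta>2 x, f x], vector [g x, \<beta>2 x]]"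
      using assms by (auto simp: admissible_def)
    then have "P1 x $ i $ j - P2 x $ i $ j = (if i = j then 1 else 0) * (P1 x $ 1 $ 1 - P2 x $ 1 $ 1)" for x i j
      using exhaust_2[of i] exhaust_2[of j] by auto
    then show ?thesis by (rule that) (auto simp: sum_2)
  next
    case 3
    then obtain \<beta>1 \<beta>2 where "\<And>x. P1 x = vector [vector [f x, \<beta>1 x], vector [\<beta>1 x, g x]]"
      "\<And>x. P2 x = vector [vector [f x, \<beta>2 x], vector [\<beta>2 x, g x]]"
      using assms by (auto simp: admissible_def)
    then have "P1 x $ i $ j - P2 x $ i $ j = (if i = j then 0 else 1) * (P1 x $ 1 $ 2 - P2 x $ 1 $ 2)" for x i j
      using exhaust_2[of i] exhaust_2[of j] by auto
    then show ?thesis by (rule that) (auto simp: sum_2)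
  qed
qed

lemma norm_e1: "norm e1 = 1"
  by (simp add: e1_def norm_vec_def L2_set_def sum_3)

theorem theorem1p4:
  fixes T :: real and p :: nat
    and f g :: "real^3 \<Rightarrow> real"
    and P1 P2 :: "real^3 \<Rightarrow> real^2^2"
    and U1 U2 :: "(spacetime functional)^2"
    and R1 R2 :: "spacetime \<Rightarrow> real^2"
  assumes "T > 1"
    and "p \<in> {1, 2, 3}"
    and "P1 \<in> admissible f g p" and "P2 \<in> admissible f g p"
    and "\<And>i j. smooth (\<lambda>x. P1 x $ i $ j)" and "\<And>i j. smooth (\<lambda>x. P2 x $ i $ j)"
    and "solves_ivp P1 U1" and "solves_ivp P2 U2"
    and "regular_part U1 R1" and "regular_part U2 R2"
    and "\<And>i j. \<exists>b :: real \<Rightarrow> real. \<forall>x. P1 x $ i $ j = b (norm x + norm (x - e1))"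
    and "\<And>i j. \<exists>b :: real \<Rightarrow> real. \<forall>x. P2 x $ i $ j = b (norm x + norm (x - e1))"
    and "\<forall>t\<in>{1<..T}. R1 (t, e1) = R2 (t, e1)"
  shows "\<forall>x. norm x + norm (x - e1) \<le> T \<longrightarrow> P1 x = P2 x"
proof -
  obtain k :: "2 \<Rightarrow> 2 \<Rightarrow> real" and i\<^sub>0 j\<^sub>0 :: 2 where
    k: "\<And>x i j. P1 x $ i $ j - P2 x $ i $ j = k i j * (P1 x $ i\<^sub>0 $ j\<^sub>0 - P2 x $ i\<^sub>0 $ j\<^sub>0)"
    and k1: "\<And>i j. \<bar>k i j\<bar> \<le> 1" and k0: "(\<Sum>j\<in>UNIV. k 1 j) \<noteq> 0"
    using admissible_difference[OF assms(2-4)] by metis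
  define d where "d x = P1 x $ i\<^sub>0 $ j\<^sub>0 - P2 x $ i\<^sub>0 $ j\<^sub>0" for x
  have kd: "P1 x $ i $ j - P2 x $ i $ j = k i j * d x" for x i j
    unfolding d_def by (rule k)
  \<comment> \<open>The point ((s + 1)/2) e1 lies beyond the focus \<open>e1\<close> on the axis,
    and for \<open>s \<ge> 1\<close> its focal distances (s + 1)/2 and (s - 1)/2 add up to
    \<open>s\<close>. Sampling \<open>d\<close> along this ray gives a profile that is continuous on
    the whole line, whereas the profiles in the hypotheses come without regularity.\<close>
  define b where "b s = d (((s + 1) / 2) *\<^sub>R e1)" for s
  have cP: "continuous_on UNIV (\<lambda>x. P1 x $ i $ j)" "continuous_on UNIV (\<lambda>x. P2 x $ i $ j)" for i j
    by (rule smooth_continuous[OF assms(5)], rule smooth_continuous[OF assms(6)])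
  have cd: "continuous_on UNIV d" unfolding d_def[abs_def] by (intro continuous_intros cP)
  have cb: "continuous_on UNIV b"
    unfolding b_def[abs_def] by (rule continuous_on_compose2[OF cd]) (auto intro!: continuous_intros)
  obtain b' where b': "\<And>x. d x = b' (norm x + norm (x - e1))"
  proof -
    obtain b1 b2 :: "real \<Rightarrow> real" where "\<forall>x. P1 x $ i\<^sub>0 $ j\<^sub>0 = b1 (norm x + norm (x - e1))"
      "\<forall>x. P2 x $ i\<^sub>0 $ j\<^sub>0 = b2 (norm x + norm (x - e1))"
      using assms(11,12) by metis
    then show ?thesis using that[of "\<lambda>s. b1 s - b2 s"] by (simp add: d_def)
  qed
  have ge1: "1 \<le> norm x + norm (x - e1)" for x
    using norm_triangle_ineq4[of x "x - e1"] norm_e1 by simp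
  have bd: "b (norm x + norm (x - e1)) = d x" for x
  proof -
    define s where "s = norm x + norm (x - e1)"
    let ?y = "((s + 1) / 2) *\<^sub>R e1"
    have s: "1 \<le> s" using ge1 by (simp add: s_def)
    have "(s - 1) / 2 = (s + 1) / 2 - 1" by (simp add: field_simps)
    then have "?y - e1 = ((s - 1) / 2) *\<^sub>R e1" by (simp only: scaleR_diff_left scaleR_one)
    then have "norm (?y - e1) = (s - 1) / 2" using s norm_e1 by (simp only: norm_scaleR) simp
    moreover have "norm ?y = (s + 1) / 2" using s norm_e1 by simp
    ultimately have "norm ?y + norm (?y - e1) = s" by (simp add: field_simps)
    then show ?thesis using b'[of ?y] b'[of x] by (simp add: b_def s_def)
  qed
  define r where "r i w = R1 w $ i - R2 w $ i" for i :: 2 and w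
  define S where "S i w = (\<Sum>j\<in>UNIV. P1 (snd w) $ i $ j * R1 w $ j - P2 (snd w) $ i $ j * R2 w $ j)" for i :: 2 and w
  have cR: "continuous_on cone_set (\<lambda>w. R1 w $ j)" "continuous_on cone_set (\<lambda>w. R2 w $ j)" for j
    using assms(9,10) by (auto simp: regular_part_def C1_up_to_cone_def cone_set_def intro!: continuous_intros)
  have wave: "cone_wave (r i) (S i) (\<lambda>x. (\<Sum>j\<in>UNIV. k i j) * b (norm x + norm (x - e1)))" for i
  proof
    show "continuous_on cone_set (r i)" unfolding r_def[abs_def] by (intro continuous_intros cR)
    show "continuous_on cone_set (S i)" unfolding S_def[abs_def]
      by (intro continuous_intros cR continuous_on_compose2[OF cP(1)] continuous_on_compose2[OF cP(2)]) auto
    show "continuous_on UNIV (\<lambda>x. (\<Sum>j\<in>UNIV. k i j) * b (norm x + norm (x - e1)))"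
      unfolding bd by (intro continuous_intros cd)
    fix \<phi> :: "spacetime \<Rightarrow> real" assume "test_fun \<phi>"
    from difference_identity[OF assms(5-10) this, of i]
    show "(LINT w|lborel. indicator cone_set w * r i w * dalembert \<phi> w)
       = (LINT x|lborel. (\<Sum>j\<in>UNIV. k i j) * b (norm x + norm (x - e1)) * \<phi> (norm x, x) / (4 * pi * norm x))
       + (LINT w|lborel. indicator cone_set w * S i w * \<phi> w)"
      unfolding bd by (simp only: r_def S_def kd sum_distrib_right)
  qed
  have "\<exists>M\<ge>0. \<forall>w. w \<in> cone_set \<longrightarrow> fst w \<le> T \<longrightarrow> \<bar>R1 w $ j\<bar> \<le> M" for j
    using cone_extension_bounded[OF cR(1), of T j] by (metis indicator_simps(1) mult_1)
  then obtain MR where MR: "\<And>j. 0 \<le> MR j" "\<And>j w. w \<in> cone_set \<Longrightarrow> fst w \<le> T \<Longrightarrow> \<bar>R1 w $ j\<bar> \<le> MR j" by metis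
  have "\<exists>M\<ge>0. \<forall>w. w \<in> cone_set \<longrightarrow> fst w \<le> T \<longrightarrow> \<bar>P2 (snd w) $ i $ j\<bar> \<le> M" for i j
  proof -
    have "continuous_on cone_set (\<lambda>w :: spacetime. P2 (snd w) $ i $ j)"
      by (rule continuous_on_compose2[OF cP(2)]) (auto intro!: continuous_intros)
    from cone_extension_bounded[OF this, of T] show ?thesis by (metis indicator_simps(1) mult_1)
  qed
  then obtain MP where MP: "\<And>i j. 0 \<le> MP i j" "\<And>i j w. w \<in> cone_set \<Longrightarrow> fst w \<le> T \<Longrightarrow> \<bar>P2 (snd w) $ i $ j\<bar> \<le> MP i j"
    by metis
  \<comment> \<open>The first sum bounds the factor of \<open>b\<close>, the second the entries of
    the second coefficient matrix; a single constant serves both kinds of terms.\<close>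
  define C where "C = (\<Sum>j\<in>UNIV. MR j) + (\<Sum>i\<in>UNIV. \<Sum>j\<in>UNIV. MP i j)"
  have bound: "\<bar>S i w\<bar> \<le> C * (\<bar>b (norm (snd w) + norm (snd w - e1))\<bar> + (\<Sum>j\<in>UNIV. \<bar>r j w\<bar>))"
    if w: "w \<in> cone_set" "fst w + norm (snd w - e1) \<le> T" for i w
  proof -
    have t: "fst w \<le> T" using w(2) norm_ge_zero[of "snd w - e1"] by linarith
    have MPC: "MP i j \<le> C" for j
    proof -
      have "MP i j \<le> (\<Sum>j\<in>UNIV. MP i j)" using MP(1) by (intro member_le_sum) auto
      also have "\<dots> \<le> (\<Sum>i\<in>UNIV. \<Sum>j\<in>UNIV. MP i j)"
        using MP(1) by (intro member_le_sum[where f="\<lambda>i. \<Sum>j\<in>UNIV. MP i j"] sum_nonneg) auto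
      finally show ?thesis unfolding C_def using MR(1) by (simp add: add_increasing sum_nonneg)
    qed
    have MRC: "(\<Sum>j\<in>UNIV. MR j) \<le> C" unfolding C_def using MP(1) by (simp add: sum_nonneg)
    \<comment> \<open>This is the splitting P1 R1 - P2 R2 = (P1 - P2) R1 + P2 (R1 - R2).\<close>
    have "S i w = (\<Sum>j\<in>UNIV. k i j * d (snd w) * R1 w $ j + P2 (snd w) $ i $ j * r j w)"
      unfolding S_def kd[symmetric] r_def by (intro sum.cong refl) (simp add: algebra_simps)
    also have "\<bar>\<dots>\<bar> \<le> (\<Sum>j\<in>UNIV. \<bar>k i j * d (snd w) * R1 w $ j + P2 (snd w) $ i $ j * r j w\<bar>)" by (rule sum_abs)
    also have "\<dots> \<le> (\<Sum>j\<in>UNIV. MR j * \<bar>d (snd w)\<bar> + C * \<bar>r j w\<bar>)"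
    proof (rule sum_mono)
      fix j
      have "\<bar>k i j\<bar> * \<bar>R1 w $ j\<bar> \<le> 1 * MR j" using k1 MR(2)[OF w(1) t] by (intro mult_mono) auto
      then have "\<bar>k i j\<bar> * \<bar>R1 w $ j\<bar> * \<bar>d (snd w)\<bar> \<le> MR j * \<bar>d (snd w)\<bar>" by (intro mult_right_mono) auto
      then have 1: "\<bar>k i j * d (snd w) * R1 w $ j\<bar> \<le> MR j * \<bar>d (snd w)\<bar>" by (simp add: abs_mult mult_ac)
      have "\<bar>P2 (snd w) $ i $ j\<bar> \<le> C" using MP(2)[OF w(1) t, of i j] MPC[of j] by linarith
      then have "\<bar>P2 (snd w) $ i $ j * r j w\<bar> \<le> C * \<bar>r j w\<bar>" unfolding abs_mult by (intro mult_right_mono) auto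
      then show "\<bar>k i j * d (snd w) * R1 w $ j + P2 (snd w) $ i $ j * r j w\<bar> \<le> MR j * \<bar>d (snd w)\<bar> + C * \<bar>r j w\<bar>"
        using 1 by linarith
    qed
    also have "\<dots> = (\<Sum>j\<in>UNIV. MR j) * \<bar>d (snd w)\<bar> + C * (\<Sum>j\<in>UNIV. \<bar>r j w\<bar>)"
      by (simp only: sum.distrib sum_distrib_right sum_distrib_left)
    also have "\<dots> \<le> C * \<bar>d (snd w)\<bar> + C * (\<Sum>j\<in>UNIV. \<bar>r j w\<bar>)"
      using MRC by (intro add_right_mono mult_right_mono) auto
    finally show ?thesis unfolding bd by (simp only: distrib_left)
  qed
  interpret ellipsoidal_difference T e1 b r S "\<lambda>i. \<Sum>j\<in>UNIV. k i j" C
  proof (rule ellipsoidal_difference.intro)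
    show "r 1 (t, e1) = 0" if "1 < t" "t \<le> T" for t using assms(13) that by (simp add: r_def)
  qed (rule assms(1) norm_e1 cb wave k0 | erule (1) bound)+
  show ?thesis
  proof (intro allI impI)
    fix x assume "norm x + norm (x - e1) \<le> T"
    then have "d x = 0" using b_zero[OF ge1] by (simp add: bd)
    then have "P1 x $ i $ j = P2 x $ i $ j" for i j using kd[of x i j] by simp
    then show "P1 x = P2 x" by (simp add: vec_eq_iff)
  qed
qed

end
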